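(* Let $X$ be a Banach space, $\varphi:X\to\,]-\infty,+\infty]$ be a proper lower semicontinuous function, and $\alpha>0$. Consider: (a) $\varphi$ is $\alpha$-robustly quasiconvex; (b) for all $x,y\in X$ with $\varphi(y)\le\varphi(x)$, one has $$\langle x^*,y-x\rangle\le-\min\{\alpha\|y-x\|,\ \varphi(x)-\varphi(y)\}\quad\text{for all }x^*\in\widehat\partial\varphi(x).$$ Then (a) implies (b). If in addition $X$ is an Asplund space, then (b) implies (a).
   Context: A function $f$ is quasiconvex if $f(\lambda x+(1-\lambda)y)\le\max\{f(x),f(y)\}$ for all $x,y\in X$, $\lambda\in\,]0,1[$. For $v^*\in X^*$, $\varphi_{v^*}(x):=\varphi(x)+\langle v^*,x\rangle$. $\varphi$ is $\alpha$-robustly quasiconvex if $\varphi_{v^*}$ is quasiconvex for every $v^*\in X^*$ with $\|v^*\|\le\alpha$. For $x\in\operatorname{dom}\varphi=\{x:\varphi(x)<\infty\}$, the Fréchet subdifferential is $\widehat\partial\varphi(x)=\{x^*\in X^*:\ \liminf_{y\to x}\frac{\varphi(y)-\varphi(x)-\langle x^*,y-x\rangle}{\|y-x\|}\ge 0\}$, and $\widehat\partial\varphi(x)=\emptyset$ otherwise. An Asplund space is a Banach space every separable subspace of which has separable dual. *)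

theory Defs
  imports "HOL-Analysis.Analysis"
begin

text \<open>Extended-real-valued functions \<open>X \<Rightarrow> ]-\<infinity>,+\<infinity>]\<close> are modelled as \<open>X \<Rightarrow> ereal\<close>
  never taking the value \<open>-\<infinity>\<close>. Elements of the dual \<open>X*\<close> are bounded linear
  functionals \<open>'a \<Rightarrow>\<^sub>L real\<close>, with the operator norm.\<close>

definition proper_fun :: "('a \<Rightarrow> ereal) \<Rightarrow> bool" where
  "proper_fun f \<longleftrightarrow> (\<forall>x. f x \<noteq> -\<infinity>) \<and> (\<exists>x. f x \<noteq> \<infinity>)"

definition lsc_fun :: "('a::topological_space \<Rightarrow> ereal) \<Rightarrow> bool" where
  "lsc_fun f \<longleftrightarrow> (\<forall>x. f x \<le> Liminf (at x) f)"

definition quasiconvex :: "('a::real_vector \<Rightarrow> ereal) \<Rightarrow> bool" where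
  "quasiconvex f \<longleftrightarrow>
     (\<forall>x y. \<forall>t::real. 0 < t \<and> t < 1 \<longrightarrow>
        f (t *\<^sub>R x + (1 - t) *\<^sub>R y) \<le> max (f x) (f y))"

definition tilt :: "('a::real_normed_vector \<Rightarrow> ereal) \<Rightarrow> ('a \<Rightarrow>\<^sub>L real) \<Rightarrow> 'a \<Rightarrow> ereal" where
  "tilt \<phi> v x = \<phi> x + ereal (blinfun_apply v x)"

definition robustly_quasiconvex :: "real \<Rightarrow> ('a::real_normed_vector \<Rightarrow> ereal) \<Rightarrow> bool" where
  "robustly_quasiconvex \<alpha> \<phi> \<longleftrightarrow> (\<forall>v. norm v \<le> \<alpha> \<longrightarrow> quasiconvex (tilt \<phi> v))"

definition frechet_subdiff :: "('a::real_normed_vector \<Rightarrow> ereal) \<Rightarrow> 'a \<Rightarrow> ('a \<Rightarrow>\<^sub>L real) set" where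
  "frechet_subdiff \<phi> x =
     (if \<phi> x < \<infinity> then
        {xs. Liminf (at x)
               (\<lambda>y. (\<phi> y - \<phi> x - ereal (blinfun_apply xs (y - x))) / ereal (norm (y - x))) \<ge> 0}
      else {})"

definition separable_set :: "'a::metric_space set \<Rightarrow> bool" where
  "separable_set Y \<longleftrightarrow> (\<exists>D. countable D \<and> D \<subseteq> Y \<and> Y \<subseteq> closure D)"

text \<open>Continuous linear functionals on a linear subspace \<open>Y\<close> (values outside \<open>Y\<close> irrelevant).\<close>
definition dual_on :: "'a::real_normed_vector set \<Rightarrow> ('a \<Rightarrow> real) set" where
  "dual_on Y = {f. (\<forall>a\<in>Y. \<forall>b\<in>Y. f (a + b) = f a + f b) \<and> (\<forall>c. \<forall>a\<in>Y. f (c *\<^sub>R a) = c * f a)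
                  \<and> (\<exists>K. \<forall>y\<in>Y. \<bar>f y\<bar> \<le> K * norm y)}"

text \<open>Separability of the dual \<open>Y*\<close> with respect to the dual (operator) norm:
  \<open>\<parallel>g - f\<parallel>\<^sub>Y\<^sub>* \<le> \<epsilon>\<close> iff \<open>|g y - f y| \<le> \<epsilon> \<parallel>y\<parallel>\<close> for all \<open>y \<in> Y\<close>.\<close>
definition separable_dual :: "'a::real_normed_vector set \<Rightarrow> bool" where
  "separable_dual Y \<longleftrightarrow>
     (\<exists>F. countable F \<and> F \<subseteq> dual_on Y \<and>
        (\<forall>g\<in>dual_on Y. \<forall>\<epsilon>>0. \<exists>f\<in>F. \<forall>y\<in>Y. \<bar>g y - f y\<bar> \<le> \<epsilon> * norm y))"

definition asplund_space :: "'a::banach itself \<Rightarrow> bool" where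
  "asplund_space _ \<longleftrightarrow>
     (\<forall>Y::'a set. subspace Y \<and> closed Y \<and> separable_set Y \<longrightarrow> separable_dual Y)"

end

theory Submission
  imports Defs
begin

text \<open>
  The implication from (a) to (b) tests quasiconvexity of the tilt by a multiple of a functional
  norming \<open>y - x\<close>, scaled so that the tilted value at \<open>y\<close> does not exceed that at \<open>x\<close>.

  For the converse, let \<open>z\<close> on the segment from \<open>y\<close> to \<open>x\<close> violate quasiconvexity of a tilt \<open>f\<close>. A mean
  value theorem yields a Frechet subgradient \<open>l\<close> of \<open>f\<close> at some \<open>c\<close> near \<open>[y, z]\<close> with
  \<open>l (x - c) > max 0 (f x - f c)\<close>, which contradicts (b) at \<open>c\<close> as soon as \<open>\<phi> x \<le> \<phi> c\<close>. The latter holds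
  for \<open>\<phi> x \<le> \<phi> y\<close> once \<open>\<phi>\<close> itself is known to be quasiconvex, which is proved first by two applications
  of the same mean value theorem.

  The mean value theorem is reduced to a separable subspace \<open>Y\<close>, to whose dual the Asplund property
  applies: \<open>Y\<close> is closed under finding finite families that witness the failure of a Frechet
  subgradient to extend to the whole space. Since the dual of \<open>Y\<close> is separable, the norm of \<open>Y\<close> is a
  uniform limit of convex Frechet smooth functions, and these serve as perturbations in a variational
  principle of Borwein--Preiss type.
\<close>

section \<open>Hahn--Banach\<close>

text \<open>The minimum in (b) matches the two bounds of the mean value theorem. If \<open>l\<close>
  is a subgradient at \<open>c\<close> of the tilt \<open>f\<close> by \<open>v\<close>, then
  \<open>l - v\<close> is one of \<phi>, and (b) gives
  \<open>l (x - c) \<le> v (x - c) - \<alpha> * norm (x - c) \<le> 0\<close> or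
  \<open>l (x - c) \<le> f x - f c\<close>. Both must be excluded for the same subgradient.

  The obstacle is \<open>\<phi> x \<le> \<phi> c\<close>: the mean value theorem only places
  \<open>c\<close> near a segment and says nothing about the untilted values there. Quasiconvexity
  of \<phi> keeps them above \<open>\<phi> x\<close> on the segment, and semicontinuity extends this
  to a neighbourhood.

  An Asplund space may lack any Frechet smooth norm, which is why the variational principle is
  confined to a separable subspace. A subgradient found there carries no information off the
  subspace, so the subspace has to be built from \<open>f\<close>. The smooth gauges serve as
  penalties that keep \<open>c\<close> near the segment and as perturbations; a uniform
  approximation of the norm is enough for both.\<close>

definition sublinear :: "('a::real_vector \<Rightarrow> real) \<Rightarrow> bool" where
  "sublinear q \<longleftrightarrow> (\<forall>x y. q (x + y) \<le> q x + q y) \<and> (\<forall>c x. 0 \<le> c \<longrightarrow> q (c *\<^sub>R x) = c * q x)"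

text \<open>Applied with \<open>inverse c\<close> at \<open>c *\<^sub>R x\<close>, the inequality
  for positive scalars yields its own converse.\<close>

lemma sublinearI:
  assumes "\<And>x y. q (x + y) \<le> q x + q y"
    and "q 0 = 0" and "\<And>c x. 0 < c \<Longrightarrow> q (c *\<^sub>R x) \<le> c * q x"
  shows "sublinear q"
  unfolding sublinear_def
proof (intro conjI allI impI)
  fix c :: real and x assume "0 \<le> c"
  show "q (c *\<^sub>R x) = c * q x"
  proof (cases "c = 0")
    case False
    with \<open>0 \<le> c\<close> have c: "0 < c" by simp
    have "q (inverse c *\<^sub>R (c *\<^sub>R x)) \<le> inverse c * q (c *\<^sub>R x)"
      using c by (intro assms(3)) simp
    then have "q x \<le> inverse c * q (c *\<^sub>R x)" using c by simp
    then have "c * q x \<le> q (c *\<^sub>R x)" using c by (simp add: field_simps)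
    with assms(3)[OF c, of x] show ?thesis by simp
  qed (use assms(2) in simp)
qed (rule assms(1))

lemma sublinear_zero: "sublinear q \<Longrightarrow> q 0 = 0"
  unfolding sublinear_def by (metis mult_zero_left order_refl scaleR_zero_left)

lemma sublinear_neg: "sublinear q \<Longrightarrow> - q (- x) \<le> q x"
  using sublinear_zero[of q] unfolding sublinear_def
  by (simp add: neg_le_iff_le) (metis add.right_inverse minus_le_iff neg_le_iff_le real_0_le_add_iff)

text \<open>A minimal sublinear functional is linear, since it can be lowered along any ray.\<close>
theorem sublinear_dominates_linear:
  fixes P :: "'a::real_vector \<Rightarrow> real"
  assumes P: "sublinear P"
  obtains l where "linear l" "\<And>x. l x \<le> P x"
proof -
  define A where "A = {q. sublinear q \<and> (\<forall>x. q x \<le> P x)}"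
  have lower: "- P (- x) \<le> q x" if "q \<in> A" for q x
    using sublinear_neg[of q x] that unfolding A_def
    by (smt (verit, best) mem_Collect_eq)
  have "\<exists>m\<in>A. \<forall>a\<in>A. (\<forall>x. a x \<le> m x) \<longrightarrow> a = m"
  proof (rule predicate_Zorn)
    show "partial_order_on A (relation_of (\<lambda>a b. \<forall>x. b x \<le> a x) A)"
      unfolding partial_order_on_def preorder_on_def
    proof (intro conjI)
      show "antisym (relation_of (\<lambda>a b. \<forall>x. b x \<le> a x) A)"
        unfolding antisym_def relation_of_def by (auto intro!: ext order.antisym)
      show "trans (relation_of (\<lambda>a b. \<forall>x. b x \<le> a x) A)"
        unfolding trans_def relation_of_def by (auto intro: order_trans)
    qed (auto simp: refl_on_def relation_of_def)
  next
    fix C assume C: "C \<in> Chains (relation_of (\<lambda>a b. \<forall>x. b x \<le> a x) A)"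
    show "\<exists>u\<in>A. \<forall>a\<in>C. \<forall>x. u x \<le> a x"
    proof (cases "C = {}")
      case True
      then show ?thesis using P unfolding A_def by auto
    next
      case False
      have CA: "C \<subseteq> A" and tot: "\<And>a b. a \<in> C \<Longrightarrow> b \<in> C \<Longrightarrow> (\<forall>x. a x \<le> b x) \<or> (\<forall>x. b x \<le> a x)"
        using C unfolding Chains_def relation_of_def by auto
      define u where "u x = (INF q\<in>C. q x)" for x
      have bdd: "bdd_below ((\<lambda>q. q x) ` C)" for x
        using CA lower by (intro bdd_belowI[of _ "- P (- x)"]) auto
      have ule: "u x \<le> q x" if "q \<in> C" for q x
        unfolding u_def using bdd that by (intro cINF_lower) auto
      have uge: "c \<le> u x" if "\<And>q. q \<in> C \<Longrightarrow> c \<le> q x" for c x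
        unfolding u_def using False that by (intro cINF_greatest) auto
      have sub: "sublinear q" if "q \<in> C" for q using that CA unfolding A_def by auto
      have "sublinear u"
      proof (rule sublinearI)
        fix x y
        \<comment> \<open>Two members of a chain are comparable; subadditivity of the smaller one
          gives the bound. The infima over \<open>q1\<close> and \<open>q2\<close> are then taken
          one after the other.\<close>
        have *: "u (x + y) - q1 x \<le> q2 y" if "q1 \<in> C" "q2 \<in> C" for q1 q2
        proof -
          have a: "q1 (x + y) \<le> q1 x + q1 y" "q2 (x + y) \<le> q2 x + q2 y"
            using sub that unfolding sublinear_def by auto
          show ?thesis
            using tot[OF that] ule[OF that(1), of "x+y"] ule[OF that(2), of "x+y"] a
            by (smt (verit, best))
        qed
        have "u (x + y) - u y \<le> q1 x" if "q1 \<in> C" for q1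
          using uge[of "u (x + y) - q1 x" y] *[OF that] by fastforce
        then have "u (x + y) - u y \<le> u x" by (rule uge)
        then show "u (x + y) \<le> u x + u y" by simp
      next
        have "(\<lambda>q. q 0) ` C = {0}" using False sublinear_zero[OF sub] by (metis (mono_tags, lifting) image_constant_conv image_cong)
        then show "u 0 = 0" unfolding u_def by simp
      next
        fix c :: real and x assume c: "0 < c"
        have "u (c *\<^sub>R x) / c \<le> q x" if "q \<in> C" for q
          using ule[OF that, of "c *\<^sub>R x"] sub[OF that] c unfolding sublinear_def
          by (simp add: field_simps)
        then have "u (c *\<^sub>R x) / c \<le> u x" by (rule uge)
        then show "u (c *\<^sub>R x) \<le> c * u x" using c by (simp add: field_simps)
      qed
      moreover have "u x \<le> P x" for x
        using False ule CA unfolding A_def by (metis (mono_tags, lifting) ex_in_conv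
            mem_Collect_eq order_trans subset_iff)
      ultimately show ?thesis using ule unfolding A_def by blast
    qed
  qed
  then obtain q where qA: "q \<in> A" and min: "\<And>a. a \<in> A \<Longrightarrow> (\<And>x. a x \<le> q x) \<Longrightarrow> a = q"
    by blast
  have q: "sublinear q" and qP: "\<And>x. q x \<le> P x" using qA unfolding A_def by auto
  have qadd: "q (x + y) \<le> q x + q y" and qsc: "0 \<le> c \<Longrightarrow> q (c *\<^sub>R x) = c * q x" for x y c
    using q unfolding sublinear_def by auto
  have neg: "q (- z) = - q z" for z
  proof -
    \<comment> \<open>This lowers \<open>q\<close> along the ray of \<open>z\<close>:
      \<open>r \<le> q\<close>, and \<open>t = 1\<close> gives \<open>r (- z) \<le> - q z\<close>.
      Minimality forces \<open>r = q\<close>, so \<open>q\<close> is odd, and an odd sublinear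
      function is linear.\<close>
    define r where "r x = (INF t\<in>{0..}. q (x + t *\<^sub>R z) - t * q z)" for x
    have low: "- q (- x) \<le> q (x + t *\<^sub>R z) - t * q z" if "0 \<le> t" for x t
    proof -
      have "q (t *\<^sub>R z) \<le> q (x + t *\<^sub>R z) + q (- x)"
        using qadd[of "x + t *\<^sub>R z" "- x"] by (simp add: algebra_simps)
      then show ?thesis using qsc[OF that, of z] by simp
    qed
    have rle: "r x \<le> q (x + t *\<^sub>R z) - t * q z" if "0 \<le> t" for x t
      unfolding r_def using that low
      by (intro cINF_lower bdd_belowI[of _ "- q (- x)"]) auto
    have rge: "c \<le> r x" if "\<And>t. 0 \<le> t \<Longrightarrow> c \<le> q (x + t *\<^sub>R z) - t * q z" for c x
      unfolding r_def using that by (intro cINF_greatest) auto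
    have rq: "r x \<le> q x" for x using rle[of 0 x] by simp
    have "sublinear r"
    proof (rule sublinearI)
      fix x y
      have *: "r (x + y) - (q (x + s *\<^sub>R z) - s * q z) \<le> q (y + t *\<^sub>R z) - t * q z"
        if "0 \<le> s" "0 \<le> t" for s t
        using rle[of "s + t" "x + y"] qadd[of "x + s *\<^sub>R z" "y + t *\<^sub>R z"] that
        by (simp add: algebra_simps)
      have "r (x + y) - r y \<le> q (x + s *\<^sub>R z) - s * q z" if "0 \<le> s" for s
        using rge[of "r (x + y) - (q (x + s *\<^sub>R z) - s * q z)" y] *[OF that] by fastforce
      then have "r (x + y) - r y \<le> r x" by (rule rge)
      then show "r (x + y) \<le> r x + r y" by simp
    next
      show "r 0 = 0"
        using rq[of 0] rge[of 0 0] qsc sublinear_zero[OF q] by fastforce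
    next
      fix c :: real and x assume c: "0 < c"
      have "r (c *\<^sub>R x) / c \<le> q (x + t *\<^sub>R z) - t * q z" if "0 \<le> t" for t
        using rle[of "c * t" "c *\<^sub>R x"] qsc[of c "x + t *\<^sub>R z"] c that
        by (simp add: field_simps scaleR_add_right)
      then have "r (c *\<^sub>R x) / c \<le> r x" by (rule rge)
      then show "r (c *\<^sub>R x) \<le> c * r x" using c by (simp add: field_simps)
    qed
    then have "r \<in> A" unfolding A_def using rq qP order_trans by blast
    then have "r = q" using min rq by blast
    then have "q (- z) \<le> - q z" using rle[of 1 "- z"] sublinear_zero[OF q] by simp
    then show ?thesis using sublinear_neg[OF q, of z] by simp
  qed
  have "linear q"
  proof (rule linearI)
    fix x y
    have "q (- x + - y) \<le> q (- x) + q (- y)" by (rule qadd)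
    then have "- q (x + y) \<le> - q x - q y" using neg[of "x + y"] neg by simp
    then show "q (x + y) = q x + q y" using qadd[of x y] by simp
  next
    fix c :: real and x
    show "q (c *\<^sub>R x) = c *\<^sub>R q x"
      using qsc[of c x] qsc[of "- c" x] neg[of "c *\<^sub>R x"] by (cases "0 \<le> c") auto
  qed
  then show thesis using qP that by blast
qed

text \<open>\<open>P\<close> is the infimal convolution of the upper bounds collected in
  \<open>A\<close> with \<open>K * norm\<close>; \<open>pos\<close> keeps it finite. A linear
  minorant of \<open>P\<close> has norm at most \<open>K\<close> because \<open>(0, 0)\<close> lies
  in \<open>A\<close>, and lies below the cone because \<open>P h \<le> a\<close> whenever
  \<open>(h, a) \<in> A\<close>.\<close>

theorem functional_below_cone:
  fixes A :: "('a::real_normed_vector \<times> real) set"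
  assumes zero: "(0, 0) \<in> A"
    and add: "\<And>h a k b. (h, a) \<in> A \<Longrightarrow> (k, b) \<in> A \<Longrightarrow> (h + k, a + b) \<in> A"
    and scale: "\<And>c h a. 0 < c \<Longrightarrow> (h, a) \<in> A \<Longrightarrow> (c *\<^sub>R h, c * a) \<in> A"
    and K: "0 \<le> K" and pos: "\<And>h a. (h, a) \<in> A \<Longrightarrow> 0 \<le> a + K * norm h"
  obtains l :: "'a \<Rightarrow>\<^sub>L real" where "norm l \<le> K" "\<And>h a. (h, a) \<in> A \<Longrightarrow> blinfun_apply l h \<le> a"
proof -
  define P where "P v = (INF p\<in>A. snd p + K * norm (v - fst p))" for v
  have low: "- K * norm v \<le> a + K * norm (v - h)" if "(h, a) \<in> A" for v h a
  proof -
    have "K * norm h \<le> K * (norm (v - h) + norm v)"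
      using norm_triangle_ineq4[of v "v - h"] K by (intro mult_left_mono) auto
    then show ?thesis using pos[OF that] by (simp add: algebra_simps)
  qed
  have Ple: "P v \<le> a + K * norm (v - h)" if "(h, a) \<in> A" for v h a
  proof -
    have "P v \<le> snd (h, a) + K * norm (v - fst (h, a))"
      unfolding P_def using that low
      by (intro cINF_lower bdd_belowI[of _ "- K * norm v"]) auto
    then show ?thesis by simp
  qed
  have Pge: "c \<le> P v" if "\<And>h a. (h, a) \<in> A \<Longrightarrow> c \<le> a + K * norm (v - h)" for c v
    unfolding P_def using that zero by (intro cINF_greatest) auto
  have "sublinear P"
  proof (rule sublinearI)
    fix x y
    have *: "P (x + y) - (a + K * norm (x - h)) \<le> b + K * norm (y - k)"
      if "(h, a) \<in> A" "(k, b) \<in> A" for h a k b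
    proof -
      have "K * norm (x + y - (h + k)) \<le> K * (norm (x - h) + norm (y - k))"
        using K norm_triangle_ineq[of "x - h" "y - k"]
        by (intro mult_left_mono) (auto simp: algebra_simps)
      then show ?thesis using Ple[OF add[OF that], of "x + y"] by (simp add: algebra_simps)
    qed
    have "P (x + y) - P y \<le> a + K * norm (x - h)" if "(h, a) \<in> A" for h a
      using Pge[of "P (x + y) - (a + K * norm (x - h))" y] *[OF that] by fastforce
    then have "P (x + y) - P y \<le> P x" by (rule Pge)
    then show "P (x + y) \<le> P x + P y" by simp
  next
    show "P 0 = 0" using Ple[OF zero, of 0] Pge[of 0 0] pos by fastforce
  next
    fix c :: real and x assume c: "0 < c"
    have "P (c *\<^sub>R x) / c \<le> a + K * norm (x - h)" if "(h, a) \<in> A" for h a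
    proof -
      have "norm (c *\<^sub>R x - c *\<^sub>R h) = c * norm (x - h)"
        using c by (simp flip: scaleR_diff_right)
      then show ?thesis
        using Ple[OF scale[OF c that], of "c *\<^sub>R x"] c by (simp add: field_simps)
    qed
    then have "P (c *\<^sub>R x) / c \<le> P x" by (rule Pge)
    then show "P (c *\<^sub>R x) \<le> c * P x" using c by (simp add: field_simps)
  qed
  then obtain l where l: "linear l" "\<And>x. l x \<le> P x" using sublinear_dominates_linear by blast
  have le: "l x \<le> K * norm x" for x using l(2)[of x] Ple[OF zero, of x] by simp
  have abs: "\<bar>l x\<bar> \<le> K * norm x" for x
    using le[of x] le[of "- x"] linear_neg[OF l(1), of x] by simp
  have bl: "bounded_linear l"
    using l(1) abs by (intro bounded_linear_intro[of l K])
      (auto simp: linear_add linear_cmul mult.commute)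
  show thesis
  proof
    show "norm (Blinfun l) \<le> K"
      using abs K by (intro norm_blinfun_bound) (auto simp: bounded_linear_Blinfun_apply[OF bl])
    fix h a assume "(h, a) \<in> A"
    then show "blinfun_apply (Blinfun l) h \<le> a"
      using l(2)[of h] Ple[of h a h] by (simp add: bounded_linear_Blinfun_apply[OF bl])
  qed
qed

text \<open>Lying below the ray through \<open>(- x, - norm x)\<close> means
  \<open>norm x \<le> l x\<close>; along this ray the cone condition with \<open>K = 1\<close> is an
  equality.\<close>

corollary norming_functional:
  fixes x :: "'a::real_normed_vector"
  obtains l :: "'a \<Rightarrow>\<^sub>L real" where "norm l \<le> 1" "blinfun_apply l x = norm x"
proof -
  define A where "A = {(- c *\<^sub>R x, - c * norm x) | c::real. 0 \<le> c}"
  have "0 \<le> a + 1 * norm h" if "(h, a) \<in> A" for h a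
    using that unfolding A_def by auto
  moreover have "(0, 0) \<in> A" unfolding A_def by (auto intro!: exI[of _ 0])
  moreover have "(h + k, a + b) \<in> A" if 1: "(h, a) \<in> A" and 2: "(k, b) \<in> A" for h a k b
  proof -
    obtain c :: real where "0 \<le> c" "h = - c *\<^sub>R x" "a = - c * norm x"
      using 1 unfolding A_def by auto
    moreover obtain d :: real where "0 \<le> d" "k = - d *\<^sub>R x" "b = - d * norm x"
      using 2 unfolding A_def by auto
    ultimately show ?thesis unfolding A_def
      by (auto intro!: exI[of _ "c + d"] simp: algebra_simps)
  qed
  moreover have "(c *\<^sub>R h, c * a) \<in> A" if 1: "0 < c" and 2: "(h, a) \<in> A" for c h a
  proof -
    obtain d :: real where "0 \<le> d" "h = - d *\<^sub>R x" "a = - d * norm x"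
      using 2 unfolding A_def by auto
    then show ?thesis using 1 unfolding A_def by (auto intro!: exI[of _ "c * d"])
  qed
  ultimately obtain l :: "'a \<Rightarrow>\<^sub>L real"
    where l: "norm l \<le> 1" "\<And>h a. (h, a) \<in> A \<Longrightarrow> blinfun_apply l h \<le> a"
    using functional_below_cone[of A 1] by (metis zero_le_one)
  have "(- x, - norm x) \<in> A" unfolding A_def by (auto intro!: exI[of _ 1])
  then have "norm x \<le> blinfun_apply l x" using l(2) by (fastforce simp: blinfun.minus_right)
  moreover have "blinfun_apply l x \<le> norm x"
    using norm_blinfun[of l x] l(1) mult_right_mono[of "norm l" 1 "norm x"] by simp
  ultimately show thesis using that[OF l(1)] by simp
qed

section \<open>Lower semicontinuity and Frechet subgradients\<close>

lemma lsc_fun_iff_open: "lsc_fun f \<longleftrightarrow> (\<forall>a. open {x. a < f x})"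
proof
  assume f: "lsc_fun f"
  show "\<forall>a. open {x. a < f x}"
  proof
    fix a
    have "\<forall>\<^sub>F y in nhds x. a < f y" if "a < f x" for x
    proof -
      have "a < Liminf (at x) f" using that f unfolding lsc_fun_def by (meson less_le_trans)
      then show ?thesis using that less_LiminfD by (auto simp: eventually_nhds_conv_at)
    qed
    then show "open {x. a < f x}"
      by (subst open_subopen) (simp add: eventually_nhds subset_iff Ball_def)
  qed
next
  assume o: "\<forall>a. open {x. a < f x}"
  show "lsc_fun f"
    unfolding lsc_fun_def le_Liminf_iff eventually_at_topological using o by blast
qed

text \<open>Multiplying out the quotient removes division and subtraction of infinite values. The
  non-strict inequality includes \<open>y = x\<close>; strictness is regained for other points by
  halving \<epsilon>.\<close>

lemma frechet_subdiff_iff: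
  fixes f :: "'a::real_normed_vector \<Rightarrow> ereal"
  assumes fx: "f x = ereal a" and ninf: "\<And>y. f y \<noteq> -\<infinity>"
  shows "l \<in> frechet_subdiff f x \<longleftrightarrow>
    (\<forall>\<epsilon>>0. \<exists>\<delta>>0. \<forall>y. norm (y - x) < \<delta> \<longrightarrow>
       ereal (a + blinfun_apply l (y - x) - \<epsilon> * norm (y - x)) \<le> f y)"
proof -
  have key: "ereal c < (f y - f x - ereal (blinfun_apply l (y - x))) / ereal (norm (y - x)) \<longleftrightarrow>
      ereal (a + blinfun_apply l (y - x) + c * norm (y - x)) < f y" if "y \<noteq> x" for c y
  proof (cases "f y")
    case (real b)
    have "norm (y - x) > 0" using that by simp
    then show ?thesis using real fx by (simp add: field_simps)
  next
    case PInf
    then show ?thesis using that fx by simp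
  qed (use ninf in simp)
  have "l \<in> frechet_subdiff f x \<longleftrightarrow> (\<forall>c<0. \<forall>\<^sub>F y in at x.
      c < (f y - f x - ereal (blinfun_apply l (y - x))) / ereal (norm (y - x)))"
    unfolding frechet_subdiff_def using fx by (simp add: le_Liminf_iff)
  also have "\<dots> \<longleftrightarrow> (\<forall>\<epsilon>>0. \<forall>\<^sub>F y in at x.
      ereal (- \<epsilon>) < (f y - f x - ereal (blinfun_apply l (y - x))) / ereal (norm (y - x)))"
    (is "?L = ?R")
  proof
    assume ?L
    then show ?R by (auto simp: zero_ereal_def)
  next
    assume R: ?R
    show ?L
    proof (intro allI impI)
      fix c :: ereal assume "c < 0"
      then obtain e where "c < ereal e" "ereal e < 0" using ereal_dense2 by blast
      then show "\<forall>\<^sub>F y in at x.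
        c < (f y - f x - ereal (blinfun_apply l (y - x))) / ereal (norm (y - x))"
        using R[rule_format, of "- e"]
        by (auto elim!: eventually_mono intro: less_trans)
    qed
  qed
  also have "\<dots> \<longleftrightarrow> (\<forall>\<epsilon>>0. \<forall>\<^sub>F y in at x.
      ereal (a + blinfun_apply l (y - x) - \<epsilon> * norm (y - x)) < f y)"
    using key[of _ "- _"]
    by (intro all_cong imp_cong refl eventually_cong iffI)
      (auto simp: eventually_at_filter)
  also have "\<dots> \<longleftrightarrow> (\<forall>\<epsilon>>0. \<exists>\<delta>>0. \<forall>y. norm (y - x) < \<delta> \<longrightarrow>
       ereal (a + blinfun_apply l (y - x) - \<epsilon> * norm (y - x)) \<le> f y)" (is "?L = ?R")
  proof
    assume L: ?L
    show ?R
    proof (intro allI impI)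
      fix \<epsilon> :: real assume "0 < \<epsilon>"
      then obtain d where "d > 0" "\<And>y. y \<noteq> x \<Longrightarrow> dist y x < d \<Longrightarrow>
          ereal (a + blinfun_apply l (y - x) - \<epsilon> * norm (y - x)) < f y"
        using L unfolding eventually_at by fastforce
      then show "\<exists>\<delta>>0. \<forall>y. norm (y - x) < \<delta> \<longrightarrow>
          ereal (a + blinfun_apply l (y - x) - \<epsilon> * norm (y - x)) \<le> f y"
        using fx by (intro exI[of _ d]) (metis blinfun.zero_right diff_self dist_norm
            less_imp_le mult_zero_right norm_zero order_refl add.right_neutral diff_zero)
    qed
  next
    assume R: ?R
    show ?L
    proof (intro allI impI)
      fix \<epsilon> :: real assume e: "0 < \<epsilon>"
      then obtain d where d: "d > 0" "\<And>y. norm (y - x) < d \<Longrightarrow>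
          ereal (a + blinfun_apply l (y - x) - \<epsilon> / 2 * norm (y - x)) \<le> f y"
        using R[rule_format, of "\<epsilon> / 2"] by auto
      show "\<forall>\<^sub>F y in at x. ereal (a + blinfun_apply l (y - x) - \<epsilon> * norm (y - x)) < f y"
        unfolding eventually_at
      proof (intro exI[of _ d] conjI ballI impI d(1))
        fix y assume y: "y \<noteq> x \<and> dist y x < d"
        have "ereal (a + blinfun_apply l (y - x) - \<epsilon> * norm (y - x))
            < ereal (a + blinfun_apply l (y - x) - \<epsilon> / 2 * norm (y - x))"
          using y e by simp
        also have "\<dots> \<le> f y" using d(2) y by (simp add: dist_norm)
        finally show "ereal (a + blinfun_apply l (y - x) - \<epsilon> * norm (y - x)) < f y" .
      qed
    qed
  qed
  finally show ?thesis .
qed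

section \<open>Smooth approximation of the norm when the dual is separable\<close>

text \<open>Bounding the functionals off \<open>Y\<close> as well makes this set compact in the product topology.\<close>
definition dual_ball :: "'a::real_normed_vector set \<Rightarrow> ('a \<Rightarrow> real) set" where
  "dual_ball Y = {\<xi>. (\<forall>y. \<bar>\<xi> y\<bar> \<le> norm y) \<and> (\<forall>a\<in>Y. \<forall>b\<in>Y. \<xi> (a + b) = \<xi> a + \<xi> b)
                  \<and> (\<forall>c. \<forall>a\<in>Y. \<xi> (c *\<^sub>R a) = c * \<xi> a)}"

lemma dual_ballD:
  assumes "\<xi> \<in> dual_ball Y"
  shows "\<bar>\<xi> y\<bar> \<le> norm y" "a \<in> Y \<Longrightarrow> b \<in> Y \<Longrightarrow> \<xi> (a + b) = \<xi> a + \<xi> b"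
    "a \<in> Y \<Longrightarrow> \<xi> (c *\<^sub>R a) = c * \<xi> a"
  using assms unfolding dual_ball_def by auto

lemma dual_ball_diff:
  assumes "\<xi> \<in> dual_ball Y" "subspace Y" "a \<in> Y" "b \<in> Y"
  shows "\<xi> (a - b) = \<xi> a - \<xi> b"
  using dual_ballD(2)[OF assms(1), of "a - b" b] subspace_diff[OF assms(2-4)] assms(4) by simp

text \<open>Banach-Alaoglu: a subset of a product of compact intervals, closed because each defining
  condition involves finitely many coordinates.\<close>

lemma compact_dual_ball: "compact (dual_ball Y)"
proof -
  have "compactin (product_topology (\<lambda>_. euclidean) UNIV) (PiE UNIV (\<lambda>y::'a. {- norm y..norm y}))"
    unfolding compactin_PiE by auto
  then have "compact (PiE UNIV (\<lambda>y::'a. {- norm y..norm y}))"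
    by (metis compactin_euclidean_iff euclidean_product_topology)
  moreover have "closed (dual_ball Y)"
  proof -
    have "dual_ball Y = (\<Inter>y. {\<xi>. \<bar>\<xi> y\<bar> \<le> norm y})
        \<inter> (\<Inter>a\<in>Y. \<Inter>b\<in>Y. {\<xi>. \<xi> (a + b) = \<xi> a + \<xi> b})
        \<inter> (\<Inter>c. \<Inter>a\<in>Y. {\<xi>. \<xi> (c *\<^sub>R a) = c * \<xi> a})"
      unfolding dual_ball_def by blast
    also have "closed \<dots>"
      by (intro closed_Int closed_INT ballI closed_Collect_le closed_Collect_eq continuous_intros)
        (auto intro!: continuous_intros)
    finally show ?thesis .
  qed
  moreover have "dual_ball Y \<subseteq> PiE UNIV (\<lambda>y. {- norm y..norm y})"
    using dual_ballD(1) by (auto simp: abs_le_iff minus_le_iff)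
  ultimately show ?thesis
    using closed_Int_compact inf.absorb1 by metis
qed

section \<open>Dual norms relative to a subspace\<close>

definition norm_on :: "'a::real_normed_vector set \<Rightarrow> ('a \<Rightarrow> real) \<Rightarrow> real" where
  "norm_on Y \<zeta> = (SUP y\<in>{y \<in> Y. norm y \<le> 1}. \<bar>\<zeta> y\<bar>)"

context
  fixes Y :: "'a::real_normed_vector set" and \<zeta> :: "'a \<Rightarrow> real" and C :: real
  assumes Y: "subspace Y" and bound: "\<And>y. y \<in> Y \<Longrightarrow> \<bar>\<zeta> y\<bar> \<le> C * norm y" and C: "0 \<le> C"
begin

lemma unit_bound: "y \<in> Y \<Longrightarrow> norm y \<le> 1 \<Longrightarrow> \<bar>\<zeta> y\<bar> \<le> C"
  using bound[of y] mult_left_mono[OF _ C, of "norm y" 1] by simp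

lemma norm_on_upper: "y \<in> Y \<Longrightarrow> norm y \<le> 1 \<Longrightarrow> \<bar>\<zeta> y\<bar> \<le> norm_on Y \<zeta>"
  unfolding norm_on_def using unit_bound by (intro cSUP_upper bdd_aboveI[of _ C]) auto

lemma norm_on_le: "(\<And>y. y \<in> Y \<Longrightarrow> norm y \<le> 1 \<Longrightarrow> \<bar>\<zeta> y\<bar> \<le> B) \<Longrightarrow> norm_on Y \<zeta> \<le> B"
  unfolding norm_on_def using subspace_0[OF Y] by (intro cSUP_least) auto

lemma norm_on_nonneg: "0 \<le> norm_on Y \<zeta>"
  using norm_on_upper[of 0] subspace_0[OF Y] by simp

lemma norm_on_le_bound: "norm_on Y \<zeta> \<le> C"
  using unit_bound by (rule norm_on_le)

lemma norm_on_approx: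
  assumes "0 < e"
  shows "\<exists>y. y \<in> Y \<and> norm y \<le> 1 \<and> norm_on Y \<zeta> - e < \<bar>\<zeta> y\<bar>"
proof (rule ccontr)
  assume "\<not> ?thesis"
  then have "norm_on Y \<zeta> \<le> norm_on Y \<zeta> - e" by (intro norm_on_le) force
  then show False using assms by simp
qed

lemma norm_on_apply:
  assumes hom: "\<And>c a. a \<in> Y \<Longrightarrow> \<zeta> (c *\<^sub>R a) = c * \<zeta> a" and y: "y \<in> Y"
  shows "\<bar>\<zeta> y\<bar> \<le> norm_on Y \<zeta> * norm y"
proof (cases "y = 0")
  case True
  then show ?thesis using bound[OF y] by simp
next
  case False
  have "\<bar>\<zeta> (inverse (norm y) *\<^sub>R y)\<bar> \<le> norm_on Y \<zeta>"
    using False y by (intro norm_on_upper subspace_scale[OF Y]) auto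
  then show ?thesis using False hom[OF y] by (simp add: abs_mult field_simps)
qed

end

text \<open>The identity \<open>(a\<^sup>2 + b\<^sup>2) / 2 - ((a + b) / 2)\<^sup>2 = ((a - b) /
  2)\<^sup>2\<close>. It is the reason for squaring distances in the penalty: a small midpoint gap
  forces two distances to agree.\<close>

lemma midpoint_square_gap:
  fixes a b c :: real
  assumes "0 \<le> c" "c \<le> (a + b) / 2"
  shows "((a - b) / 2)\<^sup>2 \<le> (a\<^sup>2 + b\<^sup>2) / 2 - c\<^sup>2"
proof -
  have "c\<^sup>2 \<le> ((a + b) / 2)\<^sup>2" using assms by (intro power_mono)
  then show ?thesis by (simp add: power2_eq_square field_simps)
qed

text \<open>The functional \<xi> is a convex subgradient and a Frechet derivative at once: the
  subgradient inequality is the lower half of differentiability, so only the upper half remains to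
  be required.\<close>

definition smooth_gauge :: "'a::real_normed_vector set \<Rightarrow> real \<Rightarrow> ('a \<Rightarrow> real) \<Rightarrow> bool" where
  "smooth_gauge Y \<eta> N \<longleftrightarrow>
     (\<forall>x\<in>Y. norm x - \<eta> \<le> N x \<and> N x \<le> norm x \<and>
        (\<exists>\<xi>\<in>dual_ball Y. (\<forall>h\<in>Y. N x + \<xi> h \<le> N (x + h)) \<and>
           (\<forall>\<epsilon>>0. \<exists>\<delta>>0. \<forall>h\<in>Y. norm h < \<delta> \<longrightarrow> N (x + h) \<le> N x + \<xi> h + \<epsilon> * norm h)))"

text \<open>The gauge is \<open>N x = sup \<xi>. \<xi> x - c J \<xi>\<close> over the dual ball, with \<open>J\<close> a weighted sum of the
  squared distances to a countable dense set \<open>g 0, g 1, \<dots>\<close>. If the midpoint gap of \<open>J\<close> is small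
  for \<open>\<xi>\<close> and \<open>\<zeta>\<close>, then both have nearly the same distance to every \<open>g n\<close>, hence, choosing
  \<open>g n\<close> close to \<open>\<xi>\<close>, they are close to each other. So near-maximisers converge in norm, which is
  Smulian's criterion for Frechet differentiability.\<close>
theorem smooth_gauge_exists:
  fixes Y :: "'a::real_normed_vector set"
  assumes Y: "subspace Y" and sep: "separable_dual Y" and \<eta>: "0 < \<eta>"
  obtains N where "smooth_gauge Y \<eta> N"
proof -
  obtain F where F: "countable F" "F \<subseteq> dual_on Y"
    "\<And>g \<epsilon>. g \<in> dual_on Y \<Longrightarrow> 0 < \<epsilon> \<Longrightarrow> \<exists>f\<in>F. \<forall>y\<in>Y. \<bar>g y - f y\<bar> \<le> \<epsilon> * norm y"
    using sep unfolding separable_dual_def by blast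
  \<comment> \<open>An approximant of a functional in the dual ball with error at most 1 has norm at
    most 2 on \<open>Y\<close>, so density survives the cut. The distances from the ball to
    \<open>F'\<close> are then at most 3, which makes the series for \<open>J\<close>
    converge.\<close>
  define F' where "F' = {f \<in> F. \<forall>y\<in>Y. \<bar>f y\<bar> \<le> 2 * norm y}"
  have dual: "\<xi> \<in> dual_on Y" if "\<xi> \<in> dual_ball Y" for \<xi>
    using dual_ballD[OF that] unfolding dual_on_def by (auto intro: exI[of _ 1])
  have dense: "\<exists>f\<in>F'. \<forall>y\<in>Y. \<bar>\<xi> y - f y\<bar> \<le> \<epsilon> * norm y" if \<xi>: "\<xi> \<in> dual_ball Y" and "0 < \<epsilon>" for \<xi> \<epsilon>
  proof -
    obtain f where f: "f \<in> F" "\<And>y. y \<in> Y \<Longrightarrow> \<bar>\<xi> y - f y\<bar> \<le> min \<epsilon> 1 * norm y"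
      using F(3)[OF dual[OF \<xi>], of "min \<epsilon> 1"] \<open>0 < \<epsilon>\<close> by auto
    have 1: "min \<epsilon> 1 * norm y \<le> norm y" "min \<epsilon> 1 * norm y \<le> \<epsilon> * norm y" for y :: 'a
      using mult_right_mono[of "min \<epsilon> 1" 1 "norm y"] mult_right_mono[of "min \<epsilon> 1" \<epsilon> "norm y"] by auto
    have "\<bar>f y\<bar> \<le> 2 * norm y" if "y \<in> Y" for y
      using f(2)[OF that] 1(1)[of y] dual_ballD(1)[OF \<xi>, of y] by linarith
    then have "f \<in> F'" using f(1) unfolding F'_def by auto
    then show ?thesis using f(2) 1(2) by (meson order_trans)
  qed
  have zero: "(\<lambda>_. 0) \<in> dual_ball Y" unfolding dual_ball_def by auto
  have "F' \<noteq> {}" using dense[OF zero, of 1] by auto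
  moreover have "countable F'" using F(1) unfolding F'_def by auto
  ultimately obtain g :: "nat \<Rightarrow> 'a \<Rightarrow> real" where g: "range g = F'"
    by (metis range_from_nat_into)
  have g2: "\<bar>g n y\<bar> \<le> 2 * norm y" if "y \<in> Y" for n y
    using g that unfolding F'_def by auto
  have ghom: "g n (c *\<^sub>R y) = c * g n y" if "y \<in> Y" for n c y
  proof -
    have "g n \<in> dual_on Y" using g F(2) unfolding F'_def by auto
    then show ?thesis using that unfolding dual_on_def by auto
  qed
  define d where "d n \<xi> = norm_on Y (\<lambda>y. \<xi> y - g n y)" for n \<xi>
  have b3: "\<bar>\<xi> y - g n y\<bar> \<le> 3 * norm y" if "\<xi> \<in> dual_ball Y" "y \<in> Y" for \<xi> y n
    using g2[OF that(2), of n] dual_ballD(1)[OF that(1), of y] by linarith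
  have d0: "0 \<le> d n \<xi>" and d3: "d n \<xi> \<le> 3" if "\<xi> \<in> dual_ball Y" for n \<xi>
    unfolding d_def using norm_on_nonneg[OF Y b3[OF that, where n=n]] norm_on_le_bound[OF Y b3[OF that, where n=n]] by auto
  have d9: "(d n \<xi>)\<^sup>2 \<le> 9" if "\<xi> \<in> dual_ball Y" for n \<xi>
    using power_mono[OF d3[OF that, of n] d0[OF that], of 2] by simp
  define w :: "nat \<Rightarrow> real" where "w n = (1/2) ^ Suc n" for n
  have w: "w sums 1" unfolding w_def by (rule power_half_series)
  have w0: "0 < w n" for n unfolding w_def by simp
  have wsum: "sum w A \<le> 1" if "finite A" for A
    using sum_le_suminf[OF sums_summable[OF w] that] w0 sums_unique[OF w] by (auto intro: less_imp_le)
  define J where "J \<xi> = (\<Sum>n. w n * (d n \<xi>)\<^sup>2)" for \<xi>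
  have w9: "w n * (d n \<xi>)\<^sup>2 \<le> w n * 9" if "\<xi> \<in> dual_ball Y" for n \<xi>
    using d9[OF that, of n] w0[of n] by (intro mult_left_mono) auto
  have s9: "summable (\<lambda>n. w n * 9)" using sums_summable[OF w] by (rule summable_mult2)
  have Js: "summable (\<lambda>n. w n * (d n \<xi>)\<^sup>2)" if "\<xi> \<in> dual_ball Y" for \<xi>
    using w9[OF that] w0 by (intro summable_comparison_test'[OF s9, of 0]) (auto simp: abs_mult less_imp_le)
  have J0: "0 \<le> J \<xi>" if "\<xi> \<in> dual_ball Y" for \<xi>
    unfolding J_def using w0 by (intro suminf_nonneg[OF Js[OF that]]) (auto simp: less_imp_le)
  have J9: "J \<xi> \<le> 9" if "\<xi> \<in> dual_ball Y" for \<xi>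
  proof -
    have "J \<xi> \<le> (\<Sum>n. w n * 9)" unfolding J_def using w9[OF that] by (intro suminf_le Js[OF that] s9)
    also have "\<dots> = 9" using sums_mult2[OF w, of 9] sums_unique by fastforce
    finally show ?thesis .
  qed
  \<comment> \<open>Together with \<open>leJ\<close> this presents \<open>J\<close> as a supremum of
    finite sums over test vectors. Each sum is continuous in the product topology, so
    \<open>J\<close> is lower semicontinuous there, as attainment of the supremum requires.\<close>
  have Jle: "J \<xi> \<le> s" if \<xi>: "\<xi> \<in> dual_ball Y"
    and le: "\<And>m ys. (\<And>n. ys n \<in> Y \<and> norm (ys n) \<le> 1) \<Longrightarrow> (\<Sum>n<m. w n * (\<xi> (ys n) - g n (ys n))\<^sup>2) \<le> s"
    for \<xi> s
    unfolding J_def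
  proof (rule suminf_le_const[OF Js[OF \<xi>]])
    fix m
    show "(\<Sum>n<m. w n * (d n \<xi>)\<^sup>2) \<le> s"
    proof (rule field_le_epsilon)
      fix e :: real assume e: "0 < e"
      \<comment> \<open>Distances are at most 3, so reducing one by \<open>e / 6\<close> reduces its
        square by at most \<open>e\<close>.\<close>
      have "\<exists>y. y \<in> Y \<and> norm y \<le> 1 \<and> d n \<xi> - e / 6 < \<bar>\<xi> y - g n y\<bar>" for n
        unfolding d_def using norm_on_approx[OF Y b3[OF \<xi>, where n=n], of "e / 6"] e by simp
      then obtain ys where ys: "\<And>n. ys n \<in> Y \<and> norm (ys n) \<le> 1"
        "\<And>n. d n \<xi> - e / 6 < \<bar>\<xi> (ys n) - g n (ys n)\<bar>" by metis
      have *: "w n * (d n \<xi>)\<^sup>2 \<le> w n * (\<xi> (ys n) - g n (ys n))\<^sup>2 + w n * e" for n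
      proof -
        have "(d n \<xi>)\<^sup>2 \<le> \<bar>\<xi> (ys n) - g n (ys n)\<bar>\<^sup>2 + e"
        proof (cases "e / 6 \<le> d n \<xi>")
          case True
          have "(d n \<xi> - e / 6)\<^sup>2 \<le> \<bar>\<xi> (ys n) - g n (ys n)\<bar>\<^sup>2"
            using True ys(2)[of n] by (intro power_mono) auto
          moreover have "e * d n \<xi> \<le> e * 3" using e d3[OF \<xi>, of n] by (intro mult_left_mono) auto
          moreover have "(d n \<xi> - e / 6)\<^sup>2 = (d n \<xi>)\<^sup>2 - (e * d n \<xi>) / 3 + (e / 6)\<^sup>2"
            by (simp add: power2_eq_square algebra_simps)
          ultimately show ?thesis using zero_le_power2[of "e / 6"] by linarith
        next
          case False
          have "d n \<xi> * d n \<xi> \<le> 3 * (e / 6)" using False d0[OF \<xi>, of n] d3[OF \<xi>, of n] e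
            by (intro mult_mono) auto
          then have "(d n \<xi>)\<^sup>2 \<le> e" using e by (simp add: power2_eq_square)
          then show ?thesis using zero_le_power2[of "\<bar>\<xi> (ys n) - g n (ys n)\<bar>"] by linarith
        qed
        then have "w n * (d n \<xi>)\<^sup>2 \<le> w n * ((\<xi> (ys n) - g n (ys n))\<^sup>2 + e)"
          using w0[of n] by (intro mult_left_mono) auto
        then show ?thesis by (simp add: algebra_simps)
      qed
      have "(\<Sum>n<m. w n * (d n \<xi>)\<^sup>2) \<le> (\<Sum>n<m. w n * (\<xi> (ys n) - g n (ys n))\<^sup>2) + (\<Sum>n<m. w n) * e"
        unfolding sum_distrib_right sum.distrib[symmetric] by (rule sum_mono) (rule *)
      also have "\<dots> \<le> s + 1 * e"
        using le[of ys m, OF ys(1)] wsum[of "{..<m}"] e by (intro add_mono mult_right_mono) auto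
      finally show "(\<Sum>n<m. w n * (d n \<xi>)\<^sup>2) \<le> s + e" by simp
    qed
  qed
  have leJ: "(\<Sum>n<m. w n * (\<xi> (ys n) - g n (ys n))\<^sup>2) \<le> J \<xi>"
    if \<xi>: "\<xi> \<in> dual_ball Y" and ys: "\<And>n. ys n \<in> Y \<and> norm (ys n) \<le> 1" for \<xi> m ys
  proof -
    have "(\<xi> (ys n) - g n (ys n))\<^sup>2 \<le> (d n \<xi>)\<^sup>2" for n
      using norm_on_upper[OF Y b3[OF \<xi>, where n=n], of "ys n"] ys[of n]
      by (subst power2_le_iff_abs_le[OF d0[OF \<xi>]]) (simp add: d_def)
    then have "(\<Sum>n<m. w n * (\<xi> (ys n) - g n (ys n))\<^sup>2) \<le> (\<Sum>n<m. w n * (d n \<xi>)\<^sup>2)"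
      using w0 by (intro sum_mono mult_left_mono) (auto simp: less_imp_le)
    also have "\<dots> \<le> J \<xi>"
      unfolding J_def using w0 by (intro sum_le_suminf Js[OF \<xi>]) (auto simp: less_imp_le)
    finally show ?thesis .
  qed
  \<comment> \<open>Since \<open>J\<close> is at most 9 on the dual ball, the penalty
    \<open>c * J\<close> costs at most \<eta>.\<close>
  define c where "c = \<eta> / 9"
  have c: "0 < c" using \<eta> unfolding c_def by simp
  define N where "N x = (SUP \<xi>\<in>dual_ball Y. \<xi> x - c * J \<xi>)" for x
  have leN: "\<xi> x - c * J \<xi> \<le> N x" if "\<xi> \<in> dual_ball Y" for \<xi> x
    unfolding N_def
  proof (rule cSUP_upper[OF that], rule bdd_aboveI[of _ "norm x"])
    fix t assume "t \<in> (\<lambda>\<xi>. \<xi> x - c * J \<xi>) ` dual_ball Y"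
    then obtain \<xi> where "\<xi> \<in> dual_ball Y" "t = \<xi> x - c * J \<xi>" by auto
    then show "t \<le> norm x" using J0[of \<xi>] c dual_ballD(1)[of \<xi> Y x]
      by (smt (verit, best) mult_nonneg_nonneg)
  qed
  have attained: "\<exists>\<xi>\<in>dual_ball Y. N x = \<xi> x - c * J \<xi>" for x
  proof -
    \<comment> \<open>Membership in \<open>S (v, m, ys)\<close> says that the objective, with
      \<open>J\<close> replaced by one finite sum, is at least \<open>v\<close>. A near-maximiser
      whose objective exceeds the largest \<open>v\<close> of a finite subfamily lies in all its
      sets; a point common to all sets is a maximiser.\<close>
    define S where "S = (\<lambda>(v, m, ys). {\<xi>. v + c * (\<Sum>n<m. w n * (\<xi> (ys n) - g n (ys n))\<^sup>2) \<le> \<xi> x})"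
    define I where "I = {(v, m::nat, ys::nat\<Rightarrow>'a). v < N x \<and> (\<forall>n. ys n \<in> Y \<and> norm (ys n) \<le> 1)}"
    have "dual_ball Y \<inter> (\<Inter>i\<in>I. S i) \<noteq> {}"
    proof (rule compact_imp_fip_image[OF compact_dual_ball])
      fix i show "closed (S i)"
        unfolding S_def
        by (cases i) (auto intro!: closed_Collect_le continuous_intros)
    next
      fix I' assume I': "finite I'" "I' \<subseteq> I"
      have "\<exists>v0<N x. \<forall>i\<in>I'. fst i \<le> v0"
      proof (cases "I' = {}")
        case True
        then show ?thesis using lt_ex by auto
      next
        case False
        then show ?thesis using I'
          by (intro exI[of _ "Max (fst ` I')"]) (auto simp: I_def)
      qed
      then obtain v0 where v0: "v0 < N x" "\<And>i. i \<in> I' \<Longrightarrow> fst i \<le> v0" by blast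
      have "\<exists>\<xi>\<in>dual_ball Y. v0 < \<xi> x - c * J \<xi>"
      proof (rule ccontr)
        assume "\<not> ?thesis"
        then have "N x \<le> v0" unfolding N_def using zero by (intro cSUP_least) auto
        then show False using v0(1) by simp
      qed
      then obtain \<xi> where \<xi>: "\<xi> \<in> dual_ball Y" "v0 < \<xi> x - c * J \<xi>" by blast
      have "\<xi> \<in> S i" if i: "i \<in> I'" for i
      proof -
        obtain v m ys where vm: "i = (v, m, ys)" by (cases i)
        have "c * (\<Sum>n<m. w n * (\<xi> (ys n) - g n (ys n))\<^sup>2) \<le> c * J \<xi>"
          using leJ[OF \<xi>(1), of ys m] i I'(2) c vm by (intro mult_left_mono) (auto simp: I_def)
        then show ?thesis using v0(2)[OF i] \<xi>(2) unfolding S_def vm by simp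
      qed
      then show "dual_ball Y \<inter> (\<Inter>i\<in>I'. S i) \<noteq> {}" using \<xi>(1) by auto
    qed
    then obtain \<xi> where \<xi>: "\<xi> \<in> dual_ball Y" "\<And>i. i \<in> I \<Longrightarrow> \<xi> \<in> S i" by auto
    have "v \<le> \<xi> x - c * J \<xi>" if v: "v < N x" for v
    proof -
      have "J \<xi> \<le> (\<xi> x - v) / c"
      proof (rule Jle[OF \<xi>(1)])
        fix m and ys :: "nat \<Rightarrow> 'a" assume "\<And>n. ys n \<in> Y \<and> norm (ys n) \<le> 1"
        then have "(v, m, ys) \<in> I" using v unfolding I_def by auto
        then have "v + c * (\<Sum>n<m. w n * (\<xi> (ys n) - g n (ys n))\<^sup>2) \<le> \<xi> x"
          using \<xi>(2) unfolding S_def by fastforce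
        then show "(\<Sum>n<m. w n * (\<xi> (ys n) - g n (ys n))\<^sup>2) \<le> (\<xi> x - v) / c"
          using c by (simp add: field_simps)
      qed
      then show ?thesis using c by (simp add: field_simps)
    qed
    then have "N x \<le> \<xi> x - c * J \<xi>" by (rule dense_le)
    then show ?thesis using leN[OF \<xi>(1), of x] \<xi>(1) by (intro bexI[of _ \<xi>]) auto
  qed
  \<comment> \<open>All summands of the midpoint gap are non-negative, so the gap dominates each one
    separately.\<close>
  have gap: "w n * ((d n \<xi> - d n \<zeta>) / 2)\<^sup>2 \<le> (J \<xi> + J \<zeta>) / 2 - J (\<lambda>y. (\<xi> y + \<zeta> y) / 2)"
    if \<xi>: "\<xi> \<in> dual_ball Y" and \<zeta>: "\<zeta> \<in> dual_ball Y" and \<mu>: "(\<lambda>y. (\<xi> y + \<zeta> y) / 2) \<in> dual_ball Y"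
    for \<xi> \<zeta> n
  proof -
    let ?m = "\<lambda>y. (\<xi> y + \<zeta> y) / 2"
    define t where "t k = w k * (((d k \<xi>)\<^sup>2 + (d k \<zeta>)\<^sup>2) / 2 - (d k ?m)\<^sup>2)" for k
    have dm: "d k ?m \<le> (d k \<xi> + d k \<zeta>) / 2" for k
      unfolding d_def
    proof (rule norm_on_le[OF Y b3[OF \<mu>, where n=k]])
      fix y assume y: "y \<in> Y" "norm y \<le> 1"
      show "\<bar>?m y - g k y\<bar> \<le> (norm_on Y (\<lambda>y. \<xi> y - g k y) + norm_on Y (\<lambda>y. \<zeta> y - g k y)) / 2"
        using norm_on_upper[OF Y b3[OF \<xi>, where n=k] _ y] norm_on_upper[OF Y b3[OF \<zeta>, where n=k] _ y]
        by (simp add: field_simps)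
    qed simp_all
    have tge: "w k * ((d k \<xi> - d k \<zeta>) / 2)\<^sup>2 \<le> t k" for k
      unfolding t_def using midpoint_square_gap[OF d0[OF \<mu>, of k] dm[of k]] w0[of k]
      by (intro mult_left_mono) auto
    have tpos: "0 \<le> t k" for k
      using tge[of k] w0[of k] by (smt (verit) mult_nonneg_nonneg zero_le_power2)
    have teq: "t = (\<lambda>k. (w k * (d k \<xi>)\<^sup>2 + w k * (d k \<zeta>)\<^sup>2) / 2 - w k * (d k ?m)\<^sup>2)"
      unfolding t_def by (auto simp: fun_eq_iff algebra_simps)
    have sums: "t sums ((J \<xi> + J \<zeta>) / 2 - J ?m)"
      unfolding teq J_def
      by (intro sums_diff sums_divide sums_add summable_sums Js \<xi> \<zeta> \<mu>)
    have "t n \<le> suminf t"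
      using sum_le_suminf[OF sums_summable[OF sums], of "{n}"] tpos by simp
    then show ?thesis using tge[of n] sums_unique[OF sums] by simp
  qed
  have "smooth_gauge Y \<eta> N"
    unfolding smooth_gauge_def
  proof (intro ballI conjI)
    fix x assume x: "x \<in> Y"
    obtain l :: "'a \<Rightarrow>\<^sub>L real" where l: "norm l \<le> 1" "blinfun_apply l x = norm x"
      using norming_functional by blast
    have lB: "blinfun_apply l \<in> dual_ball Y"
    proof -
      have "\<bar>blinfun_apply l y\<bar> \<le> norm y" for y
        using norm_blinfun[of l y] mult_right_mono[OF l(1), of "norm y"] by simp
      then show ?thesis
        unfolding dual_ball_def by (auto simp: blinfun.add_right blinfun.scaleR_right)
    qed
    show "norm x - \<eta> \<le> N x"
    proof -
      have "c * J (blinfun_apply l) \<le> c * 9" using J9[OF lB] c by (intro mult_left_mono) auto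
      then show ?thesis using leN[OF lB, of x] l(2) unfolding c_def by simp
    qed
    obtain \<xi> where \<xi>: "\<xi> \<in> dual_ball Y" "N x = \<xi> x - c * J \<xi>" using attained by blast
    show "N x \<le> norm x"
      using \<xi> J0[OF \<xi>(1)] c dual_ballD(1)[OF \<xi>(1), of x] mult_nonneg_nonneg[of c "J \<xi>"] by linarith
    show "\<exists>\<xi>\<in>dual_ball Y. (\<forall>h\<in>Y. N x + \<xi> h \<le> N (x + h)) \<and>
        (\<forall>\<epsilon>>0. \<exists>\<delta>>0. \<forall>h\<in>Y. norm h < \<delta> \<longrightarrow> N (x + h) \<le> N x + \<xi> h + \<epsilon> * norm h)"
    proof (intro bexI[OF _ \<xi>(1)] conjI ballI allI impI)
      fix h assume h: "h \<in> Y"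
      show "N x + \<xi> h \<le> N (x + h)"
        using leN[OF \<xi>(1), of "x + h"] \<xi>(2) dual_ballD(2)[OF \<xi>(1) x h] by simp
    next
      fix \<epsilon> :: real assume \<epsilon>: "0 < \<epsilon>"
      obtain f where "f \<in> F'" "\<And>y. y \<in> Y \<Longrightarrow> \<bar>\<xi> y - f y\<bar> \<le> \<epsilon> / 3 * norm y"
        using dense[OF \<xi>(1), of "\<epsilon> / 3"] \<epsilon> by auto
      then obtain n where n: "\<And>y. y \<in> Y \<Longrightarrow> \<bar>\<xi> y - g n y\<bar> \<le> \<epsilon> / 3 * norm y"
        using g by (metis imageE)
      have dn: "d n \<xi> \<le> \<epsilon> / 3" unfolding d_def using norm_on_le_bound[OF Y n] \<epsilon> by simp
      \<comment> \<open>This radius makes the two distances to \<open>g n\<close> differ by less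
        than \<open>\<epsilon> / 3\<close>. With \<open>d n \<xi> \<le> \<epsilon> / 3\<close> they
        add up to at most \<epsilon>.\<close>
      define \<delta> where "\<delta> = c * w n * (\<epsilon> / 6)\<^sup>2"
      show "\<exists>\<delta>>0. \<forall>h\<in>Y. norm h < \<delta> \<longrightarrow> N (x + h) \<le> N x + \<xi> h + \<epsilon> * norm h"
      proof (intro exI[of _ \<delta>] conjI ballI impI)
        show "0 < \<delta>" unfolding \<delta>_def using c w0 \<epsilon> by simp
        fix h assume h: "h \<in> Y" "norm h < \<delta>"
        obtain \<zeta> where \<zeta>: "\<zeta> \<in> dual_ball Y" "N (x + h) = \<zeta> (x + h) - c * J \<zeta>" using attained by blast
        have \<mu>: "(\<lambda>y. (\<xi> y + \<zeta> y) / 2) \<in> dual_ball Y"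
        proof -
          have "\<bar>(\<xi> y + \<zeta> y) / 2\<bar> \<le> norm y" for y
            using dual_ballD(1)[OF \<xi>(1), of y] dual_ballD(1)[OF \<zeta>(1), of y] by (auto simp: abs_le_iff field_simps)
          then show ?thesis
            unfolding dual_ball_def using dual_ballD(2,3)[OF \<xi>(1)] dual_ballD(2,3)[OF \<zeta>(1)]
            by (auto simp: field_simps)
        qed
        have \<zeta>x: "\<zeta> (x + h) = \<zeta> x + \<zeta> h" "\<xi> (x + h) = \<xi> x + \<xi> h"
          using dual_ballD(2) \<zeta>(1) \<xi>(1) x h by auto
        \<comment> \<open>At \<open>x + h\<close> the maximiser \<zeta> beats \<xi>; at
          \<open>x\<close> the maximiser \<xi> beats the midpoint. Combined, the values at
          \<open>x\<close> cancel, and the midpoint gap times \<open>c\<close> is at most half of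
          \<open>\<zeta> h - \<xi> h\<close>.\<close>
        have "\<xi> x + \<xi> h - c * J \<xi> \<le> \<zeta> x + \<zeta> h - c * J \<zeta>"
          using leN[OF \<xi>(1), of "x + h"] \<zeta>(2) \<zeta>x by simp
        moreover have "(\<xi> x + \<zeta> x) / 2 - c * J (\<lambda>y. (\<xi> y + \<zeta> y) / 2) \<le> \<xi> x - c * J \<xi>"
          using leN[OF \<mu>, of x] \<xi>(2) by simp
        ultimately have "c * ((J \<xi> + J \<zeta>) / 2 - J (\<lambda>y. (\<xi> y + \<zeta> y) / 2)) \<le> norm h"
          using dual_ballD(1)[OF \<xi>(1), of h] dual_ballD(1)[OF \<zeta>(1), of h] by (simp add: field_simps)
        then have "c * (w n * ((d n \<xi> - d n \<zeta>) / 2)\<^sup>2) \<le> norm h"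
          using mult_left_mono[OF gap[OF \<xi>(1) \<zeta>(1) \<mu>, of n], of c] c by linarith
        also have "\<dots> < c * (w n * (\<epsilon> / 6)\<^sup>2)" using h(2) unfolding \<delta>_def by (simp add: mult.assoc)
        finally have "((d n \<xi> - d n \<zeta>) / 2)\<^sup>2 < (\<epsilon> / 6)\<^sup>2" using c w0[of n] by simp
        then have "\<bar>(d n \<xi> - d n \<zeta>) / 2\<bar>\<^sup>2 < (\<epsilon> / 6)\<^sup>2" by (simp only: power2_abs)
        then have "\<bar>(d n \<xi> - d n \<zeta>) / 2\<bar> < \<epsilon> / 6"
          by (rule power2_less_imp_less) (use \<epsilon> in simp)
        then have "- ((d n \<xi> - d n \<zeta>) / 2) < \<epsilon> / 6" by (simp only: abs_less_iff)
        then have dz: "d n \<zeta> \<le> 2 * \<epsilon> / 3" using dn by (simp add: field_simps)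
        have "\<bar>\<xi> h - g n h\<bar> \<le> d n \<xi> * norm h" "\<bar>\<zeta> h - g n h\<bar> \<le> d n \<zeta> * norm h"
          unfolding d_def
          using norm_on_apply[OF Y b3[OF \<xi>(1), where n=n] _ _ h(1)] norm_on_apply[OF Y b3[OF \<zeta>(1), where n=n] _ _ h(1)]
            dual_ballD(3)[OF \<xi>(1)] dual_ballD(3)[OF \<zeta>(1)] ghom by (auto simp: algebra_simps)
        then have "\<zeta> h - \<xi> h \<le> (d n \<xi> + d n \<zeta>) * norm h" by (simp add: algebra_simps)
        also have "\<dots> \<le> \<epsilon> * norm h" using dn dz by (intro mult_right_mono) auto
        finally have "\<zeta> h - \<xi> h \<le> \<epsilon> * norm h" .
        moreover have "N (x + h) \<le> N x + \<zeta> h" using leN[OF \<zeta>(1), of x] \<zeta>(2) \<zeta>x by simp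
        ultimately show "N (x + h) \<le> N x + \<xi> h + \<epsilon> * norm h" by simp
      qed
    qed
  qed
  then show thesis by (rule that)
qed

section \<open>A smooth variational principle\<close>

lemma smooth_gaugeD:
  assumes "smooth_gauge Y \<eta> N" "x \<in> Y"
  shows "norm x - \<eta> \<le> N x" "N x \<le> norm x"
    "\<exists>\<xi>\<in>dual_ball Y. (\<forall>h\<in>Y. N x + \<xi> h \<le> N (x + h)) \<and>
           (\<forall>\<epsilon>>0. \<exists>\<delta>>0. \<forall>h\<in>Y. norm h < \<delta> \<longrightarrow> N (x + h) \<le> N x + \<xi> h + \<epsilon> * norm h)"
  using assms unfolding smooth_gauge_def by auto

lemma smooth_gauge_lipschitz:
  assumes N: "smooth_gauge Y \<eta> N" and Y: "subspace Y" and x: "x \<in> Y" and y: "y \<in> Y"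
  shows "\<bar>N x - N y\<bar> \<le> norm (x - y)"
proof -
  have *: "N x - N y \<le> norm (x - y)" if x: "x \<in> Y" and y: "y \<in> Y" for x y
  proof -
    obtain \<xi> where \<xi>: "\<xi> \<in> dual_ball Y" "\<And>h. h \<in> Y \<Longrightarrow> N x + \<xi> h \<le> N (x + h)"
      using smooth_gaugeD(3)[OF N x] by blast
    have "N x + \<xi> (y - x) \<le> N y" using \<xi>(2)[of "y - x"] subspace_diff[OF Y y x] by simp
    then show ?thesis using dual_ballD(1)[OF \<xi>(1), of "y - x"] by (simp add: norm_minus_commute)
  qed
  show ?thesis using *[OF x y] *[OF y x] by (simp add: norm_minus_commute abs_le_iff)
qed

lemma near_minimiser:
  fixes F :: "'a \<Rightarrow> ereal"
  assumes low: "\<And>u. u \<in> Y \<Longrightarrow> ereal b \<le> F u" and u0: "u0 \<in> Y" "F u0 < \<infinity>" and e: "0 < e"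
  shows "\<exists>u\<in>Y. \<forall>w\<in>Y. F u \<le> F w + ereal e"
proof -
  define I where "I = (INF u\<in>Y. F u)"
  have "ereal b \<le> I" unfolding I_def using low by (intro INF_greatest)
  moreover have "I < \<infinity>" using INF_lower[OF u0(1), of F] u0(2) unfolding I_def by auto
  ultimately obtain r where r: "I = ereal r" by (cases I) auto
  then have "I < ereal (r + e)" using e by simp
  then obtain u where u: "u \<in> Y" "F u < ereal (r + e)" unfolding I_def INF_less_iff by auto
  have "F u \<le> F w + ereal e" if "w \<in> Y" for w
  proof -
    have "ereal r \<le> F w" using INF_lower[OF that, of F] r unfolding I_def by simp
    then have "ereal r + ereal e \<le> F w + ereal e" by (rule add_right_mono)
    then show ?thesis using u(2) by (simp add: order.strict_implies_order order_less_le_trans)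
  qed
  then show ?thesis using u(1) by blast
qed

text \<open>The perturbation \<theta> is a weighted sum of gauges centred at successive
  near-minimisers. The \<open>n\<close>-th gauge has accuracy \<open>e n\<close>, matching the
  minimisation error \<open>l n * e n\<close>, so that being only close to the norm does no harm.
  The weights \<open>l n\<close>, which bound the Lipschitz constants, sum to \<beta>; hence the
  bound on the derivative \<tau>.\<close>

theorem smooth_variational_principle:
  fixes F :: "'a::banach \<Rightarrow> ereal" and b :: real
  assumes Y: "subspace Y" "closed Y" "separable_dual Y"
    and lsc: "\<And>u c a. range u \<subseteq> Y \<Longrightarrow> u \<longlonglongrightarrow> c \<Longrightarrow> \<forall>\<^sub>F n in sequentially. F (u n) \<le> ereal a \<Longrightarrow> F c \<le> ereal a"
    and low: "\<And>u. u \<in> Y \<Longrightarrow> ereal b \<le> F u" and u0: "u0 \<in> Y" "F u0 < \<infinity>"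
    and \<sigma>: "0 < \<sigma>" and \<beta>: "0 < \<beta>"
  obtains c \<theta> \<tau> where "c \<in> Y" "\<forall>w\<in>Y. F c + ereal (\<theta> c) \<le> F w + ereal (\<theta> w)"
    "\<forall>w\<in>Y. F c \<le> F w + ereal \<sigma>" "\<tau> \<in> dual_on Y" "\<forall>y. \<bar>\<tau> y\<bar> \<le> \<beta> * norm y"
    "\<forall>\<epsilon>>0. \<exists>\<delta>>0. \<forall>h\<in>Y. norm h < \<delta> \<longrightarrow> \<theta> (c + h) \<le> \<theta> c + \<tau> h + \<epsilon> * norm h"
proof -
  \<comment> \<open>Negative gauge values and minimisation errors each cost at most
    \<open>\<beta> * \<kappa>\<close> in total, together \<sigma>.\<close>
  define \<kappa> where "\<kappa> = \<sigma> / (2 * \<beta>)"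
  have \<kappa>: "0 < \<kappa>" using \<sigma> \<beta> unfolding \<kappa>_def by simp
  define l :: "nat \<Rightarrow> real" where "l n = \<beta> * (1/2) ^ Suc n" for n
  have l0: "0 < l n" for n unfolding l_def using \<beta> by simp
  have lsums: "l sums \<beta>" using sums_mult[OF power_half_series, of \<beta>] unfolding l_def by simp
  have lsum: "sum l A \<le> \<beta>" if "finite A" for A
    using sum_le_suminf[OF sums_summable[OF lsums] that] l0 sums_unique[OF lsums] by (auto intro: less_imp_le)
  define e :: "nat \<Rightarrow> real" where "e n = \<kappa> * (1/2) ^ n" for n
  have e0: "0 < e n" for n unfolding e_def using \<kappa> by simp
  have e\<kappa>: "e n \<le> \<kappa>" for n unfolding e_def using \<kappa> by (simp add: mult_left_le power_le_one)
  have "\<exists>N. smooth_gauge Y (e n) N" for n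
    using smooth_gauge_exists[OF Y(1,3) e0[of n]] by blast
  then obtain N where N: "\<And>n. smooth_gauge Y (e n) (N n)" by metis
  \<comment> \<open>The next perturbation contains the near-minimiser of the current one as its
    centre. With the choice made a function of \<open>\<Theta>\<close>, the recursion runs over
    perturbations alone.\<close>
  define pick where "pick \<Theta> n = (SOME u. u \<in> Y \<and> (\<forall>w\<in>Y. F u + ereal (\<Theta> u) \<le> F w + ereal (\<Theta> w) + ereal (l n * e n)))"
    for \<Theta> :: "'a \<Rightarrow> real" and n
  define \<Theta> where "\<Theta> = rec_nat (\<lambda>_. 0) (\<lambda>n \<Theta>n w. \<Theta>n w + l n * N n (w - pick \<Theta>n n))"
  define u where "u n = pick (\<Theta> n) n" for n
  have \<Theta>0: "\<Theta> 0 w = 0" and \<Theta>S: "\<Theta> (Suc n) w = \<Theta> n w + l n * N n (w - u n)" for n w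
    unfolding \<Theta>_def u_def by auto
  \<comment> \<open>The claims are intertwined: a near-minimiser exists once
    \<open>\<Theta> n\<close> is bounded below on \<open>Y\<close>, and this bound needs the earlier
    centres to lie in \<open>Y\<close>, where the gauges are controlled.\<close>
  have u: "u n \<in> Y \<and> (\<forall>w\<in>Y. F (u n) + ereal (\<Theta> n (u n)) \<le> F w + ereal (\<Theta> n w) + ereal (l n * e n))
      \<and> (\<forall>w\<in>Y. - (\<Sum>k<n. l k) * \<kappa> \<le> \<Theta> n w)" for n
  proof (induction n rule: less_induct)
    case (less n)
    have lown: "\<forall>w\<in>Y. - (\<Sum>k<n. l k) * \<kappa> \<le> \<Theta> n w"
    proof (cases n)
      case (Suc m)
      have "- l m * \<kappa> \<le> l m * N m (w - u m)" if w: "w \<in> Y" for w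
      proof -
        have "w - u m \<in> Y" using subspace_diff[OF Y(1) w] less[of m] Suc by auto
        then have "- \<kappa> \<le> N m (w - u m)"
          using smooth_gaugeD(1)[OF N, of _ m] e\<kappa>[of m] by (smt (verit) norm_ge_zero)
        then have "l m * (- \<kappa>) \<le> l m * N m (w - u m)" using l0[of m] by (intro mult_left_mono) auto
        then show ?thesis by simp
      qed
      moreover have "\<forall>w\<in>Y. - (\<Sum>k<m. l k) * \<kappa> \<le> \<Theta> m w" using less[of m] Suc by auto
      ultimately show ?thesis unfolding Suc \<Theta>S sum.lessThan_Suc by (fastforce simp: algebra_simps)
    qed (simp add: \<Theta>0)
    have tl: "- \<beta> * \<kappa> \<le> \<Theta> n w" if "w \<in> Y" for w
    proof -
      have "(\<Sum>k<n. l k) * \<kappa> \<le> \<beta> * \<kappa>" using lsum[of "{..<n}"] \<kappa> by (intro mult_right_mono) auto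
      then show ?thesis using lown that by fastforce
    qed
    have "\<exists>v\<in>Y. \<forall>w\<in>Y. F v + ereal (\<Theta> n v) \<le> F w + ereal (\<Theta> n w) + ereal (l n * e n)"
    proof (rule near_minimiser[where b = "b + - \<beta> * \<kappa>"])
      fix v assume v: "v \<in> Y"
      show "ereal (b + - \<beta> * \<kappa>) \<le> F v + ereal (\<Theta> n v)"
        unfolding plus_ereal.simps(1)[symmetric] using low[OF v] tl[OF v] by (intro add_mono) auto
    qed (use u0 l0 e0 in auto)
    then have "u n \<in> Y \<and> (\<forall>w\<in>Y. F (u n) + ereal (\<Theta> n (u n)) \<le> F w + ereal (\<Theta> n w) + ereal (l n * e n))"
      unfolding u_def pick_def Bex_def by (rule someI_ex)
    then show ?case using lown by auto
  qed
  have uY: "u n \<in> Y" for n using u by blast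
  have umin: "F (u n) + ereal (\<Theta> n (u n)) \<le> F w + ereal (\<Theta> n w) + ereal (l n * e n)" if "w \<in> Y" for n w
    using u that by blast
  have \<Theta>low: "- \<beta> * \<kappa> \<le> \<Theta> n w" if "w \<in> Y" for n w
  proof -
    have "(\<Sum>k<n. l k) * \<kappa> \<le> \<beta> * \<kappa>" using lsum[of "{..<n}"] \<kappa> by (intro mult_right_mono) auto
    then show ?thesis using u[of n] that by fastforce
  qed
  have ufin: "\<exists>r. F (u n) = ereal r" for n
  proof -
    have "F (u n) + ereal (\<Theta> n (u n)) < \<infinity>" using umin[OF u0(1), of n] u0(2) by (cases "F u0") auto
    then show ?thesis using low[OF uY[of n]] by (cases "F (u n)") auto
  qed
  then obtain f where f: "\<And>n. F (u n) = ereal (f n)" by metis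
  \<comment> \<open>Near-minimality of \<open>u n\<close> and of \<open>u (Suc n)\<close>, each
    tested at the other point, bounds the gauge of the difference by \<open>2 * e n\<close>;
    replacing the gauge by the norm costs another \<open>e n\<close>.\<close>
  have step: "norm (u (Suc n) - u n) \<le> 3 * \<kappa> * (1/2) ^ n" for n
  proof -
    have N0: "N n 0 \<le> 0" using smooth_gaugeD(2)[OF N subspace_0[OF Y(1)], of n] by simp
    have "f (Suc n) + \<Theta> (Suc n) (u (Suc n)) \<le> f n + \<Theta> (Suc n) (u n) + l (Suc n) * e (Suc n)"
      using umin[OF uY[of n], of "Suc n"] f by simp
    also have "\<dots> \<le> f n + \<Theta> n (u n) + l n * e n"
    proof -
      have "l n * N n 0 \<le> 0" using l0[of n] N0 by (simp add: mult_le_0_iff)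
      moreover have "l (Suc n) * e (Suc n) \<le> l n * e n"
        unfolding l_def e_def using \<kappa> \<beta> by (intro mult_mono) auto
      ultimately show ?thesis unfolding \<Theta>S by simp
    qed
    finally have "f (Suc n) + \<Theta> n (u (Suc n)) + l n * N n (u (Suc n) - u n) \<le> f n + \<Theta> n (u n) + l n * e n"
      unfolding \<Theta>S by simp
    moreover have "f n + \<Theta> n (u n) \<le> f (Suc n) + \<Theta> n (u (Suc n)) + l n * e n"
      using umin[OF uY[of "Suc n"], of n] f by simp
    ultimately have "l n * N n (u (Suc n) - u n) \<le> l n * (2 * e n)" by (simp add: algebra_simps)
    then have "N n (u (Suc n) - u n) \<le> 2 * e n" using l0[of n] by simp
    then have "norm (u (Suc n) - u n) \<le> 3 * e n"
      using smooth_gaugeD(1)[OF N subspace_diff[OF Y(1) uY uY], of "Suc n" n n] by simp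
    then show ?thesis unfolding e_def by simp
  qed
  have "summable (\<lambda>n. norm (u (Suc n) - u n))"
    using step by (intro summable_comparison_test'[OF summable_mult[OF summable_geometric[of "1/2::real"], of "3 * \<kappa>"], of 0]) auto
  then have "summable (\<lambda>n. u (Suc n) - u n)" by (rule summable_norm_cancel)
  then have "convergent (\<lambda>n. u n - u 0)"
    by (simp add: summable_iff_convergent sum_lessThan_telescope)
  then have "convergent u"
    using convergent_add[OF _ convergent_const[of "u 0"]] by fastforce
  then obtain c where c: "u \<longlonglongrightarrow> c" unfolding convergent_def by blast
  have cY: "c \<in> Y" using closed_sequentially[OF Y(2) uY c] by simp
  define \<theta> where "\<theta> w = (\<Sum>k. l k * N k (w - u k))" for w
  have \<Theta>sum: "\<Theta> n w = (\<Sum>k<n. l k * N k (w - u k))" for n w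
    by (induction n) (auto simp: \<Theta>0 \<Theta>S)
  obtain B where B: "\<And>n. norm (u n) \<le> B"
    using convergent_imp_Bseq[OF \<open>convergent u\<close>] unfolding Bseq_def by blast
  have Nb: "\<bar>N k (w - u k)\<bar> \<le> norm w + B + \<kappa>" if "w \<in> Y" for k w
    using smooth_gaugeD(1,2)[OF N subspace_diff[OF Y(1) that uY[of k]], of k] e\<kappa>[of k] \<kappa> B[of k]
      norm_triangle_ineq4[of w "u k"] norm_ge_zero[of "w - u k"] unfolding abs_le_iff by linarith
  have \<theta>s: "summable (\<lambda>k. l k * N k (w - u k))" if "w \<in> Y" for w
  proof (rule summable_comparison_test'[OF summable_mult2[OF sums_summable[OF lsums], of "norm w + B + \<kappa>"], of 0])
    fix n show "norm (l n * N n (w - u n)) \<le> l n * (norm w + B + \<kappa>)"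
      using Nb[OF that, of n] l0[of n] by (auto simp: abs_mult intro!: mult_left_mono)
  qed
  have \<Theta>lim: "(\<lambda>n. \<Theta> n w) \<longlonglongrightarrow> \<theta> w" if "w \<in> Y" for w
    unfolding \<Theta>sum \<theta>_def using summable_LIMSEQ[OF \<theta>s[OF that]] .
  have \<Theta>lip: "\<bar>\<Theta> n v - \<Theta> n w\<bar> \<le> \<beta> * norm (v - w)" if "v \<in> Y" "w \<in> Y" for n v w
  proof -
    have "\<bar>\<Theta> n v - \<Theta> n w\<bar> \<le> (\<Sum>k<n. \<bar>l k * N k (v - u k) - l k * N k (w - u k)\<bar>)"
      unfolding \<Theta>sum sum_subtractf[symmetric] by (rule sum_abs)
    also have "\<dots> \<le> (\<Sum>k<n. l k * norm (v - w))"
    proof (rule sum_mono)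
      fix k
      have "\<bar>N k (v - u k) - N k (w - u k)\<bar> \<le> norm (v - w)"
        using smooth_gauge_lipschitz[OF N Y(1) subspace_diff[OF Y(1) that(1) uY[of k]] subspace_diff[OF Y(1) that(2) uY[of k]], of k] by simp
      then have "l k * \<bar>N k (v - u k) - N k (w - u k)\<bar> \<le> l k * norm (v - w)"
        using l0[of k] by (intro mult_left_mono) auto
      then show "\<bar>l k * N k (v - u k) - l k * N k (w - u k)\<bar> \<le> l k * norm (v - w)"
        using l0[of k] by (simp add: abs_mult flip: right_diff_distrib)
    qed
    also have "\<dots> \<le> \<beta> * norm (v - w)"
      unfolding sum_distrib_right[symmetric] using lsum[of "{..<n}"] by (intro mult_right_mono) auto
    finally show ?thesis .
  qed
  \<comment> \<open>All \<open>\<Theta> n\<close> share the Lipschitz constant \<beta> on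
    \<open>Y\<close>, so convergence at \<open>c\<close> carries over to the moving points
    \<open>u n\<close>.\<close>
  have "(\<lambda>n. \<Theta> n (u n) - \<Theta> n c) \<longlonglongrightarrow> 0"
  proof (rule Lim_null_comparison)
    show "\<forall>\<^sub>F n in sequentially. norm (\<Theta> n (u n) - \<Theta> n c) \<le> \<beta> * norm (u n - c)"
      using \<Theta>lip[OF uY cY] by simp
    show "(\<lambda>n. \<beta> * norm (u n - c)) \<longlonglongrightarrow> 0"
      using tendsto_mult_right_zero[OF tendsto_norm_zero[OF LIM_zero[OF c]]] .
  qed
  from tendsto_add[OF this \<Theta>lim[OF cY]] have \<Theta>u: "(\<lambda>n. \<Theta> n (u n)) \<longlonglongrightarrow> \<theta> c" by simp
  have le0: "(\<lambda>n. l n * e n) \<longlonglongrightarrow> 0"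
    using tendsto_mult[OF summable_LIMSEQ_zero[OF sums_summable[OF lsums]], of e "0"]
      tendsto_mult_right_zero[OF LIMSEQ_power_zero[of "1/2::real"], of \<kappa>] unfolding e_def by simp
  have min: "F c + ereal (\<theta> c) \<le> F w + ereal (\<theta> w)" if w: "w \<in> Y" for w
  proof (cases "F w")
    case (real r)
    have "F c \<le> ereal (r + \<theta> w - \<theta> c)"
    proof (rule ereal_le_epsilon2)
      fix \<epsilon> :: real assume \<epsilon>: "0 < \<epsilon>"
      have "(\<lambda>n. r + \<Theta> n w - \<Theta> n (u n) + l n * e n) \<longlonglongrightarrow> r + \<theta> w - \<theta> c + 0"
        by (intro tendsto_intros \<Theta>lim[OF w] \<Theta>u le0)
      then have "\<forall>\<^sub>F n in sequentially. r + \<Theta> n w - \<Theta> n (u n) + l n * e n < r + \<theta> w - \<theta> c + \<epsilon>"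
        using \<epsilon> by (intro order_tendstoD(2)) auto
      then have "\<forall>\<^sub>F n in sequentially. F (u n) \<le> ereal (r + \<theta> w - \<theta> c + \<epsilon>)"
      proof eventually_elim
        case (elim n)
        then show ?case using umin[OF w, of n] f real by simp
      qed
      from lsc[OF _ c this] show "F c \<le> ereal (r + \<theta> w - \<theta> c) + ereal \<epsilon>" using uY by auto
    qed
    then have "F c + ereal (\<theta> c) \<le> ereal (r + \<theta> w - \<theta> c) + ereal (\<theta> c)" by (rule add_right_mono)
    then show ?thesis using real by simp
  next
    case MInf
    then show ?thesis using low[OF w] by simp
  qed simp
  have near: "F c \<le> F w + ereal \<sigma>" if w: "w \<in> Y" for w
  proof (cases "F w")
    case (real r)
    \<comment> \<open>A new gauge does not raise the value at its own centre, since
      \<open>N n 0 \<le> 0\<close>. Only the minimisation errors accumulate.\<close>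
    have dec: "f n + \<Theta> n (u n) \<le> r + (\<Sum>k\<le>n. l k * e k)" for n
    proof (induction n)
      case 0
      then show ?case using umin[OF w, of 0] f real \<Theta>0 by simp
    next
      case (Suc n)
      have "N n 0 \<le> 0" using smooth_gaugeD(2)[OF N subspace_0[OF Y(1)], of n] by simp
      then have "l n * N n 0 \<le> 0" using l0[of n] by (simp add: mult_le_0_iff)
      then show ?case using umin[OF uY[of n], of "Suc n"] f \<Theta>S[of n "u n"] Suc by simp
    qed
    have "F (u n) \<le> ereal (r + \<sigma>)" for n
    proof -
      have "(\<Sum>k\<le>n. l k * e k) \<le> (\<Sum>k\<le>n. l k * \<kappa>)"
        using l0 e\<kappa> by (intro sum_mono mult_left_mono) (auto simp: less_imp_le)
      also have "\<dots> \<le> \<beta> * \<kappa>"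
        unfolding sum_distrib_right[symmetric] using \<kappa> lsum[of "{..n}"] by (intro mult_right_mono) auto
      finally have "f n \<le> r + 2 * (\<beta> * \<kappa>)" using dec[of n] \<Theta>low[OF uY[of n], of n] by simp
      then show ?thesis using f \<beta> unfolding \<kappa>_def by simp
    qed
    then have "F c \<le> ereal (r + \<sigma>)" using lsc[OF _ c, of "r + \<sigma>"] uY by (simp add: image_subset_iff)
    then show ?thesis using real by simp
  next
    case MInf
    then show ?thesis using low[OF w] by simp
  qed simp
  have "\<exists>\<xi>. \<xi> \<in> dual_ball Y \<and> (\<forall>h\<in>Y. N k (c - u k) + \<xi> h \<le> N k (c - u k + h)) \<and>
      (\<forall>\<epsilon>>0. \<exists>\<delta>>0. \<forall>h\<in>Y. norm h < \<delta> \<longrightarrow> N k (c - u k + h) \<le> N k (c - u k) + \<xi> h + \<epsilon> * norm h)" for k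
    using smooth_gaugeD(3)[OF N subspace_diff[OF Y(1) cY uY[of k]], of k] by blast
  then obtain \<xi> where \<xi>: "\<And>k. \<xi> k \<in> dual_ball Y"
    "\<And>k \<epsilon>. 0 < \<epsilon> \<Longrightarrow> \<exists>\<delta>>0. \<forall>h\<in>Y. norm h < \<delta> \<longrightarrow> N k (c - u k + h) \<le> N k (c - u k) + \<xi> k h + \<epsilon> * norm h"
    by metis
  define \<tau> where "\<tau> h = (\<Sum>k. l k * \<xi> k h)" for h
  have \<xi>b: "norm (l k * \<xi> k h) \<le> l k * norm h" for k h
    using dual_ballD(1)[OF \<xi>(1)[of k], of h] l0[of k] by (auto simp: abs_mult intro!: mult_left_mono)
  have ls: "summable (\<lambda>k. l k * a)" for a using sums_summable[OF lsums] by (rule summable_mult2)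
  have \<tau>s: "summable (\<lambda>k. l k * \<xi> k h)" for h
    using \<xi>b by (intro summable_comparison_test'[OF ls[of "norm h"], of 0]) auto
  have \<tau>b: "\<bar>\<tau> h\<bar> \<le> \<beta> * norm h" for h
  proof -
    have "norm (\<tau> h) \<le> (\<Sum>k. l k * norm h)" unfolding \<tau>_def using \<xi>b by (intro norm_suminf_le ls)
    also have "\<dots> = \<beta> * norm h" using sums_unique[OF sums_mult2[OF lsums, of "norm h"]] by simp
    finally show ?thesis by simp
  qed
  have \<tau>d: "\<tau> \<in> dual_on Y"
  proof -
    have "\<tau> (a + b) = \<tau> a + \<tau> b" if "a \<in> Y" "b \<in> Y" for a b
      unfolding \<tau>_def using dual_ballD(2)[OF \<xi>(1) that] suminf_add[OF \<tau>s \<tau>s, of a b]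
      by (simp add: distrib_left)
    moreover have "\<tau> (t *\<^sub>R a) = t * \<tau> a" if "a \<in> Y" for t a
      unfolding \<tau>_def using dual_ballD(3)[OF \<xi>(1) that] suminf_mult[OF \<tau>s, of t a]
      by (simp add: mult.left_commute)
    ultimately show ?thesis unfolding dual_on_def using \<tau>b by blast
  qed
  have sm: "\<exists>\<delta>>0. \<forall>h\<in>Y. norm h < \<delta> \<longrightarrow> \<theta> (c + h) \<le> \<theta> c + \<tau> h + \<epsilon> * norm h" if \<epsilon>: "0 < \<epsilon>" for \<epsilon>
  proof -
    \<comment> \<open>Tail terms are at most \<open>l k * (2 * norm h)\<close>, from the gauge
      increment and from \<open>\<xi> k h\<close>; hence \<open>\<epsilon> / 4\<close>. Only the
      finitely many terms before \<open>M\<close> use their own radius of differentiability.\<close>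
    have "(\<lambda>n. (\<Sum>k. l (k + n))) \<longlonglongrightarrow> 0" using sums_summable[OF lsums] by (rule suminf_exist_split2)
    then have "\<forall>\<^sub>F n in sequentially. (\<Sum>k. l (k + n)) < \<epsilon> / 4" using \<epsilon> by (intro order_tendstoD(2)) auto
    then obtain M where M: "(\<Sum>k. l (k + M)) < \<epsilon> / 4" by (auto simp: eventually_sequentially)
    have "\<exists>\<delta>>0. \<forall>h\<in>Y. norm h < \<delta> \<longrightarrow> N k (c - u k + h) \<le> N k (c - u k) + \<xi> k h + \<epsilon> / (2 * \<beta>) * norm h" for k
      by (rule \<xi>(2)) (use \<epsilon> \<beta> in simp)
    then obtain \<delta> where \<delta>: "\<And>k. 0 < \<delta> k"
      "\<And>k h. h \<in> Y \<Longrightarrow> norm h < \<delta> k \<Longrightarrow> N k (c - u k + h) \<le> N k (c - u k) + \<xi> k h + \<epsilon> / (2 * \<beta>) * norm h"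
      by metis
    define D where "D = Min (insert 1 (\<delta> ` {..<M}))"
    have "0 < D" unfolding D_def using \<delta>(1) by (subst Min_gr_iff) auto
    moreover have "\<theta> (c + h) \<le> \<theta> c + \<tau> h + \<epsilon> * norm h" if h: "h \<in> Y" "norm h < D" for h
    proof -
      define t where "t k = l k * N k (c + h - u k) - l k * N k (c - u k) - l k * \<xi> k h" for k
      have chY: "c + h \<in> Y" using subspace_add[OF Y(1) cY h(1)] .
      have ts: "summable t" unfolding t_def by (intro summable_diff \<theta>s chY cY \<tau>s)
      have teq: "suminf t = \<theta> (c + h) - \<theta> c - \<tau> h"
        unfolding t_def \<theta>_def \<tau>_def
        using suminf_diff[OF summable_diff[OF \<theta>s[OF chY] \<theta>s[OF cY]] \<tau>s[of h]]
          suminf_diff[OF \<theta>s[OF chY] \<theta>s[OF cY]] by simp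
      have split: "suminf t = (\<Sum>k. t (k + M)) + sum t {..<M}" by (rule suminf_split_initial_segment[OF ts])
      have "(\<Sum>k. t (k + M)) \<le> (\<Sum>k. l (k + M) * (2 * norm h))"
      proof (rule suminf_le)
        fix k
        let ?k = "k + M"
        have "N ?k (c + h - u ?k) - N ?k (c - u ?k) \<le> norm h"
          using smooth_gauge_lipschitz[OF N Y(1) subspace_diff[OF Y(1) chY uY[of ?k]] subspace_diff[OF Y(1) cY uY[of ?k]], of ?k] by simp
        then have "l ?k * (N ?k (c + h - u ?k) - N ?k (c - u ?k) - \<xi> ?k h) \<le> l ?k * (2 * norm h)"
          using dual_ballD(1)[OF \<xi>(1)[of ?k], of h] l0[of ?k] by (intro mult_left_mono) auto
        then show "t ?k \<le> l ?k * (2 * norm h)" unfolding t_def by (simp add: algebra_simps)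
      next
        show "summable (\<lambda>k. t (k + M))" using ts by (rule summable_ignore_initial_segment)
        show "summable (\<lambda>k. l (k + M) * (2 * norm h))"
          by (rule summable_mult2) (rule summable_ignore_initial_segment[OF sums_summable[OF lsums]])
      qed
      also have "\<dots> = (\<Sum>k. l (k + M)) * (2 * norm h)"
        by (rule suminf_mult2[symmetric]) (rule summable_ignore_initial_segment[OF sums_summable[OF lsums]])
      also have "\<dots> \<le> \<epsilon> / 4 * (2 * norm h)" using M by (intro mult_right_mono) auto
      finally have 1: "(\<Sum>k. t (k + M)) \<le> \<epsilon> / 2 * norm h" by simp
      have "sum t {..<M} \<le> (\<Sum>k<M. l k * (\<epsilon> / (2 * \<beta>) * norm h))"
      proof (rule sum_mono)
        fix k assume "k \<in> {..<M}"
        then have "D \<le> \<delta> k" unfolding D_def by (intro Min_le) auto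
        then have "N k (c + h - u k) - N k (c - u k) - \<xi> k h \<le> \<epsilon> / (2 * \<beta>) * norm h"
          using \<delta>(2)[OF h(1), of k] h(2) by (simp add: algebra_simps)
        then have "l k * (N k (c + h - u k) - N k (c - u k) - \<xi> k h) \<le> l k * (\<epsilon> / (2 * \<beta>) * norm h)"
          using l0[of k] by (intro mult_left_mono) auto
        then show "t k \<le> l k * (\<epsilon> / (2 * \<beta>) * norm h)" unfolding t_def by (simp add: algebra_simps)
      qed
      also have "\<dots> \<le> \<beta> * (\<epsilon> / (2 * \<beta>) * norm h)"
        unfolding sum_distrib_right[symmetric] using lsum[of "{..<M}"] \<epsilon> \<beta> by (intro mult_right_mono) auto
      also have "\<dots> = \<epsilon> / 2 * norm h" using \<beta> by simp
      finally show ?thesis using 1 split teq by simp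
    qed
    ultimately show ?thesis by blast
  qed
  show thesis using that[of c \<theta> \<tau>] cY min near \<tau>d \<tau>b sm by blast
qed

section \<open>Separable reduction of Frechet subgradients\<close>

type_synonym 'a config = "(rat \<times> rat \<times> rat) list \<times> 'a \<times> 'a \<times> rat"

text \<open>In \<open>(L, d, w, \<rho>)\<close>, an entry of \<open>L\<close> consists of a coefficient, a radius around \<open>d\<close> and a level for
  \<open>f\<close>. These are rational so that a countable set of points has only countably many configurations.\<close>
definition realises :: "('a::real_normed_vector \<Rightarrow> ereal) \<Rightarrow> 'a config \<Rightarrow> 'a list \<Rightarrow> bool" where
  "realises f = (\<lambda>(L, d, w, \<rho>) us. length us = length L \<and>
     (\<forall>i<length L. norm (us ! i - d) < of_rat (fst (snd (L ! i))) \<and> f (us ! i) < ereal (of_rat (snd (snd (L ! i))))) \<and>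
     norm ((\<Sum>i<length L. of_rat (fst (L ! i)) *\<^sub>R (us ! i)) - w) < of_rat \<rho>)"

lemma realises_map_iff:
  "realises f (map (\<lambda>i. (\<mu> i, r i, q i)) [0..<n], d, w, \<rho>) us \<longleftrightarrow> length us = n \<and>
     (\<forall>i<n. norm (us ! i - d) < of_rat (r i) \<and> f (us ! i) < ereal (of_rat (q i))) \<and>
     norm ((\<Sum>i<n. of_rat (\<mu> i) *\<^sub>R (us ! i)) - w) < of_rat \<rho>"
proof -
  have "(\<Sum>i<n. of_rat (fst (map (\<lambda>i. (\<mu> i, r i, q i)) [0..<n] ! i)) *\<^sub>R (us ! i))
      = (\<Sum>i<n. of_rat (\<mu> i) *\<^sub>R (us ! i))"
    by (rule sum.cong) auto
  then show ?thesis unfolding realises_def by simp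
qed

text \<open>The default \<open>[]\<close> contributes no points when a configuration cannot be
  realised.\<close>

definition realisation :: "('a::real_normed_vector \<Rightarrow> ereal) \<Rightarrow> 'a config \<Rightarrow> 'a list" where
  "realisation f C = (if \<exists>us. realises f C us then SOME us. realises f C us else [])"

lemma realises_realisation: "realises f C us \<Longrightarrow> realises f C (realisation f C)"
  unfolding realisation_def by (auto intro: someI)

text \<open>Rational combinations make the topological closure of a closed-off set a subspace;
  chosen realisations move finite obstructions into the set.\<close>

definition close_step :: "('a::real_normed_vector \<Rightarrow> ereal) \<Rightarrow> 'a set \<Rightarrow> 'a set" where
  "close_step f D = D \<union> (\<lambda>(p, q, a, b). of_rat p *\<^sub>R a + of_rat q *\<^sub>R b) ` (UNIV \<times> UNIV \<times> D \<times> D)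
     \<union> (\<Union>C\<in>UNIV \<times> D \<times> D \<times> UNIV. set (realisation f C))"

lemma countable_close_step: "countable D \<Longrightarrow> countable (close_step f D)"
  unfolding close_step_def
  by (intro countable_Un countable_image countable_SIGMA countable_UN) (auto intro: countable_finite)

text \<open>Every rule of \<open>close_step\<close> uses at most two points of the set, and these
  occur together at some finite stage. The union of the stages is therefore stable.\<close>

lemma countable_closure_exists:
  fixes f :: "'a::real_normed_vector \<Rightarrow> ereal"
  assumes "countable S"
  obtains D where "countable D" "S \<subseteq> D" "0 \<in> D" "close_step f D \<subseteq> D"
proof -
  define E where "E n = (close_step f ^^ n) (insert 0 S)" for n
  have E0: "E 0 = insert 0 S" and ES: "E (Suc n) = close_step f (E n)" for n unfolding E_def by auto
  have cE: "countable (E n)" for n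
    by (induction n) (use assms in \<open>auto simp: E0 ES intro: countable_close_step\<close>)
  have "E n \<subseteq> E (Suc n)" for n unfolding ES close_step_def by blast
  then have mono: "m \<le> n \<Longrightarrow> E m \<subseteq> E n" for m n by (rule lift_Suc_mono_le)
  define U where "U = (\<Union>n. E n)"
  have common: "\<exists>n. a \<in> E n \<and> b \<in> E n" if "a \<in> U" "b \<in> U" for a b
    using that mono unfolding U_def by (metis UN_E nat_le_linear subsetD)
  have "x \<in> U" if x: "x \<in> close_step f U" for x
  proof -
    have "\<exists>n. x \<in> close_step f (E n)"
      using x unfolding close_step_def[of f U]
    proof (elim UnE)
      assume "x \<in> U"
      then show ?thesis unfolding U_def close_step_def by blast
    next
      assume "x \<in> (\<lambda>(p, q, a, b). of_rat p *\<^sub>R a + of_rat q *\<^sub>R b) ` (UNIV \<times> UNIV \<times> U \<times> U)"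
      then obtain p q a b where 1: "x = of_rat p *\<^sub>R a + of_rat q *\<^sub>R b"
        and ab: "a \<in> U" "b \<in> U" by auto
      obtain n where "a \<in> E n" "b \<in> E n" using common[OF ab] by blast
      then have "x \<in> (\<lambda>(p, q, a, b). of_rat p *\<^sub>R a + of_rat q *\<^sub>R b) ` (UNIV \<times> UNIV \<times> E n \<times> E n)"
        using 1 by (intro image_eqI[of _ _ "(p, q, a, b)"]) auto
      then show ?thesis unfolding close_step_def by blast
    next
      assume "x \<in> (\<Union>C\<in>UNIV \<times> U \<times> U \<times> UNIV. set (realisation f C))"
      then obtain L a b \<rho> where 1: "x \<in> set (realisation f (L, a, b, \<rho>))"
        and ab: "a \<in> U" "b \<in> U" by auto
      obtain n where "a \<in> E n" "b \<in> E n" using common[OF ab] by blast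
      then have "(L, a, b, \<rho>) \<in> UNIV \<times> E n \<times> E n \<times> UNIV" by auto
      then show ?thesis using 1 unfolding close_step_def by blast
    qed
    then show ?thesis unfolding ES[symmetric] U_def by blast
  qed
  then show thesis
    using cE E0 by (intro that[of U]) (auto simp: U_def intro!: exI[of _ 0])
qed

lemma subspace_closure_rational:
  fixes D :: "'a::real_normed_vector set"
  assumes 0: "0 \<in> D" and comb: "\<And>p q a b. a \<in> D \<Longrightarrow> b \<in> D \<Longrightarrow> of_rat p *\<^sub>R a + of_rat q *\<^sub>R b \<in> D"
  shows "subspace (closure D)"
proof (rule subspaceI)
  show "0 \<in> closure D" using 0 closure_subset by blast
next
  fix x y assume "x \<in> closure D" "y \<in> closure D"
  then obtain a b where a: "\<And>n. a n \<in> D" "a \<longlonglongrightarrow> x" and b: "\<And>n. b n \<in> D" "b \<longlonglongrightarrow> y"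
    unfolding closure_sequential by blast
  have "a n + b n \<in> D" for n using comb[OF a(1)[of n] b(1)[of n], of 1 1] by simp
  then show "x + y \<in> closure D"
    unfolding closure_sequential using tendsto_add[OF a(2) b(2)] by (intro exI[of _ "\<lambda>n. a n + b n"]) simp
next
  fix t :: real and x assume "x \<in> closure D"
  then obtain a where a: "\<And>n. a n \<in> D" "a \<longlonglongrightarrow> x" unfolding closure_sequential by blast
  have "\<exists>q::rat. \<bar>of_rat q - t\<bar> < 1 / real (Suc n)" for n
  proof -
    obtain q where "t < of_rat q" "of_rat q < t + 1 / real (Suc n)"
      using of_rat_dense[of t "t + 1 / real (Suc n)"] by auto
    then show ?thesis by (intro exI[of _ q]) auto
  qed
  then obtain q :: "nat \<Rightarrow> rat" where q: "\<And>n. \<bar>of_rat (q n) - t\<bar> < 1 / real (Suc n)" by metis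
  have "(\<lambda>n. of_rat (q n) - t) \<longlonglongrightarrow> 0"
    using less_imp_le[OF q] by (intro Lim_null_comparison[OF _ LIMSEQ_Suc[OF lim_1_over_n]]) simp
  then have "(\<lambda>n. of_rat (q n)) \<longlonglongrightarrow> t" by (rule LIM_zero_cancel)
  from tendsto_scaleR[OF this a(2)] have "(\<lambda>n. of_rat (q n) *\<^sub>R a n) \<longlonglongrightarrow> t *\<^sub>R x" .
  moreover have "of_rat (q n) *\<^sub>R a n \<in> D" for n using comb[OF a(1)[of n] a(1)[of n], of "q n" 0] by simp
  ultimately show "t *\<^sub>R x \<in> closure D"
    unfolding closure_sequential by (intro exI[of _ "\<lambda>n. of_rat (q n) *\<^sub>R a n"]) simp
qed

text \<open>Configurations admit only rational numbers and centres in \<open>D\<close>, whereas the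
  data here are real numbers and limits of \<open>D\<close>. Strict inequalities leave room for
  rounding, and the chosen realisation of the rounded configuration lies in
  \<open>D\<close>.\<close>

lemma realise_in_closure:
  fixes f :: "'a::real_normed_vector \<Rightarrow> ereal" and n :: nat and \<mu> r q :: "nat \<Rightarrow> real"
  assumes D: "close_step f D \<subseteq> D" and c: "c \<in> closure D" and w: "w \<in> closure D"
    and r: "\<And>i. i < n \<Longrightarrow> norm (u i - c) < r i" and q: "\<And>i. i < n \<Longrightarrow> f (u i) < ereal (q i)"
    and e: "0 < e"
  obtains u' where "\<And>i. i < n \<Longrightarrow> u' i \<in> closure D" "\<And>i. i < n \<Longrightarrow> norm (u' i - c) < r i"
    "\<And>i. i < n \<Longrightarrow> f (u' i) < ereal (q i)"
    "norm ((\<Sum>i<n. \<mu> i *\<^sub>R u' i) - w) < norm ((\<Sum>i<n. \<mu> i *\<^sub>R u i) - w) + e"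
proof -
  \<comment> \<open>Points within \<open>r i\<close> of \<open>c\<close> have norm at most
    \<open>norm c + r i\<close>. Thus rounding the coefficients by \<open>e / (8 * B)\<close> moves
    the combination by at most \<open>e / 8\<close>, for the old points as well as for the new
    ones.\<close>
  define B where "B = 1 + (\<Sum>i<n. norm c + r i)"
  have r0: "0 < r i" if "i < n" for i using r[OF that] norm_ge_zero[of "u i - c"] by linarith
  have B: "0 < B"
    unfolding B_def using less_imp_le[OF r0] by (intro add_pos_nonneg sum_nonneg add_nonneg_nonneg) auto
  have "\<exists>p::rat. \<mu> i < of_rat p \<and> of_rat p < \<mu> i + e / (8 * B)" for i
    using of_rat_dense[of "\<mu> i" "\<mu> i + e / (8 * B)"] e B by auto
  then obtain \<mu>' :: "nat \<Rightarrow> rat" where \<mu>': "\<And>i. \<mu> i < of_rat (\<mu>' i) \<and> of_rat (\<mu>' i) < \<mu> i + e / (8 * B)"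
    by metis
  have \<mu>diff: "\<bar>of_rat (\<mu>' i) - \<mu> i\<bar> \<le> e / (8 * B)" for i using \<mu>'[of i] by auto
  have perturb: "norm ((\<Sum>i<n. \<mu> i *\<^sub>R v i) - (\<Sum>i<n. of_rat (\<mu>' i) *\<^sub>R v i)) \<le> e / 8"
    if v: "\<And>i. i < n \<Longrightarrow> norm (v i - c) < r i" for v
  proof -
    have "norm ((\<Sum>i<n. \<mu> i *\<^sub>R v i) - (\<Sum>i<n. of_rat (\<mu>' i) *\<^sub>R v i))
        = norm (\<Sum>i<n. (\<mu> i - of_rat (\<mu>' i)) *\<^sub>R v i)"
      by (simp add: sum_subtractf scaleR_left_diff_distrib)
    also have "\<dots> \<le> (\<Sum>i<n. e / (8 * B) * (norm c + r i))"
    proof (rule sum_norm_le)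
      fix i assume "i \<in> {..<n}"
      then have "norm (v i) \<le> norm c + r i"
        using v[of i] norm_triangle_ineq[of "v i - c" c] by simp
      then have "\<bar>of_rat (\<mu>' i) - \<mu> i\<bar> * norm (v i) \<le> e / (8 * B) * (norm c + r i)"
        using \<mu>diff[of i] e B by (intro mult_mono) auto
      then show "norm ((\<mu> i - of_rat (\<mu>' i)) *\<^sub>R v i) \<le> e / (8 * B) * (norm c + r i)"
        by (simp add: abs_minus_commute)
    qed
    also have "\<dots> = e / (8 * B) * (\<Sum>i<n. norm c + r i)" by (simp add: sum_distrib_left)
    also have "\<dots> \<le> e / (8 * B) * B" using e B unfolding B_def by (intro mult_left_mono) auto
    also have "\<dots> = e / 8" using B by simp
    finally show ?thesis .
  qed
  \<comment> \<open>\<open>m\<close> is the least slack in the distance constraints. Replacing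
    \<open>c\<close> by \<open>d\<close> and later going back costs \<open>m / 3\<close> each time,
    which leaves an interval for the rational radius.\<close>
  define m where "m = Min (insert 1 ((\<lambda>i. r i - norm (u i - c)) ` {..<n}))"
  have m: "0 < m" unfolding m_def using r by (subst Min_gr_iff) auto
  have mle: "m \<le> r i - norm (u i - c)" if "i < n" for i unfolding m_def using that by (intro Min_le) auto
  obtain d where d: "d \<in> D" "norm (d - c) < m / 3"
    using c m unfolding closure_approachable dist_norm by (metis divide_pos_pos zero_less_numeral)
  obtain wd where wd: "wd \<in> D" "norm (wd - w) < e / 8"
    using w e unfolding closure_approachable dist_norm by (metis divide_pos_pos zero_less_numeral)
  have "\<exists>p::rat. i < n \<longrightarrow> norm (u i - c) + m / 3 < of_rat p \<and> of_rat p < r i - m / 3" for i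
  proof (cases "i < n")
    case True
    then have "norm (u i - c) + m / 3 < r i - m / 3" using mle m by fastforce
    then show ?thesis using of_rat_dense by blast
  qed simp
  then obtain r' :: "nat \<Rightarrow> rat" where
    r': "\<And>i. i < n \<Longrightarrow> norm (u i - c) + m / 3 < of_rat (r' i) \<and> of_rat (r' i) < r i - m / 3" by metis
  have "\<exists>p::rat. i < n \<longrightarrow> f (u i) < ereal (of_rat p) \<and> ereal (of_rat p) < ereal (q i)" for i
    using q ereal_dense3 by blast
  then obtain q' :: "nat \<Rightarrow> rat" where
    q': "\<And>i. i < n \<Longrightarrow> f (u i) < ereal (of_rat (q' i)) \<and> ereal (of_rat (q' i)) < ereal (q i)" by metis
  let ?S = "\<Sum>i<n. \<mu> i *\<^sub>R u i" and ?S' = "\<Sum>i<n. of_rat (\<mu>' i) *\<^sub>R u i"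
  obtain \<rho> :: rat where \<rho>: "norm (?S' - wd) < of_rat \<rho>" "of_rat \<rho> < norm (?S' - wd) + e / 8"
    using of_rat_dense[of "norm (?S' - wd)" "norm (?S' - wd) + e / 8"] e by auto
  define C where "C = (map (\<lambda>i. (\<mu>' i, r' i, q' i)) [0..<n], d, wd, \<rho>)"
  have "realises f C (map u [0..<n])"
  proof -
    have "norm (u i - d) < of_rat (r' i)" if "i < n" for i
      using r'[OF that] d(2) norm_triangle_ineq[of "u i - c" "c - d"] by (simp add: norm_minus_commute)
    then show ?thesis unfolding C_def realises_map_iff using q' \<rho>(1) by simp
  qed
  define us where "us = realisation f C"
  have R: "realises f C us" unfolding us_def by (rule realises_realisation) fact
  have "C \<in> UNIV \<times> D \<times> D \<times> UNIV" unfolding C_def using d(1) wd(1) by simp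
  then have "set us \<subseteq> close_step f D" unfolding us_def close_step_def by (intro le_supI2 UN_upper)
  then have RD: "set us \<subseteq> D" using D by (rule order_trans)
  define u' where "u' i = us ! i" for i
  have len: "length us = n" using R unfolding C_def realises_map_iff by blast
  have u'd: "norm (u' i - d) < of_rat (r' i)" and u'q: "f (u' i) < ereal (of_rat (q' i))" if "i < n" for i
    using R that unfolding C_def realises_map_iff u'_def by blast+
  have u'S: "norm ((\<Sum>i<n. of_rat (\<mu>' i) *\<^sub>R u' i) - wd) < of_rat \<rho>"
    using R unfolding C_def realises_map_iff u'_def by blast
  have u'r: "norm (u' i - c) < r i" if "i < n" for i
    using u'd[OF that] r'[OF that] d(2) norm_triangle_ineq[of "u' i - d" "d - c"] by simp
  show thesis
  proof (rule that)
    fix i assume i: "i < n"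
    show "u' i \<in> closure D" using RD len i closure_subset unfolding u'_def by (metis nth_mem subsetD)
    show "norm (u' i - c) < r i" by (rule u'r[OF i])
    show "f (u' i) < ereal (q i)" using u'q[OF i] q'[OF i] by (auto intro: less_trans)
  next
    let ?T = "\<Sum>i<n. \<mu> i *\<^sub>R u' i" and ?T' = "\<Sum>i<n. of_rat (\<mu>' i) *\<^sub>R u' i"
    have "norm (?T - w) \<le> norm (?T - ?T') + norm (?T' - wd) + norm (wd - w)"
      using norm_triangle_ineq[of "?T - ?T'" "?T' - wd"] norm_triangle_ineq[of "?T - wd" "wd - w"] by simp
    moreover have "norm (?S' - wd) \<le> norm (?S - ?S') + norm (?S - w) + norm (wd - w)"
      using norm_triangle_ineq[of "?S' - ?S" "?S - w"] norm_triangle_ineq[of "?S' - w" "w - wd"]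
      by (simp add: norm_minus_commute)
    ultimately show "norm (?T - w) < norm (?S - w) + e"
      \<comment> \<open>Two coefficient roundings, two replacements of \<open>w\<close> by
        \<open>wd\<close> and the slack in \<open>\<rho>\<close> cost \<open>e / 8\<close> each, in
        total less than \<open>e\<close>.\<close>
      using perturb[OF u'r] perturb[OF r] wd(2) u'S \<rho>(2) e by linarith
  qed
qed

text \<open>The division-free form from \<open>frechet_subdiff_iff\<close>, with test points
  restricted to \<open>Y\<close>.\<close>

definition frechet_subdiff_on :: "'a::real_normed_vector set \<Rightarrow> ('a \<Rightarrow> ereal) \<Rightarrow> 'a \<Rightarrow> ('a \<Rightarrow> real) set" where
  "frechet_subdiff_on Y f c = {g \<in> dual_on Y. \<exists>a. f c = ereal a \<and>
     (\<forall>\<epsilon>>0. \<exists>\<delta>>0. \<forall>u\<in>Y. norm (u - c) < \<delta> \<longrightarrow> ereal (a + g (u - c) - \<epsilon> * norm (u - c)) \<le> f u)}"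

text \<open>Extending the subgradient \<open>g\<close> on \<open>Y\<close> amounts to finding a functional below a cone generated by
  difference quotients of \<open>f\<close> and the graph of \<open>g\<close>. An obstruction to this is a finite family
  of points, hence can be moved into \<open>Y\<close>, where \<open>g\<close> itself rules it out.\<close>
theorem separable_reduction:
  fixes f :: "'a::real_normed_vector \<Rightarrow> ereal"
  assumes ninf: "\<And>x. f x \<noteq> -\<infinity>" and S: "countable S"
  obtains Y where "subspace Y" "closed Y" "separable_set Y" "S \<subseteq> Y"
    "\<forall>c\<in>Y. \<forall>g\<in>frechet_subdiff_on Y f c. \<exists>l\<in>frechet_subdiff f c. \<forall>w\<in>Y. blinfun_apply l w = g w"
proof -
  obtain D where D: "countable D" "S \<subseteq> D" "0 \<in> D" "close_step f D \<subseteq> D"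
    using countable_closure_exists[OF S] by blast
  define Y where "Y = closure D"
  have DY: "D \<subseteq> Y" unfolding Y_def by (rule closure_subset)
  have Y: "subspace Y"
    unfolding Y_def
  proof (rule subspace_closure_rational[OF D(3)])
    fix p q a b assume "a \<in> D" "b \<in> D"
    then have "of_rat p *\<^sub>R a + of_rat q *\<^sub>R b \<in> close_step f D"
      unfolding close_step_def by (intro UnI1 UnI2 image_eqI[of _ _ "(p, q, a, b)"]) auto
    then show "of_rat p *\<^sub>R a + of_rat q *\<^sub>R b \<in> D" using D(4) by blast
  qed
  have ext: "\<exists>l\<in>frechet_subdiff f c. \<forall>w\<in>Y. blinfun_apply l w = g w"
    if c: "c \<in> Y" and fc: "f c = ereal a" and g: "g \<in> dual_on Y"
      and sub: "\<And>\<epsilon>. 0 < \<epsilon> \<Longrightarrow> \<exists>\<delta>>0. \<forall>u\<in>Y. norm (u - c) < \<delta> \<longrightarrow> ereal (a + g (u - c) - \<epsilon> * norm (u - c)) \<le> f u"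
    for c a g
  proof -
    have gadd: "g (v + w) = g v + g w" and gsc: "g (t *\<^sub>R v) = t * g v" if "v \<in> Y" "w \<in> Y" for v w t
      using g that unfolding dual_on_def by auto
    obtain K0 where "\<forall>y\<in>Y. \<bar>g y\<bar> \<le> K0 * norm y" using g unfolding dual_on_def by auto
    then have K0: "\<And>y. y \<in> Y \<Longrightarrow> \<bar>g y\<bar> \<le> K0 * norm y" by blast
    define K where "K = max K0 0"
    have gK: "\<bar>g y\<bar> \<le> K * norm y" if "y \<in> Y" for y
      using K0[OF that] mult_right_mono[of K0 K "norm y"] unfolding K_def by auto
    have K: "0 \<le> K" unfolding K_def by simp
    have gsum: "g (\<Sum>i<n. t i *\<^sub>R v i) = (\<Sum>i<n. t i * g (v i))" if "\<And>i. i < n \<Longrightarrow> v i \<in> Y" for n :: nat and t v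
      using that
    proof (induction n)
      case 0
      then show ?case using gsc[OF subspace_0[OF Y] subspace_0[OF Y], of 0] by simp
    next
      case (Suc n)
      have "(\<Sum>i<n. t i *\<^sub>R v i) \<in> Y" using Suc.prems by (intro subspace_sum[OF Y] subspace_scale[OF Y]) auto
      moreover have "v n \<in> Y" using Suc.prems by auto
      moreover have "t n *\<^sub>R v n \<in> Y" using Suc.prems by (intro subspace_scale[OF Y]) auto
      ultimately show ?case using Suc gadd gsc by simp
    qed
    obtain \<delta> where \<delta>: "\<And>\<epsilon>. 0 < \<epsilon> \<Longrightarrow> 0 < \<delta> \<epsilon>"
      "\<And>\<epsilon> u. 0 < \<epsilon> \<Longrightarrow> u \<in> Y \<Longrightarrow> norm (u - c) < \<delta> \<epsilon> \<Longrightarrow> ereal (a + g (u - c) - \<epsilon> * norm (u - c)) \<le> f u"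
      using sub by metis
    \<comment> \<open>Here \<open>b\<close> lies strictly above
      \<open>f (c + h) - a + \<epsilon> * norm h\<close>, within the radius \<delta> that serves
      \<open>g\<close> on \<open>Y\<close>. A functional below \<open>G\<close> is thus a Frechet
      subgradient on the whole space with the same radii.\<close>
    define G where "G = {(h, b). \<exists>\<epsilon>>0. norm h < \<delta> \<epsilon> \<and> f (c + h) < ereal (a + b - \<epsilon> * norm h)}"
    define T where "T = {(t::real, h, b). 0 \<le> t \<and> (h, b) \<in> G}"
    \<comment> \<open>The graph of \<open>g\<close> enters with both \<open>w\<close> and
      \<open>- w\<close>, so a functional below \<open>A\<close> has to coincide with
      \<open>g\<close> on \<open>Y\<close>.\<close>
    define A where "A = {((\<Sum>(t, h, b)\<leftarrow>L. t *\<^sub>R h) + w, (\<Sum>(t, h, b)\<leftarrow>L. t * b) + g w) | L w. set L \<subseteq> T \<and> w \<in> Y}"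
    have "\<exists>l :: 'a \<Rightarrow>\<^sub>L real. norm l \<le> K \<and> (\<forall>h b. (h, b) \<in> A \<longrightarrow> blinfun_apply l h \<le> b)"
    proof (rule functional_below_cone[of A K])
      have "g 0 = 0" using gsum[of 0] by simp
      then show "(0, 0) \<in> A" unfolding A_def using subspace_0[OF Y] by (auto intro!: exI[of _ "[]"] exI[of _ 0])
    next
      fix h b k d assume hb: "(h, b) \<in> A" and kd: "(k, d) \<in> A"
      obtain L v where 1: "set L \<subseteq> T" "v \<in> Y" "h = (\<Sum>(t, h, b)\<leftarrow>L. t *\<^sub>R h) + v" "b = (\<Sum>(t, h, b)\<leftarrow>L. t * b) + g v"
        using hb unfolding A_def by blast
      obtain M w where 2: "set M \<subseteq> T" "w \<in> Y" "k = (\<Sum>(t, h, b)\<leftarrow>M. t *\<^sub>R h) + w" "d = (\<Sum>(t, h, b)\<leftarrow>M. t * b) + g w"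
        using kd unfolding A_def by blast
      show "(h + k, b + d) \<in> A" unfolding A_def using 1 2 gadd[OF 1(2) 2(2)] subspace_add[OF Y 1(2) 2(2)]
        by (intro CollectI exI[of _ "L @ M"] exI[of _ "v + w"]) auto
    next
      fix s :: real and h b assume s: "0 < s" and hb: "(h, b) \<in> A"
      obtain L v where 1: "set L \<subseteq> T" "v \<in> Y" "h = (\<Sum>(t, h, b)\<leftarrow>L. t *\<^sub>R h) + v" "b = (\<Sum>(t, h, b)\<leftarrow>L. t * b) + g v"
        using hb unfolding A_def by blast
      let ?m = "map (\<lambda>(t, h, b). (s * t, h, b))"
      have m1: "(\<Sum>(t, h, b)\<leftarrow>?m L. t *\<^sub>R h) = s *\<^sub>R (\<Sum>(t, h, b)\<leftarrow>L. t *\<^sub>R h)" for L :: "(real \<times> 'a \<times> real) list"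
        by (induction L) (auto simp: scaleR_add_right)
      have m2: "(\<Sum>(t, h, b)\<leftarrow>?m L. t * b) = s * (\<Sum>(t, h, b)\<leftarrow>L. t * b)" for L :: "(real \<times> 'a \<times> real) list"
        by (induction L) (auto simp: algebra_simps)
      have "set (?m L) \<subseteq> T" using 1(1) s unfolding T_def by auto
      then show "(s *\<^sub>R h, s * b) \<in> A"
        unfolding A_def using 1(3,4) gsc[OF 1(2) 1(2), of s] subspace_scale[OF Y 1(2), of s]
        by (intro CollectI exI[of _ "?m L"] exI[of _ "s *\<^sub>R v"]) (simp only: m1 m2, simp add: scaleR_add_right distrib_left)
    next
      show "0 \<le> K" by (rule K)
    next
      fix h b assume hb: "(h, b) \<in> A"
      obtain L w where 1: "set L \<subseteq> T" "w \<in> Y" "h = (\<Sum>(t, h, b)\<leftarrow>L. t *\<^sub>R h) + w" "b = (\<Sum>(t, h, b)\<leftarrow>L. t * b) + g w"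
        using hb unfolding A_def by blast
      define n where "n = length L"
      define t where "t i = fst (L ! i)" for i
      define v where "v i = fst (snd (L ! i))" for i
      define \<beta> where "\<beta> i = snd (snd (L ! i))" for i
      have h: "h = (\<Sum>i<n. t i *\<^sub>R v i) + w" and b: "b = (\<Sum>i<n. t i * \<beta> i) + g w"
        unfolding 1(3,4) sum_list_sum_nth n_def t_def v_def \<beta>_def
        by (auto simp: case_prod_beta atLeast0LessThan)
      have T: "0 \<le> t i" "(v i, \<beta> i) \<in> G" if "i < n" for i
      proof -
        have "L ! i \<in> T" using 1(1) that unfolding n_def by auto
        then show "0 \<le> t i" "(v i, \<beta> i) \<in> G" unfolding T_def t_def v_def \<beta>_def by (auto simp: case_prod_beta)
      qed
      \<comment> \<open>The points moved into \<open>Y\<close> will satisfy only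
        \<open>norm (u' i - c) < r i\<close>. The strict inequality in \<open>G\<close> has room to
        put such an \<open>r\<close> in place of \<open>norm (v i)\<close>.\<close>
      have "\<exists>\<epsilon> r. i < n \<longrightarrow> 0 < \<epsilon> \<and> norm (v i) < r \<and> r \<le> \<delta> \<epsilon> \<and> f (c + v i) < ereal (a + \<beta> i - \<epsilon> * r)" for i
      proof (cases "i < n")
        case True
        obtain \<epsilon> where \<epsilon>: "0 < \<epsilon>" "norm (v i) < \<delta> \<epsilon>" "f (c + v i) < ereal (a + \<beta> i - \<epsilon> * norm (v i))"
          using T(2)[OF True] unfolding G_def by auto
        obtain p where p: "f (c + v i) < ereal p" "ereal p < ereal (a + \<beta> i - \<epsilon> * norm (v i))"
          using ereal_dense2[OF \<epsilon>(3)] by blast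
        define r where "r = min (\<delta> \<epsilon>) ((a + \<beta> i - p) / \<epsilon>)"
        have "norm (v i) < r" using \<epsilon> p(2) unfolding r_def by (simp add: field_simps)
        moreover have "\<epsilon> * r \<le> a + \<beta> i - p" using \<epsilon>(1) unfolding r_def by (simp add: field_simps min_def)
        ultimately show ?thesis using \<epsilon>(1) p(1)
          by (intro exI[of _ \<epsilon>] exI[of _ r]) (auto simp: r_def intro: less_le_trans)
      qed auto
      then obtain \<epsilon> r where \<epsilon>r: "\<And>i. i < n \<Longrightarrow> 0 < \<epsilon> i \<and> norm (v i) < r i \<and> r i \<le> \<delta> (\<epsilon> i) \<and> f (c + v i) < ereal (a + \<beta> i - \<epsilon> i * r i)"
        by metis
      \<comment> \<open>Configurations contain points, not differences from \<open>c\<close>.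
        Subtracting \<open>z\<close> turns the combination of the points \<open>c + v i\<close> into
        \<open>h\<close>.\<close>
      define z where "z = (\<Sum>i<n. t i) *\<^sub>R c - w"
      have zY: "z \<in> Y" unfolding z_def using c 1(2) by (intro subspace_diff[OF Y] subspace_scale[OF Y])
      have shift: "(\<Sum>i<n. t i *\<^sub>R x i) - z = (\<Sum>i<n. t i *\<^sub>R (x i - c)) + w" for x
        unfolding z_def by (simp add: scaleR_diff_right sum_subtractf scaleR_sum_left)
      show "0 \<le> b + K * norm h"
      proof (rule field_le_epsilon)
        fix e :: real assume e: "0 < e"
        define e' where "e' = e / (K + 1)"
        have e': "0 < e'" "K * e' \<le> e" unfolding e'_def using K e by (auto simp: field_simps)
        obtain u' where u': "\<And>i. i < n \<Longrightarrow> u' i \<in> Y" "\<And>i. i < n \<Longrightarrow> norm (u' i - c) < r i"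
          "\<And>i. i < n \<Longrightarrow> f (u' i) < ereal (a + \<beta> i - \<epsilon> i * r i)"
          "norm ((\<Sum>i<n. t i *\<^sub>R u' i) - z) < norm ((\<Sum>i<n. t i *\<^sub>R (c + v i)) - z) + e'"
          unfolding Y_def
          by (rule realise_in_closure[of f D c z n "\<lambda>i. c + v i" r "\<lambda>i. a + \<beta> i - \<epsilon> i * r i" e' t])
            (use D(4) c zY \<epsilon>r e' in \<open>auto simp: Y_def\<close>)
        have u'c: "u' i - c \<in> Y" if "i < n" for i using subspace_diff[OF Y u'(1)[OF that] c] .
        have gb: "g (u' i - c) \<le> \<beta> i" if i: "i < n" for i
        proof -
          have "ereal (a + g (u' i - c) - \<epsilon> i * norm (u' i - c)) \<le> f (u' i)"
            using \<epsilon>r[OF i] u'(1,2)[OF i] by (intro \<delta>(2)) auto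
          also have "\<dots> < ereal (a + \<beta> i - \<epsilon> i * r i)" by (rule u'(3)[OF i])
          finally have "g (u' i - c) - \<epsilon> i * norm (u' i - c) < \<beta> i - \<epsilon> i * r i" by simp
          moreover have "\<epsilon> i * norm (u' i - c) \<le> \<epsilon> i * r i"
            using \<epsilon>r[OF i] u'(2)[OF i] by (intro mult_left_mono) auto
          ultimately show ?thesis by simp
        qed
        let ?y = "(\<Sum>i<n. t i *\<^sub>R (u' i - c)) + w"
        have sY: "(\<Sum>i<n. t i *\<^sub>R (u' i - c)) \<in> Y"
          using u'c by (intro subspace_sum[OF Y] subspace_scale[OF Y]) auto
        \<comment> \<open>The moved combination \<open>?y\<close> lies in \<open>Y\<close>, where
          \<open>g\<close> itself is below the cone. So
          \<open>b \<ge> g ?y \<ge> - K * norm ?y\<close>, and \<open>?y\<close> is hardly longer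
          than \<open>h\<close>.\<close>
        have "g ?y = (\<Sum>i<n. t i * g (u' i - c)) + g w"
          using gadd[OF sY 1(2)] gsum[of n "\<lambda>i. u' i - c" t] u'c by simp
        also have "\<dots> \<le> b" unfolding b using gb T(1) by (intro add_mono sum_mono mult_left_mono) auto
        finally have "g ?y \<le> b" .
        moreover have "- (K * norm ?y) \<le> g ?y" using gK[OF subspace_add[OF Y sY 1(2)]] by (simp add: abs_le_iff)
        moreover have "K * norm ?y \<le> K * (norm h + e')"
          using u'(4) K unfolding shift h by (intro mult_left_mono) auto
        ultimately show "0 \<le> b + K * norm h + e" using e'(2) by (simp add: distrib_left)
      qed
    qed auto
    then obtain l :: "'a \<Rightarrow>\<^sub>L real" where l: "\<And>h b. (h, b) \<in> A \<Longrightarrow> blinfun_apply l h \<le> b" by blast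
    have lg: "blinfun_apply l w = g w" if w: "w \<in> Y" for w
    proof -
      have *: "blinfun_apply l v \<le> g v" if "v \<in> Y" for v
        using that unfolding A_def by (intro l, unfold A_def) (auto intro!: exI[of _ "[]"])
      have "g (- w) = - g w" using gsc[OF w w, of "- 1"] by simp
      then show ?thesis using *[OF w] *[of "- w"] subspace_neg[OF Y w] by (simp add: blinfun.minus_right)
    qed
    have "l \<in> frechet_subdiff f c"
    proof (subst frechet_subdiff_iff[where f = f and x = c, OF fc ninf], intro allI impI)
      fix \<epsilon> :: real assume \<epsilon>: "0 < \<epsilon>"
      have "ereal (a + blinfun_apply l (y - c) - \<epsilon> * norm (y - c)) \<le> f y" if y: "norm (y - c) < \<delta> \<epsilon>" for y
      proof (cases "f y")
        case (real p)
        have "blinfun_apply l (y - c) \<le> b" if b: "p - a + \<epsilon> * norm (y - c) < b" for b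
        proof (rule l)
          have "(y - c, b) \<in> G" unfolding G_def using \<epsilon> y b real by (auto intro!: exI[of _ \<epsilon>])
          then have "set [(1, y - c, b)] \<subseteq> T" unfolding T_def by simp
          moreover have "g 0 = 0" using gsum[of 0] by simp
          ultimately show "(y - c, b) \<in> A" unfolding A_def using subspace_0[OF Y]
            by (intro CollectI exI[of _ "[(1, y - c, b)]"] exI[of _ 0]) auto
        qed
        then have "blinfun_apply l (y - c) \<le> p - a + \<epsilon> * norm (y - c)" by (rule dense_ge)
        then show ?thesis using real by simp
      qed (use ninf in auto)
      then show "\<exists>\<delta>>0. \<forall>y. norm (y - c) < \<delta> \<longrightarrow> ereal (a + blinfun_apply l (y - c) - \<epsilon> * norm (y - c)) \<le> f y"
        using \<delta>(1)[OF \<epsilon>] by blast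
    qed
    then show ?thesis using lg by blast
  qed
  show thesis
  proof (rule that[OF Y])
    show "closed Y" unfolding Y_def by simp
    show "separable_set Y" unfolding separable_set_def using D(1) DY by (intro exI[of _ D]) (simp add: Y_def)
    show "S \<subseteq> Y" using D(2) DY by blast
    show "\<forall>c\<in>Y. \<forall>g\<in>frechet_subdiff_on Y f c. \<exists>l\<in>frechet_subdiff f c. \<forall>w\<in>Y. blinfun_apply l w = g w"
      unfolding frechet_subdiff_on_def using ext by blast
  qed
qed

section \<open>A mean value theorem for Frechet subgradients\<close>

text \<open>A real level between \<open>m t\<close> and \<open>f u\<close> separates the variables
  and exhibits a union of open rectangles. The second variable allows bounds that vary along a
  segment; on the diagonal it gives semicontinuity of tilts.\<close>

lemma open_lsc_above_continuous:
  fixes f :: "'a::topological_space \<Rightarrow> ereal" and m :: "'b::topological_space \<Rightarrow> real"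
  assumes f: "lsc_fun f" and m: "continuous_on UNIV m"
  shows "open {(u, t). ereal (m t) < f u}"
proof -
  have "{(u, t). ereal (m t) < f u} = (\<Union>q. {u. ereal q < f u} \<times> {t. m t < q})"
  proof (intro set_eqI iffI)
    fix z assume "z \<in> {(u, t). ereal (m t) < f u}"
    then obtain u t where z: "z = (u, t)" "ereal (m t) < f u" by auto
    obtain q where "ereal (m t) < ereal q" "ereal q < f u" using ereal_dense2[OF z(2)] by blast
    then show "z \<in> (\<Union>q. {u. ereal q < f u} \<times> {t. m t < q})" using z(1) by auto
  next
    fix z assume "z \<in> (\<Union>q. {u. ereal q < f u} \<times> {t. m t < q})"
    then obtain q u t where z: "z = (u, t)" and q: "ereal q < f u" "ereal (m t) < ereal q" by auto
    then show "z \<in> {(u, t). ereal (m t) < f u}" using less_trans[OF q(2,1)] by simp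
  qed
  moreover have "open ({u. ereal q < f u} \<times> {t. m t < q})" for q
    using f open_Collect_less[OF m continuous_on_const[of UNIV q]]
    by (intro open_Times) (simp_all add: lsc_fun_iff_open)
  ultimately show ?thesis by auto
qed

lemma lsc_bounded_below_on_compact:
  fixes f :: "'a::topological_space \<Rightarrow> ereal"
  assumes f: "lsc_fun f" and C: "compact C" and ninf: "\<And>u. f u \<noteq> -\<infinity>"
  obtains b :: real where "\<And>u. u \<in> C \<Longrightarrow> ereal b < f u"
proof -
  have "\<exists>n::nat. ereal (- real n) < f u" for u
  proof (cases "f u")
    case (real v)
    obtain n :: nat where "- v < real n" using reals_Archimedean2 by blast
    then show ?thesis using real by (intro exI[of _ n]) auto
  qed (use ninf in auto)
  then have cover: "C \<subseteq> (\<Union>n::nat. {u. ereal (- real n) < f u})" by blast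
  obtain I where I: "finite I" "C \<subseteq> (\<Union>n\<in>I. {u. ereal (- real n) < f u})"
    by (rule compactE_image[OF C _ cover]) (use f in \<open>simp_all add: lsc_fun_iff_open\<close>)
  have "ereal (- real (Max (insert 0 I))) < f u" if u: "u \<in> C" for u
  proof -
    obtain n where n: "n \<in> I" "ereal (- real n) < f u" using I(2) u by blast
    have "n \<le> Max (insert 0 I)" using I(1) n(1) by (intro Max_ge) auto
    then have "ereal (- real (Max (insert 0 I))) \<le> ereal (- real n)" by simp
    then show ?thesis using n(2) by (rule le_less_trans)
  qed
  then show thesis by (rule that)
qed

text \<open>The critical slope \<open>s\<close> makes the cone with apex value \<open>r\<close> at \<open>t = 1\<close> touch \<open>\<phi>\<close> from below.\<close>
lemma touching_slope:
  fixes \<phi> :: "real \<Rightarrow> ereal"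
  assumes T: "0 < T" "T < 1" and low: "\<And>t. t \<in> {0..T} \<Longrightarrow> ereal b < \<phi> t" and \<phi>0: "\<phi> 0 < ereal r"
  obtains s where "0 < s" "\<And>t. t \<in> {0..T} \<Longrightarrow> ereal (r - s * (1 - t)) \<le> \<phi> t"
    "\<And>\<epsilon>. 0 < \<epsilon> \<Longrightarrow> \<exists>t\<in>{0..T}. \<phi> t < ereal (r - s * (1 - t) + \<epsilon>)"
proof -
  define S where "S = {s. 0 \<le> s \<and> (\<forall>t\<in>{0..T}. ereal (r - s * (1 - t)) \<le> \<phi> t)}"
  define s1 where "s1 = max 0 ((r - b) / (1 - T))"
  have "r - s1 * (1 - t) \<le> b" if "t \<in> {0..T}" for t
  proof -
    have "r - b \<le> s1 * (1 - T)" using T unfolding s1_def by (simp add: max_def field_simps)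
    also have "\<dots> \<le> s1 * (1 - t)" using that by (intro mult_left_mono) (auto simp: s1_def)
    finally show ?thesis by simp
  qed
  then have "ereal (r - s1 * (1 - t)) \<le> \<phi> t" if "t \<in> {0..T}" for t
    using that less_imp_le[OF low[OF that]] by (meson ereal_less_eq(3) order_trans)
  then have "s1 \<in> S" unfolding S_def by (simp add: s1_def)
  have bdd: "bdd_below S" by (rule bdd_belowI[of _ 0]) (simp add: S_def)
  define s where "s = Inf S"
  have ge: "a \<le> s" if "\<And>s'. s' \<in> S \<Longrightarrow> a \<le> s'" for a
    unfolding s_def using \<open>s1 \<in> S\<close> that by (intro cInf_greatest) auto
  have main: "ereal (r - s * (1 - t)) \<le> \<phi> t" if t: "t \<in> {0..T}" for t
  proof (cases "\<phi> t")
    case (real v)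
    have pos: "0 < 1 - t" using t T by simp
    have "(r - v) / (1 - t) \<le> s"
    proof (rule ge)
      fix s' assume "s' \<in> S"
      then have "r - s' * (1 - t) \<le> v" using t real unfolding S_def by force
      then show "(r - v) / (1 - t) \<le> s'" using pos by (simp add: field_simps)
    qed
    then show ?thesis using pos real by (simp add: field_simps)
  qed (use low[OF t] in auto)
  obtain v where v: "\<phi> 0 = ereal v" using low[of 0] \<phi>0 T by (cases "\<phi> 0") auto
  have s: "0 < s" using main[of 0] \<phi>0 v T by simp
  have "\<exists>t\<in>{0..T}. \<phi> t < ereal (r - s * (1 - t) + \<epsilon>)" if \<epsilon>: "0 < \<epsilon>" for \<epsilon>
  proof -
    \<comment> \<open>The slope \<open>s - e\<close> must fail at some \<open>t\<close>, by
      minimality of \<open>s\<close>; \<open>e \<le> s\<close> keeps it non-negative, as membership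
      in \<open>S\<close> demands.\<close>
    define e where "e = min \<epsilon> s"
    have e: "0 < e" "e \<le> \<epsilon>" "e \<le> s" unfolding e_def using \<epsilon> s by auto
    have "s - e \<notin> S" using cInf_lower[OF _ bdd, of "s - e"] e unfolding s_def by auto
    then obtain t where t: "t \<in> {0..T}" "\<phi> t < ereal (r - (s - e) * (1 - t))"
      unfolding S_def using e by auto
    have "e * (1 - t) \<le> e" using e(1) t(1) by (simp add: mult_left_le)
    then have "ereal (r - (s - e) * (1 - t)) \<le> ereal (r - s * (1 - t) + \<epsilon>)"
      using e by (simp add: algebra_simps)
    then show ?thesis using t less_le_trans by blast
  qed
  then show thesis using that[OF s main] by blast
qed

text \<open>For \<open>p t = y + t (x - y)\<close>, one minimises
  \<open>f u + s (1 - t) + k N (u - p t)\<close> jointly in \<open>u\<close> and \<open>t \<le> T\<close>, with \<open>s\<close> the touching slope along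
  the segment and \<open>N\<close> a smooth approximation of the norm. Stationarity in \<open>u\<close> produces the
  subgradient, stationarity in \<open>t\<close> bounds it from below in the direction \<open>x - y\<close>.\<close>
theorem asplund_mean_value:
  fixes f :: "'a::banach \<Rightarrow> ereal" and x y :: 'a
  assumes asp: "asplund_space TYPE('a)" and lsc: "lsc_fun f" and ninf: "\<And>u. f u \<noteq> -\<infinity>"
    and T: "0 < T" "T < 1" and lt: "f x < f (y + T *\<^sub>R (x - y))" "f y < f (y + T *\<^sub>R (x - y))"
    and \<rho>: "0 < \<rho>"
  obtains c t fc fx and l :: "'a \<Rightarrow>\<^sub>L real" where "l \<in> frechet_subdiff f c" "t \<in> {0..T}"
    "norm (c - (y + t *\<^sub>R (x - y))) < \<rho>" "f c = ereal fc" "f x = ereal fx"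
    "0 < blinfun_apply l (x - c)" "fx - fc < blinfun_apply l (x - c)"
proof -
  define p where "p t = y + t *\<^sub>R (x - y)" for t
  obtain fx where fx: "f x = ereal fx" using lt(1) ninf[of x] by (cases "f x") auto
  \<comment> \<open>\<open>r\<close> replaces \<open>f x\<close> as apex value, and the slack
    \<open>r - fx\<close> absorbs the later errors. The second level \<open>r'\<close> will exclude
    \<open>t = T\<close>.\<close>
  obtain r where r: "max (f x) (f y) < ereal r" "ereal r < f (p T)"
    using ereal_dense2[of "max (f x) (f y)" "f (p T)"] lt unfolding p_def by auto
  obtain r' where r': "ereal r < ereal r'" "ereal r' < f (p T)" using ereal_dense2[OF r(2)] by blast
  have contp: "continuous_on A p" for A unfolding p_def by (intro continuous_intros)
  obtain b0 where b0: "\<And>u. u \<in> p ` {0..T} \<Longrightarrow> ereal b0 < f u"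
    using lsc_bounded_below_on_compact[OF lsc compact_continuous_image[OF contp compact_Icc] ninf] by blast
  have "f (p 0) < ereal r" using r(1) unfolding p_def by simp
  then obtain s where s: "0 < s" "\<And>t. t \<in> {0..T} \<Longrightarrow> ereal (r - s * (1 - t)) \<le> f (p t)"
    "\<And>\<epsilon>. 0 < \<epsilon> \<Longrightarrow> \<exists>t\<in>{0..T}. f (p t) < ereal (r - s * (1 - t) + \<epsilon>)"
    using touching_slope[OF T, of b0 "\<lambda>t. f (p t)" r] b0 by (metis imageI)
  \<comment> \<open>One budget per conclusion, in the order of the terms:
    \<open>fx - fc < l (x - c)\<close>, positivity of \<open>l (x - c)\<close>, and
    \<open>t < T\<close>.\<close>
  define \<epsilon> where "\<epsilon> = min ((r - fx) / 3) (min (s * (1 - T) / 3) ((r' - r) / 3))"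
  have \<epsilon>: "0 < \<epsilon>" "3 * \<epsilon> \<le> r - fx" "3 * \<epsilon> \<le> s * (1 - T)" "3 * \<epsilon> \<le> r' - r"
  proof -
    have "fx < r" using r(1) fx by simp
    then show "0 < \<epsilon>" unfolding \<epsilon>_def using s(1) T r'(1) by simp
    show "3 * \<epsilon> \<le> r - fx" "3 * \<epsilon> \<le> s * (1 - T)" "3 * \<epsilon> \<le> r' - r" unfolding \<epsilon>_def by (auto simp: min_def)
  qed
  obtain \<rho>1 where \<rho>1: "0 < \<rho>1"
    "\<And>u t. t \<in> {0..T} \<Longrightarrow> norm (u - p t) < \<rho>1 \<Longrightarrow> ereal (r - \<epsilon> - s * (1 - t)) < f u"
  proof -
    \<comment> \<open>The graph of \<open>p\<close> is thickened rather than its range, because the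
      lower bound depends on \<open>t\<close>.\<close>
    let ?C = "(\<lambda>t. (p t, t)) ` {0..T}" and ?B = "{(u, t). ereal (r - \<epsilon> - s * (1 - t)) < f u}"
    have "compact ?C" by (intro compact_continuous_image continuous_on_Pair contp continuous_on_id compact_Icc)
    moreover have "open ?B" by (rule open_lsc_above_continuous[OF lsc]) (intro continuous_intros)
    moreover have "?C \<subseteq> ?B"
    proof
      fix z assume "z \<in> ?C"
      then obtain t where t: "t \<in> {0..T}" "z = (p t, t)" by auto
      have "ereal (r - \<epsilon> - s * (1 - t)) < ereal (r - s * (1 - t))" using \<epsilon>(1) by simp
      then have "ereal (r - \<epsilon> - s * (1 - t)) < f (p t)" using s(2)[OF t(1)] by (rule less_le_trans)
      then show "z \<in> ?B" using t(2) by simp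
    qed
    ultimately obtain e where e: "0 < e" "(\<Union>z\<in>?C. ball z e) \<subseteq> ?B"
      using compact_subset_open_imp_ball_epsilon_subset by blast
    show thesis
    proof (rule that[OF e(1)])
      fix u t assume t: "t \<in> {0..T}" and u: "norm (u - p t) < e"
      have "(u, t) \<in> ball (p t, t) e" using u by (simp add: dist_Pair_Pair dist_norm norm_minus_commute)
      then have "(u, t) \<in> ?B" using e(2) t by blast
      then show "ereal (r - \<epsilon> - s * (1 - t)) < f u" by simp
    qed
  qed
  obtain \<rho>2 where \<rho>2: "0 < \<rho>2" "\<And>u. norm (u - p T) < \<rho>2 \<Longrightarrow> ereal r' < f u"
  proof -
    have "open {u. ereal r' < f u}" using lsc by (simp add: lsc_fun_iff_open)
    then obtain e where "0 < e" "ball (p T) e \<subseteq> {u. ereal r' < f u}"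
      using r'(2) open_contains_ball by (metis (mono_tags, lifting) mem_Collect_eq)
    then show thesis using that[of e] by (auto simp: subset_iff dist_norm norm_minus_commute)
  qed
  define \<rho>0 where "\<rho>0 = min \<rho> (min \<rho>1 \<rho>2)"
  have \<rho>0: "0 < \<rho>0" "\<rho>0 \<le> \<rho>" "\<rho>0 \<le> \<rho>1" "\<rho>0 \<le> \<rho>2" unfolding \<rho>0_def using \<rho> \<rho>1(1) \<rho>2(1) by auto
  define b where "b = r - \<epsilon> - s - 1"
  have fb: "ereal b < f u" if t: "t \<in> {0..T}" and u: "norm (u - p t) < \<rho>0" for u t
  proof -
    have "s * (1 - t) \<le> s" using s(1) t by (simp add: mult_left_le)
    then have "ereal b < ereal (r - \<epsilon> - s * (1 - t))" unfolding b_def by simp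
    also have "\<dots> < f u" using \<rho>1(2)[OF t, of u] u \<rho>0(3) by simp
    finally show ?thesis .
  qed
  \<comment> \<open>The penalty is so strong that a value of at most
    \<open>r + 2 * \<epsilon>\<close> forces the gauge of \<open>c - p t\<close> below
    \<open>\<rho>0 / 2\<close>. Since \<eta> is at most \<open>\<rho>0 / 4\<close>, the norm is then
    below \<open>\<rho>0\<close>; \<open>k * \<eta> \<le> \<epsilon>\<close> limits the effect of
    negative gauge values.\<close>
  define k where "k = 2 * (r + 2 * \<epsilon> - b) / \<rho>0"
  have k: "0 < k" unfolding k_def b_def using \<epsilon>(1) s(1) \<rho>0(1) by simp
  define \<eta> where "\<eta> = min (\<rho>0 / 4) (\<epsilon> / k)"
  have \<eta>: "0 < \<eta>" "\<eta> \<le> \<rho>0 / 4" "k * \<eta> \<le> \<epsilon>"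
    unfolding \<eta>_def using \<rho>0(1) \<epsilon>(1) k by (auto simp: min_def field_simps)

  obtain Y where Y: "subspace Y" "closed Y" "separable_set Y" "{x, y} \<subseteq> Y"
    and ext: "\<forall>c\<in>Y. \<forall>g\<in>frechet_subdiff_on Y f c. \<exists>l\<in>frechet_subdiff f c. \<forall>w\<in>Y. blinfun_apply l w = g w"
    by (rule separable_reduction[where f = f and S = "{x, y}", OF ninf]) simp
  have sep: "separable_dual Y" using asp Y(1-3) unfolding asplund_space_def by blast
  obtain N where N: "smooth_gauge Y \<eta> N" using smooth_gauge_exists[OF Y(1) sep \<eta>(1)] by blast
  have xy: "x \<in> Y" "y \<in> Y" "x - y \<in> Y" using Y(1,4) subspace_diff by auto
  have pY: "p t \<in> Y" for t
    unfolding p_def using xy Y(1) by (intro subspace_add subspace_scale)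
  have upY: "u - p t \<in> Y" if "u \<in> Y" for u t using subspace_diff[OF Y(1) that pY] .
  define H where "H u t = s * (1 - t) + k * N (u - p t)" for u t
  have "\<exists>t\<in>{0..T}. \<forall>t'\<in>{0..T}. H u t \<le> H u t'" if u: "u \<in> Y" for u
  proof (rule continuous_attains_inf)
    have "(norm (x - y))-lipschitz_on {0..T} (\<lambda>t. N (u - p t))"
    proof (rule lipschitz_onI)
      fix t t' assume "t \<in> {0..T}" "t' \<in> {0..T}"
      have "\<bar>N (u - p t) - N (u - p t')\<bar> \<le> norm ((u - p t) - (u - p t'))"
        by (rule smooth_gauge_lipschitz[OF N Y(1) upY[OF u] upY[OF u]])
      also have "(u - p t) - (u - p t') = (t' - t) *\<^sub>R (x - y)" unfolding p_def by (simp add: algebra_simps)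
      finally show "dist (N (u - p t)) (N (u - p t')) \<le> norm (x - y) * dist t t'"
        by (simp add: dist_norm mult.commute abs_minus_commute)
    qed simp
    then show "continuous_on {0..T} (H u)"
      unfolding H_def by (intro continuous_intros lipschitz_on_continuous_on)
  qed (use T in auto)
  then obtain \<tau> where \<tau>: "\<And>u. u \<in> Y \<Longrightarrow> \<tau> u \<in> {0..T}"
    "\<And>u t'. u \<in> Y \<Longrightarrow> t' \<in> {0..T} \<Longrightarrow> H u (\<tau> u) \<le> H u t'" by metis
  \<comment> \<open>The parameter \<open>t\<close> is minimised out exactly over a compact interval.
    The variational principle then perturbs only \<open>u\<close>, and \<open>\<tau> c\<close>
    remains an exact minimiser.\<close>
  define G where "G u = H u (\<tau> u)" for u
  have Glip: "G u \<le> G v + k * norm (u - v)" if u: "u \<in> Y" and v: "v \<in> Y" for u v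
  proof -
    have "N (u - p (\<tau> v)) \<le> N (v - p (\<tau> v)) + norm (u - v)"
      using smooth_gauge_lipschitz[OF N Y(1) upY[OF u, of "\<tau> v"] upY[OF v, of "\<tau> v"]] by simp
    then have "k * N (u - p (\<tau> v)) \<le> k * (N (v - p (\<tau> v)) + norm (u - v))" using k by (intro mult_left_mono) auto
    then show ?thesis using \<tau>(2)[OF u \<tau>(1)[OF v]] unfolding G_def H_def by (simp add: algebra_simps)
  qed
  have Nlow: "- \<eta> \<le> N v" if "v \<in> Y" for v
    using smooth_gaugeD(1)[OF N that] norm_ge_zero[of v] by linarith
  have N0: "N 0 \<le> 0" using smooth_gaugeD(2)[OF N subspace_0[OF Y(1)]] by simp
  have Glow: "- (k * \<eta>) \<le> G u" if u: "u \<in> Y" for u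
  proof -
    have "k * (- \<eta>) \<le> k * N (u - p (\<tau> u))" using Nlow[OF upY[OF u]] k by (intro mult_left_mono) auto
    moreover have "0 \<le> s * (1 - \<tau> u)" using s(1) \<tau>(1)[OF u] T by (intro mult_nonneg_nonneg) auto
    ultimately show ?thesis unfolding G_def H_def by simp
  qed
  \<comment> \<open>Off the tube \<open>f\<close> may be unbounded below, hence the truncation at
    \<open>b\<close>. The minimiser will fall inside the tube, where \<open>b < f\<close> and the
    truncation is invisible.\<close>
  define F where "F u = max (f u) (ereal b) + ereal (G u)" for u
  have Flsc: "F c \<le> ereal a" if ran: "range u \<subseteq> Y" and lim: "u \<longlonglongrightarrow> c"
    and le: "\<forall>\<^sub>F n in sequentially. F (u n) \<le> ereal a" for u c a
  proof (rule ccontr)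
    assume "\<not> F c \<le> ereal a"
    then have "ereal (a - G c) < max (f c) (ereal b)" unfolding F_def by (cases "max (f c) (ereal b)") auto
    then obtain q where q: "ereal (a - G c) < ereal q" "ereal q < max (f c) (ereal b)" using ereal_dense2 by blast
    have uY: "u n \<in> Y" for n using ran by auto
    have cY: "c \<in> Y" using closed_sequentially[OF Y(2) uY lim] .
    have "open {v. ereal q < max (f v) (ereal b)}"
      using lsc by (cases "q < b") (auto simp: lsc_fun_iff_open less_max_iff_disj)
    then have 1: "\<forall>\<^sub>F n in sequentially. ereal q < max (f (u n)) (ereal b)"
      using topological_tendstoD[OF lim] q(2) by fastforce
    have "(\<lambda>n. G c - k * norm (c - u n)) \<longlonglongrightarrow> G c - k * norm (c - c)" by (intro tendsto_intros lim)
    then have 2: "\<forall>\<^sub>F n in sequentially. a - q < G c - k * norm (c - u n)"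
      using q(1) by (intro order_tendstoD(1)) auto
    have "\<forall>\<^sub>F n in sequentially. False"
      using 1 2 le
    proof eventually_elim
      case (elim n)
      have "a - q < G (u n)" using elim(2) Glip[OF cY uY[of n]] by simp
      then have "ereal a < ereal q + ereal (G (u n))" by simp
      also have "\<dots> \<le> F (u n)" unfolding F_def using elim(1) by (intro add_right_mono) auto
      finally show ?case using elim(3) by simp
    qed
    then show False by simp
  qed
  have Flow: "ereal (b + - (k * \<eta>)) \<le> F u" if "u \<in> Y" for u
    unfolding F_def plus_ereal.simps(1)[symmetric] using Glow[OF that] by (intro add_mono) auto
  \<comment> \<open>\<open>R\<close> bounds \<open>norm (x - c)\<close>, so the derivative of the
    perturbation will cost at most \<epsilon> in that direction.\<close>
  define R where "R = norm (x - y) + \<rho>0"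
  have R: "0 < R" unfolding R_def using \<rho>0(1) by (simp add: add_nonneg_pos)
  define \<beta> where "\<beta> = \<epsilon> / R"
  have \<beta>: "0 < \<beta>" "\<beta> * R = \<epsilon>" unfolding \<beta>_def using \<epsilon>(1) R by auto
  have Fy: "F y < \<infinity>" unfolding F_def using r(1) by (cases "f y") (auto simp: max_def)
  obtain c \<theta> \<zeta> where cY: "c \<in> Y"
    and min: "\<forall>w\<in>Y. F c + ereal (\<theta> c) \<le> F w + ereal (\<theta> w)"
    and near: "\<forall>w\<in>Y. F c \<le> F w + ereal \<epsilon>"
    and \<zeta>: "\<zeta> \<in> dual_on Y" "\<forall>v. \<bar>\<zeta> v\<bar> \<le> \<beta> * norm v"
    and \<theta>: "\<forall>\<epsilon>>0. \<exists>\<delta>>0. \<forall>h\<in>Y. norm h < \<delta> \<longrightarrow> \<theta> (c + h) \<le> \<theta> c + \<zeta> h + \<epsilon> * norm h"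
    by (rule smooth_variational_principle[where F = F and Y = Y, OF Y(1,2) sep Flsc Flow xy(2) Fy \<epsilon>(1) \<beta>(1)])
  \<comment> \<open>Where the cone nearly touches \<open>f\<close>, the term
    \<open>s * (1 - t)\<close> in \<open>G\<close> cancels its slope and \<open>F\<close> is at most
    \<open>r + \<epsilon>\<close>.\<close>
  obtain t0 where t0: "t0 \<in> {0..T}" "f (p t0) < ereal (r - s * (1 - t0) + \<epsilon>)" using s(3)[OF \<epsilon>(1)] by blast
  have "F (p t0) \<le> ereal (r + \<epsilon>)"
  proof -
    have "ereal b < f (p t0)" using fb[OF t0(1), of "p t0"] \<rho>0(1) by simp
    then have "max (f (p t0)) (ereal b) \<le> ereal (r - s * (1 - t0) + \<epsilon>)" using t0(2) by (simp add: less_imp_le)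
    moreover have "G (p t0) \<le> s * (1 - t0)"
      using \<tau>(2)[OF pY t0(1), of t0] N0 k mult_nonneg_nonpos[of k "N 0"] unfolding G_def H_def by simp
    ultimately have "F (p t0) \<le> ereal (r - s * (1 - t0) + \<epsilon>) + ereal (s * (1 - t0))"
      unfolding F_def by (intro add_mono) auto
    then show ?thesis by simp
  qed
  then have "F (p t0) + ereal \<epsilon> \<le> ereal (r + \<epsilon>) + ereal \<epsilon>" by (rule add_right_mono)
  from order_trans[OF bspec[OF near pY[of t0]] this] have Fc: "F c \<le> ereal (r + 2 * \<epsilon>)"
    by (simp add: algebra_simps)
  define t where "t = \<tau> c"
  have t: "t \<in> {0..T}" unfolding t_def by (rule \<tau>(1)[OF cY])
  have Gc: "G c = s * (1 - t) + k * N (c - p t)" unfolding G_def H_def t_def ..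
  have cp: "norm (c - p t) < \<rho>0"
  proof -
    have "ereal b + ereal (G c) \<le> F c" unfolding F_def by (intro add_right_mono) auto
    then have "b + G c \<le> r + 2 * \<epsilon>" using Fc by (metis ereal_less_eq(3) order_trans plus_ereal.simps(1))
    moreover have "0 \<le> s * (1 - t)" using s(1) t T by (intro mult_nonneg_nonneg) auto
    ultimately have "k * N (c - p t) \<le> r + 2 * \<epsilon> - b" unfolding Gc by simp
    also have "\<dots> = k * (\<rho>0 / 2)" unfolding k_def using \<rho>0(1) by simp
    finally have "N (c - p t) \<le> \<rho>0 / 2" using k by simp
    then show ?thesis using smooth_gaugeD(1)[OF N upY[OF cY, of t]] \<eta>(2) \<rho>0(1) by linarith
  qed
  have maxc: "max (f c) (ereal b) = f c" using fb[OF t cp] by (simp add: less_imp_le max.absorb1)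
  obtain fc where fc: "f c = ereal fc"
    using Fc ninf[of c] unfolding F_def maxc by (cases "f c") simp_all
  have Fceq: "F c = ereal (fc + G c)" unfolding F_def maxc by (simp add: fc)
  have fc_low: "r - \<epsilon> - s * (1 - t) < fc" using \<rho>1(2)[OF t, of c] cp \<rho>0(3) fc by simp
  have kNc: "- \<epsilon> \<le> k * N (c - p t)"
    using mult_left_mono[OF Nlow[OF upY[OF cY, of t]], of k] k \<eta>(3) by simp
  \<comment> \<open>The one-sided estimate in \<open>t\<close> needs room to increase
    \<open>t\<close>. At \<open>t = T\<close> the value \<open>r'\<close> would be too
    large.\<close>
  have tT: "t < T"
  proof (rule ccontr)
    assume "\<not> t < T"
    then have "t = T" using t by simp
    then have "r' < fc" using \<rho>2(2)[of c] cp \<rho>0(4) fc by simp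
    moreover have "fc + G c \<le> r + 2 * \<epsilon>" using Fc unfolding Fceq by simp
    moreover have "0 < s * (1 - t)" using s(1) t T by (intro mult_pos_pos) auto
    ultimately show False using \<epsilon>(4) kNc unfolding Gc by linarith
  qed
  obtain \<nu> where \<nu>: "\<nu> \<in> dual_ball Y" "\<And>h. h \<in> Y \<Longrightarrow> N (c - p t) + \<nu> h \<le> N (c - p t + h)"
    "\<And>e. 0 < e \<Longrightarrow> \<exists>\<delta>>0. \<forall>h\<in>Y. norm h < \<delta> \<longrightarrow> N (c - p t + h) \<le> N (c - p t) + \<nu> h + e * norm h"
    using smooth_gaugeD(3)[OF N upY[OF cY, of t]] by blast
  define g where "g v = - (k * \<nu> v + \<zeta> v)" for v
  have g: "g \<in> dual_on Y"
  proof -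
    have "\<bar>g v\<bar> \<le> (k + \<beta>) * norm v" for v
    proof -
      have "\<bar>g v\<bar> \<le> k * \<bar>\<nu> v\<bar> + \<bar>\<zeta> v\<bar>" unfolding g_def using k abs_triangle_ineq[of "k * \<nu> v" "\<zeta> v"] by (simp add: abs_mult)
      also have "\<dots> \<le> k * norm v + \<beta> * norm v"
        using dual_ballD(1)[OF \<nu>(1), of v] spec[OF \<zeta>(2), of v] k by (intro add_mono mult_left_mono) auto
      finally show ?thesis by (simp add: distrib_right)
    qed
    then have "\<exists>K. \<forall>v\<in>Y. \<bar>g v\<bar> \<le> K * norm v" by blast
    moreover have "g (v + w) = g v + g w" "g (a *\<^sub>R v) = a * g v" if "v \<in> Y" "w \<in> Y" for v w a
      using \<zeta>(1) dual_ballD(2,3)[OF \<nu>(1)] that unfolding dual_on_def g_def by (simp_all add: algebra_simps)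
    ultimately show ?thesis unfolding dual_on_def by blast
  qed
  have "\<exists>\<delta>>0. \<forall>u\<in>Y. norm (u - c) < \<delta> \<longrightarrow> ereal (fc + g (u - c) - e * norm (u - c)) \<le> f u" if e: "0 < e" for e
  proof -
    obtain \<delta>1 where \<delta>1: "0 < \<delta>1" "\<And>h. h \<in> Y \<Longrightarrow> norm h < \<delta>1 \<Longrightarrow> N (c - p t + h) \<le> N (c - p t) + \<nu> h + e / (2 * k) * norm h"
      using \<nu>(3)[of "e / (2 * k)"] e k by auto
    obtain \<delta>2 where \<delta>2: "0 < \<delta>2" "\<And>h. h \<in> Y \<Longrightarrow> norm h < \<delta>2 \<Longrightarrow> \<theta> (c + h) \<le> \<theta> c + \<zeta> h + e / 2 * norm h"
      using \<theta>[rule_format, of "e / 2"] e by auto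
    define \<delta> where "\<delta> = min (min \<delta>1 \<delta>2) (\<rho>0 - norm (c - p t))"
    have "ereal (fc + g (u - c) - e * norm (u - c)) \<le> f u" if u: "u \<in> Y" "norm (u - c) < \<delta>" for u
    proof (cases "f u")
      case (real v)
      let ?h = "u - c"
      have hY: "?h \<in> Y" using subspace_diff[OF Y(1) u(1) cY] .
      have "norm (u - p t) < \<rho>0" using norm_triangle_ineq[of "u - c" "c - p t"] u(2) unfolding \<delta>_def by simp
      then have maxu: "max (f u) (ereal b) = f u" using fb[OF t] by (simp add: less_imp_le max.absorb1)
      have Fu: "F u = ereal (v + G u)" unfolding F_def maxu by (simp add: real)
      have "fc + G c + \<theta> c \<le> v + G u + \<theta> u"
        using bspec[OF min u(1)] unfolding Fceq Fu by simp
      \<comment> \<open>Freezing \<open>t\<close> bounds \<open>G\<close> above by a function that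
        agrees with it at \<open>c\<close> and is differentiable there along
        \<open>Y\<close>.\<close>
      moreover have "G u \<le> G c + k * \<nu> ?h + e / 2 * norm ?h"
      proof -
        have "N (c - p t + ?h) \<le> N (c - p t) + \<nu> ?h + e / (2 * k) * norm ?h"
          using u(2) by (intro \<delta>1(2)[OF hY]) (simp add: \<delta>_def)
        then have "k * N (c - p t + ?h) \<le> k * (N (c - p t) + \<nu> ?h + e / (2 * k) * norm ?h)"
          using k by (intro mult_left_mono) auto
        also have "\<dots> = k * N (c - p t) + k * \<nu> ?h + e / 2 * norm ?h" using k by (simp add: algebra_simps)
        finally show ?thesis using \<tau>(2)[OF u(1) t] unfolding G_def[of u] H_def Gc by (simp add: algebra_simps)
      qed
      moreover have "\<theta> u \<le> \<theta> c + \<zeta> ?h + e / 2 * norm ?h"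
        using \<delta>2(2)[OF hY] u(2) by (simp add: \<delta>_def)
      ultimately show ?thesis using real unfolding g_def by simp
    qed (use ninf in auto)
    moreover have "0 < \<delta>" unfolding \<delta>_def using \<delta>1(1) \<delta>2(1) cp by simp
    ultimately show ?thesis by blast
  qed
  then have "g \<in> frechet_subdiff_on Y f c" unfolding frechet_subdiff_on_def using g fc by blast
  then obtain l where l: "l \<in> frechet_subdiff f c" "\<And>w. w \<in> Y \<Longrightarrow> blinfun_apply l w = g w"
    using ext cY by blast
  \<comment> \<open>Raising \<open>t\<close> by \<open>j\<close> at fixed \<open>c\<close> lowers
    \<open>s * (1 - t)\<close> by \<open>s * j\<close>. By minimality of \<open>t\<close> the gauge
    term gains at least as much, and dividing by \<open>j\<close> compares \<open>s\<close> with its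
    derivative.\<close>
  have slope: "s \<le> - (k * \<nu> (x - y))"
  proof (rule field_le_epsilon)
    fix e :: real assume e: "0 < e"
    define n where "n = norm (x - y) + 1"
    have n: "0 < n" "norm (x - y) \<le> n" unfolding n_def by (auto simp: add_nonneg_pos)
    define e' where "e' = e / (k * n)"
    have e': "0 < e'" unfolding e'_def using e k n(1) by simp
    have e'e: "k * (e' * norm (x - y)) \<le> e"
    proof -
      have "k * (e' * norm (x - y)) \<le> k * (e' * n)" using e' k n(2) by (intro mult_left_mono) auto
      also have "\<dots> = e" unfolding e'_def using k n(1) by simp
      finally show ?thesis .
    qed
    obtain \<delta> where \<delta>: "0 < \<delta>" "\<And>h. h \<in> Y \<Longrightarrow> norm h < \<delta> \<Longrightarrow> N (c - p t + h) \<le> N (c - p t) + \<nu> h + e' * norm h"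
      using \<nu>(3)[OF e'] by auto
    define j where "j = min (T - t) (\<delta> / n / 2)"
    have j: "0 < j" "j \<le> \<delta> / n / 2" "t + j \<in> {0..T}"
      unfolding j_def using tT t \<delta>(1) n(1) by (auto simp: min_def)
    have nj: "norm ((- j) *\<^sub>R (x - y)) = j * norm (x - y)" using j(1) by simp
    have "j * norm (x - y) \<le> (\<delta> / n / 2) * n" using j(1,2) n by (intro mult_mono) auto
    then have jn: "norm ((- j) *\<^sub>R (x - y)) < \<delta>" unfolding nj using n(1) \<delta>(1) by simp
    have hY: "(- j) *\<^sub>R (x - y) \<in> Y" using subspace_scale[OF Y(1) xy(3)] .
    have eq: "c - p (t + j) = c - p t + (- j) *\<^sub>R (x - y)" unfolding p_def by (simp add: algebra_simps)
    have "N (c - p (t + j)) \<le> N (c - p t) + (- j) * \<nu> (x - y) + e' * (j * norm (x - y))"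
      using \<delta>(2)[OF hY jn] unfolding eq[symmetric] dual_ballD(3)[OF \<nu>(1) xy(3)] nj .
    then have "k * N (c - p (t + j)) \<le> k * (N (c - p t) + (- j) * \<nu> (x - y) + e' * (j * norm (x - y)))"
      using k by (intro mult_left_mono) auto
    moreover have "H c t \<le> H c (t + j)" using \<tau>(2)[OF cY j(3)] unfolding t_def .
    ultimately have "j * s \<le> j * (- (k * \<nu> (x - y)) + k * (e' * norm (x - y)))"
      unfolding H_def by (simp add: algebra_simps)
    then have "s \<le> - (k * \<nu> (x - y)) + k * (e' * norm (x - y))" using j(1) by simp
    then show "s \<le> - (k * \<nu> (x - y)) + e" using e'e by simp
  qed
  have xcY: "x - c \<in> Y" using subspace_diff[OF Y(1) xy(1) cY] .
  have gx: "s * (1 - t) - 2 * \<epsilon> \<le> g (x - c)"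
  proof -
    have xc: "x - c = (1 - t) *\<^sub>R (x - y) - (c - p t)" unfolding p_def by (simp add: algebra_simps)
    have 0: "\<nu> (x - c) = (1 - t) * \<nu> (x - y) - \<nu> (c - p t)"
      unfolding xc using dual_ball_diff[OF \<nu>(1) Y(1) subspace_scale[OF Y(1) xy(3)] upY[OF cY]]
        dual_ballD(3)[OF \<nu>(1) xy(3)] by simp
    have 1: "- (k * \<nu> (x - c)) = (1 - t) * (- (k * \<nu> (x - y))) + k * \<nu> (c - p t)"
      unfolding 0 by (simp add: algebra_simps)
    have "\<nu> (- (c - p t)) = - \<nu> (c - p t)" using dual_ballD(3)[OF \<nu>(1) upY[OF cY, of t], of "- 1"] by simp
    \<comment> \<open>The subgradient inequality is used in the direction leading back to 0, where
      \<open>N 0 \<le> 0\<close>. The displacement \<open>c - p t\<close> off the segment thus costs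
      at most \<epsilon>.\<close>
    then have "N (c - p t) \<le> \<nu> (c - p t)"
      using \<nu>(2)[OF subspace_neg[OF Y(1) upY[OF cY, of t]]] N0 by simp
    then have 2: "- \<epsilon> \<le> k * \<nu> (c - p t)" using kNc mult_left_mono[of "N (c - p t)" "\<nu> (c - p t)" k] k by linarith
    have 3: "(1 - t) * s \<le> (1 - t) * (- (k * \<nu> (x - y)))" using slope t T by (intro mult_left_mono) auto
    have "norm (x - c) \<le> R"
    proof -
      have "norm (x - c) \<le> norm ((1 - t) *\<^sub>R (x - y)) + norm (c - p t)" unfolding xc by (rule norm_triangle_ineq4)
      also have "norm ((1 - t) *\<^sub>R (x - y)) \<le> norm (x - y)" using t T by (simp add: mult_left_le_one_le)
      finally show ?thesis unfolding R_def using cp by simp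
    qed
    then have "\<beta> * norm (x - c) \<le> \<beta> * R" using \<beta>(1) by (intro mult_left_mono) auto
    then have 4: "\<zeta> (x - c) \<le> \<epsilon>" using spec[OF \<zeta>(2), of "x - c"] \<beta>(2) by linarith
    show ?thesis unfolding g_def using 1 2 3 4 by (simp add: mult.commute)
  qed
  have "s * (1 - T) \<le> s * (1 - t)" using s(1) t by (intro mult_left_mono) auto
  then have "0 < g (x - c)" using gx \<epsilon>(1,3) by linarith
  moreover have "fx - fc < g (x - c)" using gx fc_low \<epsilon>(2) by linarith
  ultimately show thesis
    using that[OF l(1) t _ fc fx] l(2)[OF xcY] cp \<rho>0(2) unfolding p_def by simp
qed

section \<open>Robust quasiconvexity\<close>

lemma frechet_subdiff_finite:
  assumes "l \<in> frechet_subdiff f x" "f x \<noteq> -\<infinity>"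
  obtains a where "f x = ereal a"
  using assms unfolding frechet_subdiff_def by (cases "f x") auto

lemma lsc_tilt:
  assumes lsc: "lsc_fun \<phi>" and ninf: "\<And>x. \<phi> x \<noteq> -\<infinity>"
  shows "lsc_fun (tilt \<phi> v)"
  unfolding lsc_fun_iff_open
proof
  fix a :: ereal
  show "open {x. a < tilt \<phi> v x}"
  proof (cases a)
    case (real q)
    have "open {(u, t). ereal (q - blinfun_apply v t) < \<phi> u}"
      by (rule open_lsc_above_continuous[OF lsc]) (intro continuous_intros)
    then have "open ((\<lambda>u. (u, u)) -` {(u, t). ereal (q - blinfun_apply v t) < \<phi> u})"
      by (rule open_vimage) (intro continuous_intros)
    moreover have "a < tilt \<phi> v u \<longleftrightarrow> ereal (q - blinfun_apply v u) < \<phi> u" for u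
      unfolding tilt_def real by (cases "\<phi> u") auto
    ultimately show ?thesis by (simp add: vimage_def)
  next
    case MInf
    have "{x. a < tilt \<phi> v x} = UNIV" using ninf unfolding MInf tilt_def by (auto simp: less_le)
    then show ?thesis by simp
  qed simp
qed

lemma frechet_subdiff_tilt:
  assumes l: "l \<in> frechet_subdiff (tilt \<phi> v) c" and c: "\<phi> c = ereal a" and ninf: "\<And>x. \<phi> x \<noteq> -\<infinity>"
  shows "l - v \<in> frechet_subdiff \<phi> c"
proof (subst frechet_subdiff_iff[where f = \<phi> and x = c, OF c ninf], intro allI impI)
  fix \<epsilon> :: real assume "0 < \<epsilon>"
  have "tilt \<phi> v x \<noteq> -\<infinity>" for x using ninf[of x] unfolding tilt_def by simp
  moreover have "tilt \<phi> v c = ereal (a + blinfun_apply v c)" unfolding tilt_def c by simp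
  ultimately obtain \<delta> where \<delta>: "0 < \<delta>"
    "\<And>y. norm (y - c) < \<delta> \<Longrightarrow> ereal (a + blinfun_apply v c + blinfun_apply l (y - c) - \<epsilon> * norm (y - c)) \<le> tilt \<phi> v y"
    using l \<open>0 < \<epsilon>\<close> frechet_subdiff_iff[where f = "tilt \<phi> v" and x = c] by metis
  have "ereal (a + blinfun_apply (l - v) (y - c) - \<epsilon> * norm (y - c)) \<le> \<phi> y" if "norm (y - c) < \<delta>" for y
    using \<delta>(2)[OF that] ninf[of y] unfolding tilt_def
    by (cases "\<phi> y") (auto simp: blinfun.diff_left blinfun.diff_right)
  then show "\<exists>\<delta>>0. \<forall>y. norm (y - c) < \<delta> \<longrightarrow> ereal (a + blinfun_apply (l - v) (y - c) - \<epsilon> * norm (y - c)) \<le> \<phi> y"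
    using \<delta>(1) by blast
qed

section \<open>From (a) to (b)\<close>

lemma subgradient_bound_of_robustly_quasiconvex:
  fixes \<phi> :: "'a::real_normed_vector \<Rightarrow> ereal"
  assumes rq: "robustly_quasiconvex \<alpha> \<phi>" and \<alpha>: "0 < \<alpha>" and ninf: "\<And>x. \<phi> x \<noteq> -\<infinity>"
    and le: "\<phi> y \<le> \<phi> x" and l: "l \<in> frechet_subdiff \<phi> x"
  shows "ereal (blinfun_apply l (y - x)) \<le> - min (ereal (\<alpha> * norm (y - x))) (\<phi> x - \<phi> y)"
proof -
  obtain a where a: "\<phi> x = ereal a" using frechet_subdiff_finite[OF l ninf] .
  obtain b where b: "\<phi> y = ereal b" using le a ninf[of y] by (cases "\<phi> y") auto
  have ba: "b \<le> a" using le a b by simp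
  define h where "h = y - x"
  \<comment> \<open>The largest admissible value of \<open>v h\<close>:
    \<open>norm v \<le> \<alpha>\<close> asks for \<open>m \<le> \<alpha> * norm h\<close>, and the
    comparison of tilted values at \<open>y\<close> and \<open>x\<close> asks for
    \<open>m \<le> a - b\<close>.\<close>
  define m where "m = min (\<alpha> * norm h) (a - b)"
  have m: "0 \<le> m" "m \<le> \<alpha> * norm h" "m \<le> a - b" unfolding m_def using \<alpha> ba by auto
  have "blinfun_apply l h \<le> - m"
  proof (cases "h = 0")
    case True
    then have "m = 0" using m by simp
    then show ?thesis using True by (simp add: blinfun.zero_right)
  next
    case False
    obtain e :: "'a \<Rightarrow>\<^sub>L real" where e: "norm e \<le> 1" "blinfun_apply e h = norm h" using norming_functional by blast
    define v where "v = (m / norm h) *\<^sub>R e"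
    have "norm v = m / norm h * norm e" unfolding v_def using m by simp
    also have "\<dots> \<le> m / norm h * 1" using e(1) m(1) by (intro mult_left_mono) auto
    also have "\<dots> \<le> \<alpha>" using m(2) False by (simp add: field_simps)
    finally have "norm v \<le> \<alpha>" .
    then have qc: "quasiconvex (tilt \<phi> v)" using rq unfolding robustly_quasiconvex_def by blast
    have vh: "blinfun_apply v h = m" unfolding v_def using e(2) False by (simp add: blinfun.scaleR_left)
    \<comment> \<open>Quasiconvexity of the tilt makes \<phi> fall at least at rate \<open>m\<close>
      towards \<open>y\<close>; a Frechet subgradient tolerates this only if
      \<open>l h \<le> - m\<close>.\<close>
    have step: "\<phi> (x + t *\<^sub>R h) \<le> ereal (a - t * m)" if t: "0 < t" "t < 1" for t
    proof -
      have eq: "t *\<^sub>R y + (1 - t) *\<^sub>R x = x + t *\<^sub>R h" unfolding h_def by (simp add: algebra_simps)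
      have "tilt \<phi> v (t *\<^sub>R y + (1 - t) *\<^sub>R x) \<le> max (tilt \<phi> v y) (tilt \<phi> v x)"
        using qc t unfolding quasiconvex_def by blast
      also have "\<dots> \<le> tilt \<phi> v x"
        using m(3) vh unfolding tilt_def a b h_def by (simp add: blinfun.diff_right)
      finally have "\<phi> (x + t *\<^sub>R h) + ereal (blinfun_apply v x + t * m) \<le> ereal (a + blinfun_apply v x)"
        unfolding eq tilt_def a by (simp add: blinfun.add_right blinfun.scaleR_right vh)
      then show ?thesis using ninf[of "x + t *\<^sub>R h"] by (cases "\<phi> (x + t *\<^sub>R h)") auto
    qed
    show ?thesis
    proof (rule field_le_epsilon)
      fix r :: real assume r: "0 < r"
      define \<epsilon> where "\<epsilon> = r / norm h"
      have \<epsilon>: "0 < \<epsilon>" "\<epsilon> * norm h = r" unfolding \<epsilon>_def using r False by auto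
      obtain \<delta> where \<delta>: "0 < \<delta>" "\<And>y. norm (y - x) < \<delta> \<Longrightarrow> ereal (a + blinfun_apply l (y - x) - \<epsilon> * norm (y - x)) \<le> \<phi> y"
        using l \<epsilon>(1) frechet_subdiff_iff[where f = \<phi> and x = x, OF a ninf] by metis
      define t where "t = min (1/2) (\<delta> / (2 * norm h))"
      have t: "0 < t" "t < 1" "t * norm h < \<delta>"
      proof -
        show "0 < t" "t < 1" unfolding t_def using \<delta>(1) False by auto
        have "t * norm h \<le> \<delta> / (2 * norm h) * norm h" unfolding t_def by (intro mult_right_mono) auto
        then show "t * norm h < \<delta>" using False \<delta>(1) by simp
      qed
      have "ereal (a + t * blinfun_apply l h - \<epsilon> * (t * norm h)) \<le> \<phi> (x + t *\<^sub>R h)"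
        using \<delta>(2)[of "x + t *\<^sub>R h"] t by (simp add: blinfun.scaleR_right)
      also have "\<dots> \<le> ereal (a - t * m)" by (rule step[OF t(1,2)])
      finally have "t * blinfun_apply l h \<le> t * (- m + \<epsilon> * norm h)" by (simp add: algebra_simps)
      then show "blinfun_apply l h \<le> - m + r" using t(1) \<epsilon>(2) by simp
    qed
  qed
  moreover have "- min (ereal (\<alpha> * norm (y - x))) (\<phi> x - \<phi> y) = ereal (- m)"
    unfolding a b m_def h_def by (simp add: min_def)
  ultimately show ?thesis unfolding h_def by simp
qed

section \<open>From (b) to (a)\<close>

lemma convex_combination_via_point:
  fixes x y :: "'a::real_vector" and s T :: real
  assumes "s \<le> T" "T < 1"
  defines "\<sigma> \<equiv> (T - s) / (1 - s)"
  shows "0 \<le> \<sigma> \<and> \<sigma> < 1 \<and> (\<sigma> = 0 \<longleftrightarrow> s = T) \<and>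
    y + T *\<^sub>R (x - y) = y + s *\<^sub>R (x - y) + \<sigma> *\<^sub>R (x - (y + s *\<^sub>R (x - y)))"
proof -
  have pos: "0 < 1 - s" using assms by simp
  have "0 \<le> \<sigma>" "\<sigma> < 1" "\<sigma> = 0 \<longleftrightarrow> s = T" unfolding \<sigma>_def using pos assms(1,2) by (auto simp: field_simps)
  moreover have "y + T *\<^sub>R (x - y) = y + s *\<^sub>R (x - y) + \<sigma> *\<^sub>R (x - (y + s *\<^sub>R (x - y)))"
  proof -
    have "x - (y + s *\<^sub>R (x - y)) = (1 - s) *\<^sub>R (x - y)" by (simp add: algebra_simps)
    then have "\<sigma> *\<^sub>R (x - (y + s *\<^sub>R (x - y))) = (\<sigma> * (1 - s)) *\<^sub>R (x - y)" by simp
    also have "\<sigma> * (1 - s) = T - s" unfolding \<sigma>_def using pos by simp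
    finally show ?thesis by (simp add: algebra_simps)
  qed
  ultimately show ?thesis by blast
qed

text \<open>Near one end of a segment violating quasiconvexity there is a point \<open>a\<close> with a subgradient \<open>l\<close>
  pointing to the other end; by assumption \<open>\<phi> > \<phi> a\<close> wherever \<open>l\<close> is positive, and a second
  subgradient, found at such a point and pointing back to \<open>a\<close>, contradicts the assumption.\<close>
lemma quasiconvex_of_subgradients:
  fixes \<phi> :: "'a::banach \<Rightarrow> ereal"
  assumes asp: "asplund_space TYPE('a)" and lsc: "lsc_fun \<phi>" and ninf: "\<And>x. \<phi> x \<noteq> -\<infinity>"
    and sub: "\<And>x y l. l \<in> frechet_subdiff \<phi> x \<Longrightarrow> \<phi> y \<le> \<phi> x \<Longrightarrow> blinfun_apply l (y - x) \<le> 0"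
  shows "quasiconvex \<phi>"
  unfolding quasiconvex_def
proof (intro allI impI, elim conjE, rule ccontr)
  fix x y :: 'a and t :: real assume t: "0 < t" "t < 1"
  define z where "z = t *\<^sub>R x + (1 - t) *\<^sub>R y"
  assume "\<not> \<phi> (t *\<^sub>R x + (1 - t) *\<^sub>R y) \<le> max (\<phi> x) (\<phi> y)"
  then have z: "max (\<phi> x) (\<phi> y) < \<phi> z" unfolding z_def by (rule not_le_imp_less)
  have zeq: "x + (1 - t) *\<^sub>R (y - x) = z" unfolding z_def by (simp add: algebra_simps)
  have "open {u. max (\<phi> x) (\<phi> y) < \<phi> u}" using lsc by (simp only: lsc_fun_iff_open)
  then obtain \<rho> where \<rho>: "0 < \<rho>" "ball z \<rho> \<subseteq> {u. max (\<phi> x) (\<phi> y) < \<phi> u}"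
    using z open_contains_ball by (metis (mono_tags, lifting) mem_Collect_eq)
  obtain a s fa fy and l :: "'a \<Rightarrow>\<^sub>L real" where l: "l \<in> frechet_subdiff \<phi> a" "s \<in> {0..1 - t}"
    "norm (a - (x + s *\<^sub>R (y - x))) < \<rho>" "\<phi> a = ereal fa" "\<phi> y = ereal fy" "0 < blinfun_apply l (y - a)"
    by (rule asplund_mean_value[where f = \<phi> and T = "1 - t" and x = y and y = x and \<rho> = \<rho>, OF asp lsc ninf]) (use t z zeq \<rho>(1) in auto)
  define \<sigma> where "\<sigma> = (1 - t - s) / (1 - s)"
  have st: "s \<le> 1 - t" "1 - t < 1" using l(2) t by auto
  have \<sigma>: "0 \<le> \<sigma>" "\<sigma> < 1" "\<sigma> = 0 \<longleftrightarrow> s = 1 - t"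
    "z = x + s *\<^sub>R (y - x) + \<sigma> *\<^sub>R (y - (x + s *\<^sub>R (y - x)))"
    using convex_combination_via_point[OF st, where x = y and y = x] unfolding \<sigma>_def zeq by auto
  \<comment> \<open>The counterpart of \<open>z\<close> on the segment from \<open>a\<close> to
    \<open>y\<close>. It is no farther from \<open>z\<close> than \<open>a\<close> is from the
    original segment, so its value still exceeds \<open>\<phi> y\<close>.\<close>
  define z' where "z' = a + \<sigma> *\<^sub>R (y - a)"
  have "z' - z = (1 - \<sigma>) *\<^sub>R (a - (x + s *\<^sub>R (y - x)))"
    unfolding z'_def \<sigma>(4) by (simp add: algebra_simps)
  then have "norm (z' - z) = (1 - \<sigma>) * norm (a - (x + s *\<^sub>R (y - x)))" using \<sigma>(2) by simp
  also have "\<dots> \<le> norm (a - (x + s *\<^sub>R (y - x)))" using \<sigma>(1,2) by (simp add: mult_left_le_one_le)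
  finally have "z' \<in> ball z \<rho>" using l(3) by (simp add: dist_norm norm_minus_commute)
  then have z': "\<phi> y < \<phi> z'" using \<rho>(2) by auto
  have ay: "\<phi> a < \<phi> y" using sub[OF l(1), of y] l(6) by force
  then have "\<sigma> \<noteq> 0" using z' unfolding z'_def by auto
  then have \<sigma>0: "0 < \<sigma>" using \<sigma>(1) by simp
  have z'eq: "y + (1 - \<sigma>) *\<^sub>R (a - y) = z'" unfolding z'_def by (simp add: algebra_simps)
  \<comment> \<open>On the segment from \<open>y\<close> to \<open>z'\<close>, \<open>l\<close>
    exceeds its value at \<open>a\<close> by at least \<open>d\<close>. The radius
    \<open>\<rho>'\<close> is chosen so that this excess stays positive at points within
    \<open>\<rho>'\<close> of that segment.\<close>
  define d where "d = \<sigma> * blinfun_apply l (y - a)"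
  have d: "0 < d" unfolding d_def using \<sigma>0 l(6) by simp
  define \<rho>' where "\<rho>' = d / (norm l + 1)"
  have l1: "0 < norm l + 1" by (simp add: add_nonneg_pos)
  have \<rho>': "0 < \<rho>'" unfolding \<rho>'_def using d l1 by simp
  obtain c s' fc fa' and l' :: "'a \<Rightarrow>\<^sub>L real" where l': "l' \<in> frechet_subdiff \<phi> c" "s' \<in> {0..1 - \<sigma>}"
    "norm (c - (y + s' *\<^sub>R (a - y))) < \<rho>'" "\<phi> c = ereal fc" "\<phi> a = ereal fa'" "0 < blinfun_apply l' (a - c)"
    by (rule asplund_mean_value[where f = \<phi> and T = "1 - \<sigma>" and x = a and y = y and \<rho> = \<rho>', OF asp lsc ninf])
      (use \<sigma>0 \<sigma>(2) z' ay less_trans[OF ay z'] z'eq \<rho>' in auto)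
  have "0 < blinfun_apply l (c - a)"
  proof -
    let ?w = "c - (y + s' *\<^sub>R (a - y))"
    have "c - a = (1 - s') *\<^sub>R (y - a) + ?w" by (simp add: algebra_simps)
    then have "blinfun_apply l (c - a) = (1 - s') * blinfun_apply l (y - a) + blinfun_apply l ?w"
      by (metis blinfun.add_right blinfun.scaleR_right real_scaleR_def)
    moreover have "d \<le> (1 - s') * blinfun_apply l (y - a)"
      unfolding d_def using l'(2) l(6) by (intro mult_right_mono) auto
    moreover have "\<bar>blinfun_apply l ?w\<bar> < d"
    proof -
      have "\<bar>blinfun_apply l ?w\<bar> \<le> norm l * norm ?w" using norm_blinfun[of l ?w] by simp
      also have "\<dots> \<le> norm l * \<rho>'" using l'(3) by (intro mult_left_mono) auto
      also have "\<dots> < (norm l + 1) * \<rho>'" using \<rho>' by simp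
      also have "\<dots> = d" unfolding \<rho>'_def using l1 by (metis nonzero_mult_div_cancel_left less_irrefl times_divide_eq_right)
      finally show ?thesis .
    qed
    ultimately show ?thesis by linarith
  qed
  then have "\<phi> a < \<phi> c" using sub[OF l(1), of c] by force
  then show False using sub[OF l'(1), of a] l'(6) by (simp add: less_imp_le)
qed

text \<open>The mean value theorem is directed at the endpoint with the smaller value of \<phi>,
  however the tilt ranks the endpoints, because (b) compares untilted values.\<close>

lemma tilt_quasiconvex_on_segment:
  fixes \<phi> :: "'a::banach \<Rightarrow> ereal"
  assumes asp: "asplund_space TYPE('a)" and lsc: "lsc_fun \<phi>" and ninf: "\<And>x. \<phi> x \<noteq> -\<infinity>"
    and sub: "\<And>x y l a b. l \<in> frechet_subdiff \<phi> x \<Longrightarrow> \<phi> x = ereal a \<Longrightarrow> \<phi> y = ereal b \<Longrightarrow> b \<le> a \<Longrightarrow>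
      blinfun_apply l (y - x) \<le> - min (\<alpha> * norm (y - x)) (a - b)"
    and qc: "quasiconvex \<phi>" and v: "norm v \<le> \<alpha>" and le: "\<phi> x \<le> \<phi> y" and T: "0 < T" "T < 1"
  shows "tilt \<phi> v (y + T *\<^sub>R (x - y)) \<le> max (tilt \<phi> v x) (tilt \<phi> v y)"
proof (rule ccontr)
  define z where "z = y + T *\<^sub>R (x - y)"
  assume "\<not> tilt \<phi> v (y + T *\<^sub>R (x - y)) \<le> max (tilt \<phi> v x) (tilt \<phi> v y)"
  then have zx: "tilt \<phi> v x < tilt \<phi> v z" and zy: "tilt \<phi> v y < tilt \<phi> v z" unfolding z_def by (auto simp: not_le)
  obtain a where a: "\<phi> x = ereal a" using zx ninf[of x] unfolding tilt_def by (cases "\<phi> x") auto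
  obtain b where b: "\<phi> y = ereal b" using zy ninf[of y] unfolding tilt_def by (cases "\<phi> y") auto
  \<comment> \<open>Otherwise \<phi> at \<open>z\<close> is at most its value at either endpoint, so
    \<open>v\<close> alone would have to be larger at \<open>z\<close> than at both, which is
    impossible for a linear functional.\<close>
  have "\<phi> x < \<phi> z"
  proof (rule ccontr)
    assume "\<not> \<phi> x < \<phi> z"
    then obtain d where d: "\<phi> z = ereal d" "d \<le> a" using a ninf[of z] by (cases "\<phi> z") auto
    have "a + blinfun_apply v x < d + blinfun_apply v z" "b + blinfun_apply v y < d + blinfun_apply v z"
      using zx zy unfolding tilt_def a b d(1) by auto
    then have "blinfun_apply v x < blinfun_apply v z" "blinfun_apply v y < blinfun_apply v z"
      using d(2) le a b by auto
    moreover have "blinfun_apply v z - blinfun_apply v y = T * blinfun_apply v (x - y)"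
      "blinfun_apply v z - blinfun_apply v x = - ((1 - T) * blinfun_apply v (x - y))"
      unfolding z_def by (simp_all add: blinfun.add_right blinfun.diff_right blinfun.scaleR_right algebra_simps)
    ultimately have "0 < T * blinfun_apply v (x - y)" "(1 - T) * blinfun_apply v (x - y) < 0" by linarith+
    then show False using T by (simp add: zero_less_mult_iff mult_less_0_iff)
  qed
  have seg: "\<phi> x < \<phi> (y + s *\<^sub>R (x - y))" if s: "s \<in> {0..T}" for s
  proof (cases "s = T")
    case True
    then show ?thesis using \<open>\<phi> x < \<phi> z\<close> unfolding z_def by simp
  next
    case False
    have sT: "s \<le> T" using s by simp
    define \<sigma> where "\<sigma> = (T - s) / (1 - s)"
    have \<sigma>: "0 \<le> \<sigma>" "\<sigma> < 1" "\<sigma> = 0 \<longleftrightarrow> s = T"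
      "z = y + s *\<^sub>R (x - y) + \<sigma> *\<^sub>R (x - (y + s *\<^sub>R (x - y)))"
      using convex_combination_via_point[OF sT T(2), where x = x and y = y] unfolding \<sigma>_def z_def by blast+
    let ?p = "y + s *\<^sub>R (x - y)"
    \<comment> \<open>Since \<open>z\<close> lies between \<open>?p\<close> and \<open>x\<close> and
      has a value above \<open>\<phi> x\<close>, the maximum at the ends must come from
      \<open>?p\<close>. The weights in \<open>quasiconvex\<close> are strictly interior, hence the
      separate case \<open>s = T\<close>.\<close>
    have "z = \<sigma> *\<^sub>R x + (1 - \<sigma>) *\<^sub>R ?p" unfolding \<sigma>(4) by (simp add: algebra_simps)
    moreover have "0 < \<sigma>" using \<sigma>(1,3) False by simp
    ultimately have "\<phi> z \<le> max (\<phi> x) (\<phi> ?p)" using qc \<sigma>(2) unfolding quasiconvex_def by blast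
    then show ?thesis using \<open>\<phi> x < \<phi> z\<close> by (auto simp: le_max_iff_disj)
  qed
  have "compact ((\<lambda>s. y + s *\<^sub>R (x - y)) ` {0..T})"
    by (intro compact_continuous_image continuous_intros compact_Icc)
  moreover have "open {u. \<phi> x < \<phi> u}" using lsc by (simp only: lsc_fun_iff_open)
  moreover have "(\<lambda>s. y + s *\<^sub>R (x - y)) ` {0..T} \<subseteq> {u. \<phi> x < \<phi> u}" using seg by blast
  ultimately obtain \<rho> where \<rho>: "0 < \<rho>" "(\<Union>u\<in>(\<lambda>s. y + s *\<^sub>R (x - y)) ` {0..T}. ball u \<rho>) \<subseteq> {u. \<phi> x < \<phi> u}"
    using compact_subset_open_imp_ball_epsilon_subset by blast
  have tninf: "tilt \<phi> v u \<noteq> -\<infinity>" for u using ninf[of u] unfolding tilt_def by simp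
  obtain c t fc fx and l :: "'a \<Rightarrow>\<^sub>L real" where l: "l \<in> frechet_subdiff (tilt \<phi> v) c" "t \<in> {0..T}"
    "norm (c - (y + t *\<^sub>R (x - y))) < \<rho>" "tilt \<phi> v c = ereal fc" "tilt \<phi> v x = ereal fx"
    "0 < blinfun_apply l (x - c)" "fx - fc < blinfun_apply l (x - c)"
    by (rule asplund_mean_value[where f = "tilt \<phi> v" and x = x and y = y and \<rho> = \<rho>, OF asp lsc_tilt[where \<phi> = \<phi>, OF lsc ninf] tninf T])
      (use zx zy \<rho>(1) in \<open>auto simp: z_def\<close>)
  have "c \<in> ball (y + t *\<^sub>R (x - y)) \<rho>" using l(3) by (simp add: dist_norm norm_minus_commute)
  then have xc: "\<phi> x < \<phi> c" using \<rho>(2) l(2) by blast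
  obtain d where d: "\<phi> c = ereal d" using l(4) ninf[of c] unfolding tilt_def by (cases "\<phi> c") auto
  have fd: "fc = d + blinfun_apply v c" "fx = a + blinfun_apply v x" using l(4,5) unfolding tilt_def a d by auto
  \<comment> \<open>If the minimum is its first term, \<open>norm v \<le> \<alpha>\<close> gives
    \<open>l (x - c) \<le> 0\<close>; if it is the second, \<open>l (x - c) \<le> fx - fc\<close>.
    Each contradicts one bound from the mean value theorem.\<close>
  have "blinfun_apply (l - v) (x - c) \<le> - min (\<alpha> * norm (x - c)) (d - a)"
    using frechet_subdiff_tilt[OF l(1) d ninf] d a xc by (intro sub) auto
  then have "blinfun_apply l (x - c) \<le> blinfun_apply v (x - c) - min (\<alpha> * norm (x - c)) (d - a)"
    by (simp add: blinfun.diff_left)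
  moreover have "blinfun_apply v (x - c) \<le> \<alpha> * norm (x - c)"
    using norm_blinfun[of v "x - c"] mult_right_mono[OF v, of "norm (x - c)"] by simp
  moreover have "blinfun_apply v (x - c) - (d - a) = fx - fc" unfolding fd by (simp add: blinfun.diff_right)
  ultimately show False using l(6,7) by (simp add: min_def split: if_splits)
qed

theorem theorem3p1:
  fixes \<phi> :: "'a::banach \<Rightarrow> ereal" and \<alpha> :: real
  assumes "proper_fun \<phi>" and "lsc_fun \<phi>" and "\<alpha> > 0"
  defines "cond_b \<equiv> (\<forall>x y. \<phi> y \<le> \<phi> x \<longrightarrow>
             (\<forall>xs\<in>frechet_subdiff \<phi> x.
                ereal (blinfun_apply xs (y - x)) \<le> - min (ereal (\<alpha> * norm (y - x))) (\<phi> x - \<phi> y)))"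
  shows "(robustly_quasiconvex \<alpha> \<phi> \<longrightarrow> cond_b)
         \<and> (asplund_space TYPE('a) \<longrightarrow> cond_b \<longrightarrow> robustly_quasiconvex \<alpha> \<phi>)"
proof (intro conjI impI)
  have ninf: "\<phi> x \<noteq> -\<infinity>" for x using assms(1) unfolding proper_fun_def by blast
  {
    assume "robustly_quasiconvex \<alpha> \<phi>"
    then show cond_b
      unfolding cond_b_def using subgradient_bound_of_robustly_quasiconvex[where \<phi> = \<phi>, OF _ assms(3) ninf] by blast
  next
    assume asp: "asplund_space TYPE('a)" and cond: cond_b
    have sub: "blinfun_apply l (y - x) \<le> - min (\<alpha> * norm (y - x)) (a - b)"
      if "l \<in> frechet_subdiff \<phi> x" "\<phi> x = ereal a" "\<phi> y = ereal b" "b \<le> a" for x y l a b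
    proof -
      have "\<phi> y \<le> \<phi> x" using that by simp
      have "ereal (blinfun_apply l (y - x)) \<le> - min (ereal (\<alpha> * norm (y - x))) (\<phi> x - \<phi> y)"
        using cond that(1) \<open>\<phi> y \<le> \<phi> x\<close> unfolding cond_b_def by blast
      also have "\<dots> = ereal (- min (\<alpha> * norm (y - x)) (a - b))" using that by (simp add: min_def)
      finally show ?thesis by simp
    qed
    have qc: "quasiconvex \<phi>"
    proof (rule quasiconvex_of_subgradients[where \<phi> = \<phi>, OF asp assms(2) ninf])
      fix x y l assume l: "l \<in> frechet_subdiff \<phi> x" and le: "\<phi> y \<le> \<phi> x"
      obtain a where a: "\<phi> x = ereal a" using frechet_subdiff_finite[OF l ninf] .
      obtain b where b: "\<phi> y = ereal b" using le a ninf[of y] by (cases "\<phi> y") auto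
      have "0 \<le> min (\<alpha> * norm (y - x)) (a - b)" using le a b assms(3) by simp
      moreover have "b \<le> a" using le a b by simp
      ultimately show "blinfun_apply l (y - x) \<le> 0" using sub[OF l a b] by linarith
    qed
    have aux: "tilt \<phi> v (y + T *\<^sub>R (x - y)) \<le> max (tilt \<phi> v x) (tilt \<phi> v y)"
      if "norm v \<le> \<alpha>" "\<phi> x \<le> \<phi> y" "0 < T" "T < 1" for v x y T
      by (rule tilt_quasiconvex_on_segment[where \<phi> = \<phi>, OF asp assms(2) ninf _ qc that]) (rule sub)
    have "tilt \<phi> v (t *\<^sub>R x + (1 - t) *\<^sub>R y) \<le> max (tilt \<phi> v x) (tilt \<phi> v y)"
      if v: "norm v \<le> \<alpha>" and t: "0 < t" "t < 1" for v x y and t :: real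
    proof (cases "\<phi> x \<le> \<phi> y")
      case True
      have "t *\<^sub>R x + (1 - t) *\<^sub>R y = y + t *\<^sub>R (x - y)" by (simp add: algebra_simps)
      then show ?thesis using aux[OF v True t] by simp
    next
      case False
      have "t *\<^sub>R x + (1 - t) *\<^sub>R y = x + (1 - t) *\<^sub>R (y - x)" by (simp add: algebra_simps)
      then show ?thesis using aux[OF v, of y x "1 - t"] False t by (simp add: max.commute)
    qed
    then show "robustly_quasiconvex \<alpha> \<phi>" unfolding robustly_quasiconvex_def quasiconvex_def by blast
  }
qed

end
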